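(* Consider the Lipschitz MAB problem on a compact metric space $(X,\mathcal{D})$, and let $d=\mathrm{MaxMinCOV}(X)$. If $\gamma>\frac{d+1}{d+2}$, then there exists a bandit algorithm $\mathcal{A}$ such that for every problem instance $I$ its regret satisfies $R(t)\le C_I\, t^{\gamma}$ for all $t$, for some constant $C_I$ depending on $I$. No such algorithm exists if $d>0$ and $\gamma<\frac{d+1}{d+2}$.
   Context: Lipschitz MAB problem on a metric space $(X,\mathcal{D})$ (of diameter at most $1$): $(X,\mathcal{D})$ is known to the algorithm. A problem instance consists of an unknown payoff function $\mu:X\to[0,1]$ satisfying $|\mu(x)-\mu(y)|\le \mathcal{D}(x,y)$ for all $x,y$, together with, for each $x\in X$, a distribution on $[0,1]$ with mean $\mu(x)$. In each round $t$ the algorithm chooses an arm $x_t\in X$ and receives a reward drawn independently from the distribution of $x_t$. Regret: $R(t)=t\sup_{x}\mu(x)-\mathbb{E}[\sum_{s=1}^t\mu(x_s)]$. For $Y\subseteq X$ and $r>0$, $N_r(Y)$ is the minimal number of subsets of diameter strictly less than $r$ covering $Y$; $\mathrm{COV}(Y)=\inf\{d\ge0:\exists c\ \forall r>0,\ N_r(Y)\le c\,r^{-d}\}$. The min-covering dimension of $Y\subseteq X$ is $\mathrm{MinCOV}(Y)=\inf\{\mathrm{COV}(U): U\subseteq Y \text{ non-empty and open in } (Y,\mathcal{D})\}$, and the max-min-covering dimension is $\mathrm{MaxMinCOV}(X)=\sup\{\mathrm{MinCOV}(Y):Y\subseteq X\}$.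
   Formalization: In COV the scale r ranges over (0,1] rather than all r>0 (else COV is only 0 or infinity), MaxMinCOV is a supremum over non-empty Y, X is non-empty, and for d = infinity the exponent (d+1)/(d+2) is read as 1. *)

theory Defs
  imports "HOL-Probability.Probability"
begin

section \<open>Covering dimensions\<close>

text \<open>Restricting the covering sets to subsets of \<open>Y\<close> does not change the minimal number, since
  a covering set can be intersected with \<open>Y\<close>. The requirement \<open>bounded S\<close> is there because
  \<^const>\<open>diameter\<close> is only meaningful for bounded sets.\<close>

definition covering_number :: "real \<Rightarrow> 'a::metric_space set \<Rightarrow> enat" where
  "covering_number r Y =
     Inf {enat (card F) |F. finite F \<and> Y \<subseteq> \<Union>F \<and>
            (\<forall>S\<in>F. S \<subseteq> Y \<and> bounded S \<and> diameter S < r)}"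

text \<open>The scale \<open>r\<close> ranges over \<open>(0, 1]\<close>, as the spaces considered have diameter at most \<open>1\<close>. For
  \<open>r \<rightarrow> \<infinity>\<close> the bound \<open>c * r powr (-d)\<close> with \<open>d > 0\<close> tends to \<open>0\<close> and would fail for every nonempty set.
  The value is \<open>\<infinity>\<close> if no \<open>d\<close> qualifies.\<close>

definition COV :: "'a::metric_space set \<Rightarrow> ereal" where
  "COV Y = Inf {ereal d |d. 0 \<le> d \<and>
     (\<exists>c::real. \<forall>r. 0 < r \<and> r \<le> 1 \<longrightarrow> ereal_of_enat (covering_number r Y) \<le> ereal (c * r powr (- d)))}"

definition MinCOV :: "'a::metric_space set \<Rightarrow> ereal" where
  "MinCOV Y = Inf {COV U |U. U \<noteq> {} \<and> openin (top_of_set Y) U}"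

text \<open>The empty set must be excluded, since \<open>MinCOV {}\<close> is an infimum over the empty set,
  hence \<open>\<infinity>\<close>.\<close>

definition MaxMinCOV :: "'a::metric_space set \<Rightarrow> ereal" where
  "MaxMinCOV X = Sup {MinCOV Y |Y. Y \<noteq> {} \<and> Y \<subseteq> X}"

text \<open>The number \<open>(d + 1) / (d + 2)\<close>, with its limit \<open>1\<close> at \<open>d = \<infinity>\<close>; plain \<^typ>\<open>ereal\<close> arithmetic
  would give \<open>\<infinity> / \<infinity> = 0\<close> there.\<close>

definition critical_exponent :: "ereal \<Rightarrow> real" where
  "critical_exponent d =
     (if d = \<infinity> then 1 else (real_of_ereal d + 1) / (real_of_ereal d + 2))"

section \<open>The Lipschitz bandit problem\<close>

text \<open>The set of arms is the space of a measure \<open>M\<close>, of which only the \<open>\<sigma>\<close>-algebra is used: the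
  choices of an algorithm and the reward distributions are probability kernels with respect to it,
  which makes the interaction of the two well-defined. If \<open>M\<close> is \<open>count_space X\<close>, then measurability
  of the reward distributions is no restriction; if \<open>M\<close> is the Borel \<open>\<sigma>\<close>-algebra of \<open>X\<close>, then all
  Borel randomized algorithms are covered.

  An instance is a payoff function \<open>\<mu>\<close> with a reward distribution \<open>P x\<close> for each arm \<open>x\<close>.\<close>

definition lipschitz_instance ::
  "'a::metric_space measure \<Rightarrow> ('a \<Rightarrow> real) \<Rightarrow> ('a \<Rightarrow> real measure) \<Rightarrow> bool" where
  "lipschitz_instance M \<mu> P \<longleftrightarrow>
     (\<forall>x\<in>space M. 0 \<le> \<mu> x \<and> \<mu> x \<le> 1) \<and>
     1-lipschitz_on (space M) \<mu> \<and>
     P \<in> M \<rightarrow>\<^sub>M prob_algebra borel \<and>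
     (\<forall>x\<in>space M. (AE y in P x. 0 \<le> y \<and> y \<le> 1) \<and> (\<integral>y. y \<partial>P x) = \<mu> x)"

text \<open>Rounds are numbered from \<open>0\<close>; a history of \<open>t\<close> rounds records the pairs of arm and reward of
  the rounds \<open>0, \<dots>, t - 1\<close>.\<close>

abbreviation history_space :: "'a measure \<Rightarrow> nat \<Rightarrow> (nat \<Rightarrow> 'a \<times> real) measure" where
  "history_space M t \<equiv> (\<Pi>\<^sub>M s\<in>{0..<t}. M \<Otimes>\<^sub>M borel)"

text \<open>A (randomized) algorithm maps the history before round \<open>t\<close> to the distribution of the arm
  chosen in round \<open>t\<close>.\<close>

type_synonym 'a algorithm = "nat \<Rightarrow> (nat \<Rightarrow> 'a \<times> real) \<Rightarrow> 'a measure"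

definition bandit_algorithm :: "'a measure \<Rightarrow> 'a algorithm \<Rightarrow> bool" where
  "bandit_algorithm M A \<longleftrightarrow> (\<forall>t. A t \<in> history_space M t \<rightarrow>\<^sub>M prob_algebra M)"

primrec history_law ::
  "'a measure \<Rightarrow> 'a algorithm \<Rightarrow> ('a \<Rightarrow> real measure) \<Rightarrow> nat \<Rightarrow> (nat \<Rightarrow> 'a \<times> real) measure" where
  "history_law M A P 0 = return (history_space M 0) (\<lambda>_. undefined)"
| "history_law M A P (Suc t) = do {
     h \<leftarrow> history_law M A P t;
     x \<leftarrow> A t h;
     y \<leftarrow> P x;
     return (history_space M (Suc t)) (h(t := (x, y)))
   }"

definition regret ::
  "'a measure \<Rightarrow> 'a algorithm \<Rightarrow> ('a \<Rightarrow> real) \<Rightarrow> ('a \<Rightarrow> real measure) \<Rightarrow> nat \<Rightarrow> real" where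
  "regret M A \<mu> P t =
     real t * (SUP x\<in>space M. \<mu> x) - (\<integral>h. (\<Sum>s<t. \<mu> (fst (h s))) \<partial>history_law M A P t)"

definition achieves_rate :: "'a::metric_space measure \<Rightarrow> 'a algorithm \<Rightarrow> real \<Rightarrow> bool" where
  "achieves_rate M A \<gamma> \<longleftrightarrow>
     (\<forall>\<mu> P. lipschitz_instance M \<mu> P \<longrightarrow>
        (\<exists>C::real. \<forall>t\<ge>1. regret M A \<mu> P t \<le> C * real t powr \<gamma>))"

lemma history_law_in_prob_algebra:
  assumes A: "bandit_algorithm M A" and P: "P \<in> M \<rightarrow>\<^sub>M prob_algebra borel"
  shows "history_law M A P t \<in> space (prob_algebra (history_space M t))"
proof (induction t)
  case 0
  show ?case
    by (auto simp: space_prob_algebra space_PiM intro!: prob_space_return)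
next
  case (Suc t)
  have [measurable]: "A t \<in> history_space M t \<rightarrow>\<^sub>M prob_algebra M"
    using A by (simp add: bandit_algorithm_def)
  note P[measurable]
  have [measurable]: "(\<lambda>z. (fst (fst z))(t := (snd (fst z), snd z)))
      \<in> (history_space M t \<Otimes>\<^sub>M M) \<Otimes>\<^sub>M borel \<rightarrow>\<^sub>M history_space M (Suc t)"
    by (rule measurable_fun_upd[where J = "{0..<t}"]) (auto simp: atLeast0_lessThan_Suc)
  have K: "(\<lambda>h. A t h \<bind> (\<lambda>x. P x \<bind> (\<lambda>y. return (history_space M (Suc t)) (h(t := (x, y))))))
      \<in> history_space M t \<rightarrow>\<^sub>M prob_algebra (history_space M (Suc t))"
    by (intro measurable_bind_prob_space2[where N = M] measurable_bind_prob_space2[where N = borel]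
        measurable_compose[OF _ measurable_return_prob_space])
      (simp_all add: case_prod_beta)
  show ?case
    using prob_space_bind'[OF Suc K] sets_bind'[OF Suc K] by (simp add: space_prob_algebra)
qed

end

theory Submission
  imports Defs "HOL-Real_Asymp.Real_Asymp"
begin

text \<open>
  Upper bound: if \<open>MaxMinCOV X < d\<close>, then \<open>X\<close> is a countable union of sets \<open>T\<^sub>i\<close> with
  \<open>COV T\<^sub>i < d\<close>. In phase \<open>k\<close>, which lasts \<open>2\<^sup>k\<close> rounds, exponential weights on importance-weighted
  losses are run on a union of \<open>2\<^bsup>-\<beta>k\<^esup>\<close>-nets of those \<open>T\<^sub>i\<close>, \<open>i < k\<close>, that are small enough at
  that scale, where \<open>\<beta> = 1 - \<gamma>\<close>. An optimal arm lies in some \<open>T\<^sub>i\<close>, which takes part in all but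
  finitely many phases; the other phases only affect the constant.

  Lower bound: if \<open>MinCOV Y > d\<close>, an instance is built against a given algorithm by adding to a
  constant payoff bumps with shrinking nested supports centred in \<open>Y\<close>. At every stage the plateau of
  the last bump contains many disjoint balls, and the next bump is put on a ball that the algorithm
  rarely visits under the current payoff. All later bumps live in the same ball, so the final
  instance differs from the current one only there, and a likelihood ratio argument shows that the
  algorithm cannot notice the difference in time.
\<close>

section \<open>Expectations along the interaction\<close>

text \<open>The bound \<open>MaxMinCOV X < d\<close> yields pieces of small covering dimension but
  no common covering constant. With N arms, N of order at most 2 powr (k a) in phase k,
  discretization costs 2 powr (k (1 - \<beta>)) and exponential weights cost ln N / \<eta> + 2^k
  \<eta> N / 2. Some \<eta> brings the sum to order 2 powr (k (1 - \<beta>)) as soon as a < 1 - 2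
  \<beta>; together with a > \<beta> d this asks for \<beta> (d + 2) < 1, which is \<gamma> > (d +
  1) / (d + 2). The analysis uses expectations only, no concentration of rewards. In the lower bound
  a bump of height H on one of m balls goes unnoticed for about m / H^2 rounds. With m of order r
  powr (- d) and H proportional to r this is r powr (- (d + 2)) rounds, and the regret is r powr (-
  (d + 1)). A single instance has to beat the rate at infinitely many times, by a factor that grows
  from stage to stage, so that no constant survives.\<close>

lemma sets_history_law:
  assumes "bandit_algorithm M A" and "P \<in> M \<rightarrow>\<^sub>M prob_algebra borel"
  shows "sets (history_law M A P t) = sets (history_space M t)"
    and "prob_space (history_law M A P t)"
  using history_law_in_prob_algebra[OF assms, of t] by (auto simp: space_prob_algebra)

lemma measurable_history_update:
  "(\<lambda>z. (fst (fst z))(t := (snd (fst z), snd z)))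
      \<in> (history_space M t \<Otimes>\<^sub>M M) \<Otimes>\<^sub>M borel \<rightarrow>\<^sub>M history_space M (Suc t)"
  by (rule measurable_fun_upd[where J = "{0..<t}"]) (auto simp: atLeast0_lessThan_Suc)

lemma history_update_in_space:
  "h \<in> space (history_space M t) \<Longrightarrow> x \<in> space M \<Longrightarrow>
    h(t := (x, y)) \<in> space (history_space M (Suc t))"
  by (auto simp: space_PiM space_pair_measure PiE_iff extensional_def)

lemma history_arm_in_space:
  "h \<in> space (history_space M t) \<Longrightarrow> s < t \<Longrightarrow> fst (h s) \<in> space M"
  by (auto simp: space_PiM space_pair_measure PiE_iff mem_Times_iff)

text \<open>Pushing \<open>K x\<close> forward along \<open>\<lambda>y. (x, y)\<close> gives a
  kernel into the product space. The parameter thus moves from the integrand into the measure, where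
  measurability of integration against a kernel applies.\<close>

lemma measurable_integral_kernel:
  fixes f :: "'b \<Rightarrow> 'c \<Rightarrow> real"
  assumes K: "K \<in> N \<rightarrow>\<^sub>M prob_algebra L"
    and f: "(\<lambda>z. f (fst z) (snd z)) \<in> borel_measurable (N \<Otimes>\<^sub>M L)"
  shows "(\<lambda>x. \<integral>y. f x y \<partial>K x) \<in> borel_measurable N"
proof -
  note measurable_prob_algebraD[OF K, measurable]
  note f[measurable]
  have [measurable]: "(\<lambda>x. distr (K x) (N \<Otimes>\<^sub>M L) (\<lambda>y. (x, y))) \<in> N \<rightarrow>\<^sub>M subprob_algebra (N \<Otimes>\<^sub>M L)"
    by (rule measurable_distr2[where M = L]) measurable
  have "(\<lambda>x. integral\<^sup>L (distr (K x) (N \<Otimes>\<^sub>M L) (\<lambda>y. (x, y))) (\<lambda>z. f (fst z) (snd z)))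
     \<in> borel_measurable N"
    by (rule measurable_compose[OF _ integral_measurable_subprob_algebra]) measurable
  moreover have "integral\<^sup>L (distr (K x) (N \<Otimes>\<^sub>M L) (\<lambda>y. (x, y))) (\<lambda>z. f (fst z) (snd z)) =
      (\<integral>y. f x y \<partial>K x)" if x: "x \<in> space N" for x
  proof -
    have s: "sets (K x) = sets L"
      using measurable_space[OF K x] by (simp add: space_prob_algebra)
    have "(\<lambda>y. (x, y)) \<in> K x \<rightarrow>\<^sub>M N \<Otimes>\<^sub>M L"
      unfolding measurable_cong_sets[OF s refl] using x by simp
    then show ?thesis
      by (subst integral_distr) (use f in auto)
  qed
  ultimately show ?thesis
    by (simp cong: measurable_cong)
qed

lemma (in prob_space) abs_integral_le_const:
  assumes "\<And>x. x \<in> space M \<Longrightarrow> \<bar>f x\<bar> \<le> B"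
  shows "\<bar>\<integral>x. f x \<partial>M\<bar> \<le> (B :: real)"
proof -
  have "\<bar>\<integral>x. f x \<partial>M\<bar> \<le> (\<integral>x. \<bar>f x\<bar> \<partial>M)"
    by simp
  also have "\<dots> \<le> B"
  proof (cases "integrable M (\<lambda>x. \<bar>f x\<bar>)")
    case True
    then show ?thesis
      using integral_le_const[of "\<lambda>x. \<bar>f x\<bar>" B] assms by (auto intro: AE_I2)
  next
    \<comment> \<open>A non-integrable function has integral 0, and \<open>B\<close> is nonnegative
      because the space of a probability measure is inhabited.\<close>
    case False
    obtain x where "x \<in> space M"
      using not_empty by blast
    with assms[OF this] False show ?thesis
      by (simp add: not_integrable_integral_eq)
  qed
  finally show ?thesis .
qed

lemma (in prob_space) integrable_abs_le_const:
  assumes "f \<in> borel_measurable M" "\<And>x. x \<in> space M \<Longrightarrow> \<bar>f x\<bar> \<le> (B::real)"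
  shows "integrable M f"
  by (rule integrable_const_bound[of _ B]) (use assms in \<open>auto intro: AE_I2\<close>)

lemma integral_bind_kernel:
  fixes f :: "'c \<Rightarrow> real"
  assumes Q: "Q \<in> space (prob_algebra N)" and K: "K \<in> N \<rightarrow>\<^sub>M prob_algebra L"
    and f: "f \<in> borel_measurable L" and B: "\<And>x. x \<in> space L \<Longrightarrow> \<bar>f x\<bar> \<le> B"
  shows "(\<integral>y. f y \<partial>(Q \<bind> K)) = (\<integral>x. (\<integral>y. f y \<partial>K x) \<partial>Q)"
proof -
  have s: "sets Q = sets N" and p: "prob_space Q"
    using Q by (auto simp: space_prob_algebra)
  have sp: "space Q = space N" by (rule sets_eq_imp_space_eq[OF s])
  have K': "K \<in> Q \<rightarrow>\<^sub>M subprob_algebra L"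
    unfolding measurable_cong_sets[OF s refl] by (rule measurable_prob_algebraD[OF K])
  have pK: "prob_space (K x)" if "x \<in> space Q" for x
    using measurable_space[OF K] that sp by (auto simp: space_prob_algebra)
  interpret Q: prob_space Q by (rule p)
  have "emeasure (K x) (space (K x)) \<le> ennreal 1" if "x \<in> space Q" for x
    using prob_space.emeasure_space_1[OF pK[OF that]] by simp
  then show ?thesis
    by (intro integral_bind[OF f B K', where B' = 1] Q.finite_measure_axioms AE_I2) auto
qed

text \<open>The first kernel depends jointly on history and arm; freezing the history in it gives
  the measurability in the arm that unfolding the inner bind requires.\<close>

lemma bandit_kernel:
  assumes A: "bandit_algorithm M A" and P: "P \<in> M \<rightarrow>\<^sub>M prob_algebra borel"
  shows "(\<lambda>z. P (snd z) \<bind> (\<lambda>y. return (history_space M (Suc t)) ((fst z)(t := (snd z, y)))))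
      \<in> history_space M t \<Otimes>\<^sub>M M \<rightarrow>\<^sub>M prob_algebra (history_space M (Suc t))"
    and "(\<lambda>h. A t h \<bind> (\<lambda>x. P x \<bind> (\<lambda>y. return (history_space M (Suc t)) (h(t := (x, y))))))
      \<in> history_space M t \<rightarrow>\<^sub>M prob_algebra (history_space M (Suc t))"
proof -
  have [measurable]: "A t \<in> history_space M t \<rightarrow>\<^sub>M prob_algebra M"
    using A by (simp add: bandit_algorithm_def)
  note P[measurable] measurable_history_update[measurable]
  show "(\<lambda>z. P (snd z) \<bind> (\<lambda>y. return (history_space M (Suc t)) ((fst z)(t := (snd z, y)))))
      \<in> history_space M t \<Otimes>\<^sub>M M \<rightarrow>\<^sub>M prob_algebra (history_space M (Suc t))"
    by (intro measurable_bind_prob_space2[where N = borel]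
        measurable_compose[OF _ measurable_return_prob_space])
      (simp_all add: case_prod_beta)
  show "(\<lambda>h. A t h \<bind> (\<lambda>x. P x \<bind> (\<lambda>y. return (history_space M (Suc t)) (h(t := (x, y))))))
      \<in> history_space M t \<rightarrow>\<^sub>M prob_algebra (history_space M (Suc t))"
    by (intro measurable_bind_prob_space2[where N = M] measurable_bind_prob_space2[where N = borel]
        measurable_compose[OF _ measurable_return_prob_space])
      (simp_all add: case_prod_beta)
qed

text \<open>Tower rule for the last round: boundedness allows the three binds of
  \<open>history_law\<close> to be integrated in turn. The further claims give the measurability and
  the bounds needed to iterate the rule and to compare integrands.\<close>

lemma integral_history_law_Suc:
  fixes f :: "(nat \<Rightarrow> 'a \<times> real) \<Rightarrow> real"
  assumes A: "bandit_algorithm M A" and P: "P \<in> M \<rightarrow>\<^sub>M prob_algebra borel"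
    and f: "f \<in> borel_measurable (history_space M (Suc t))"
    and B: "\<And>h. h \<in> space (history_space M (Suc t)) \<Longrightarrow> \<bar>f h\<bar> \<le> B"
  shows "(\<integral>h. f h \<partial>history_law M A P (Suc t)) =
      (\<integral>h. (\<integral>x. (\<integral>y. f (h(t := (x, y))) \<partial>P x) \<partial>A t h) \<partial>history_law M A P t)"
    and "(\<lambda>h. \<integral>x. (\<integral>y. f (h(t := (x, y))) \<partial>P x) \<partial>A t h) \<in> borel_measurable (history_space M t)"
    and "h \<in> space (history_space M t) \<Longrightarrow>
      \<bar>\<integral>x. (\<integral>y. f (h(t := (x, y))) \<partial>P x) \<partial>A t h\<bar> \<le> B"
    and "h \<in> space (history_space M t) \<Longrightarrow>
      (\<lambda>x. \<integral>y. f (h(t := (x, y))) \<partial>P x) \<in> borel_measurable M"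
proof -
  have At: "A t \<in> history_space M t \<rightarrow>\<^sub>M prob_algebra M"
    using A by (simp add: bandit_algorithm_def)
  let ?H = "history_space M t" and ?H' = "history_space M (Suc t)"
  have f1: "(\<lambda>z. f ((fst (fst z))(t := (snd (fst z), snd z)))) \<in> borel_measurable ((?H \<Otimes>\<^sub>M M) \<Otimes>\<^sub>M borel)"
    by (rule measurable_compose[OF measurable_history_update f])
  have P': "(\<lambda>z. P (snd z)) \<in> ?H \<Otimes>\<^sub>M M \<rightarrow>\<^sub>M prob_algebra borel"
    using P by measurable
  have f2: "(\<lambda>z. \<integral>y. f ((fst z)(t := (snd z, y))) \<partial>P (snd z)) \<in> borel_measurable (?H \<Otimes>\<^sub>M M)"
    by (rule measurable_integral_kernel[OF P'], use f1 in simp)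
  show m: "(\<lambda>h. \<integral>x. (\<integral>y. f (h(t := (x, y))) \<partial>P x) \<partial>A t h) \<in> borel_measurable ?H"
    by (rule measurable_integral_kernel[OF At], use f2 in simp)
  have m1: "(\<lambda>x. \<integral>y. f (h(t := (x, y))) \<partial>P x) \<in> borel_measurable M" if "h \<in> space ?H" for h
  proof -
    have "(\<lambda>x. (h, x)) \<in> M \<rightarrow>\<^sub>M ?H \<Otimes>\<^sub>M M"
      using that by simp
    from measurable_compose[OF this f2] show ?thesis by simp
  qed
  have Px: "prob_space (P x)" "sets (P x) = sets borel" if "x \<in> space M" for x
    using measurable_space[OF P that] by (auto simp: space_prob_algebra)
  have Ah: "prob_space (A t h)" "sets (A t h) = sets M" "space (A t h) = space M" if "h \<in> space ?H" for h
    using measurable_space[OF At that] by (auto simp: space_prob_algebra dest: sets_eq_imp_space_eq)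
  have b1: "\<bar>\<integral>y. f (h(t := (x, y))) \<partial>P x\<bar> \<le> B" if "h \<in> space ?H" "x \<in> space M" for h x
    using prob_space.abs_integral_le_const[OF Px(1)] B history_update_in_space that by metis
  have b2: "\<bar>\<integral>x. (\<integral>y. f (h(t := (x, y))) \<partial>P x) \<partial>A t h\<bar> \<le> B" if "h \<in> space ?H" for h
    by (rule prob_space.abs_integral_le_const[OF Ah(1)[OF that]]) (use b1 Ah that in auto)
  show "h \<in> space ?H \<Longrightarrow> \<bar>\<integral>x. (\<integral>y. f (h(t := (x, y))) \<partial>P x) \<partial>A t h\<bar> \<le> B"
    by (rule b2)
  show "h \<in> space ?H \<Longrightarrow> (\<lambda>x. \<integral>y. f (h(t := (x, y))) \<partial>P x) \<in> borel_measurable M"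
    by (rule m1)
  note Q = history_law_in_prob_algebra[OF A P, of t]
  have "(\<integral>h. f h \<partial>history_law M A P (Suc t)) =
      (\<integral>h. (\<integral>h'. f h' \<partial>(A t h \<bind> (\<lambda>x. P x \<bind> (\<lambda>y. return ?H' (h(t := (x, y))))))) \<partial>history_law M A P t)"
    by (simp add: integral_bind_kernel[OF Q bandit_kernel(2)[OF A P] f B])
  also have "\<dots> = (\<integral>h. (\<integral>x. (\<integral>y. f (h(t := (x, y))) \<partial>P x) \<partial>A t h) \<partial>history_law M A P t)"
  proof (rule Bochner_Integration.integral_cong[OF refl])
    fix h assume "h \<in> space (history_law M A P t)"
    then have h: "h \<in> space ?H"
      using sets_history_law[OF A P] by (simp add: sets_eq_imp_space_eq[of "history_law M A P t" ?H])
    have k1: "(\<lambda>x. P x \<bind> (\<lambda>y. return ?H' (h(t := (x, y))))) \<in> M \<rightarrow>\<^sub>M prob_algebra ?H'"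
    proof -
      have "(\<lambda>x. (h, x)) \<in> M \<rightarrow>\<^sub>M ?H \<Otimes>\<^sub>M M"
        using h by simp
      from measurable_compose[OF this bandit_kernel(1)[OF A P]] show ?thesis by simp
    qed
    have "(\<integral>h'. f h' \<partial>(A t h \<bind> (\<lambda>x. P x \<bind> (\<lambda>y. return ?H' (h(t := (x, y))))))) =
       (\<integral>x. (\<integral>h'. f h' \<partial>(P x \<bind> (\<lambda>y. return ?H' (h(t := (x, y)))))) \<partial>A t h)"
      by (rule integral_bind_kernel[OF measurable_space[OF At h] k1 f B])
    also have "\<dots> = (\<integral>x. (\<integral>y. f (h(t := (x, y))) \<partial>P x) \<partial>A t h)"
    proof (rule Bochner_Integration.integral_cong[OF refl])
      fix x assume "x \<in> space (A t h)"
      then have x: "x \<in> space M" using Ah[OF h] by simp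
      have m3: "(\<lambda>y. h(t := (x, y))) \<in> borel \<rightarrow>\<^sub>M ?H'"
      proof -
        have "(\<lambda>y. ((h, x), y)) \<in> borel \<rightarrow>\<^sub>M (?H \<Otimes>\<^sub>M M) \<Otimes>\<^sub>M borel"
          using h x by (simp add: space_pair_measure)
        from measurable_compose[OF this measurable_history_update] show ?thesis by simp
      qed
      have "(\<integral>h'. f h' \<partial>(P x \<bind> (\<lambda>y. return ?H' (h(t := (x, y)))))) =
        (\<integral>y. (\<integral>h'. f h' \<partial>return ?H' (h(t := (x, y)))) \<partial>P x)"
        by (rule integral_bind_kernel[OF measurable_space[OF P x] _ f B])
          (rule measurable_compose[OF m3 measurable_return_prob_space])
      also have "\<dots> = (\<integral>y. f (h(t := (x, y))) \<partial>P x)"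
        by (intro Bochner_Integration.integral_cong[OF refl] integral_return f
            history_update_in_space h x)
      finally show "(\<integral>h'. f h' \<partial>(P x \<bind> (\<lambda>y. return ?H' (h(t := (x, y)))))) =
        (\<integral>y. f (h(t := (x, y))) \<partial>P x)" .
    qed
    finally show "(\<integral>h'. f h' \<partial>(A t h \<bind> (\<lambda>x. P x \<bind> (\<lambda>y. return ?H' (h(t := (x, y))))))) =
       (\<integral>x. (\<integral>y. f (h(t := (x, y))) \<partial>P x) \<partial>A t h)" .
  qed
  finally show "(\<integral>h. f h \<partial>history_law M A P (Suc t)) =
      (\<integral>h. (\<integral>x. (\<integral>y. f (h(t := (x, y))) \<partial>P x) \<partial>A t h) \<partial>history_law M A P t)" .
qed

text \<open>The one-round supermartingale step, through which both the potential of exponential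
  weights and the compensated log-likelihood are shown to decrease in expectation.\<close>

lemma integral_history_law_Suc_le:
  fixes f :: "(nat \<Rightarrow> 'a \<times> real) \<Rightarrow> real"
  assumes A: "bandit_algorithm M A" and P: "P \<in> M \<rightarrow>\<^sub>M prob_algebra borel"
    and f: "f \<in> borel_measurable (history_space M (Suc t))"
    and B: "\<And>h. h \<in> space (history_space M (Suc t)) \<Longrightarrow> \<bar>f h\<bar> \<le> B"
    and g: "g \<in> borel_measurable (history_space M t)"
    and C: "\<And>h. h \<in> space (history_space M t) \<Longrightarrow> \<bar>g h\<bar> \<le> C"
    and le: "\<And>h. h \<in> space (history_space M t) \<Longrightarrow>
      (\<integral>x. (\<integral>y. f (h(t := (x, y))) \<partial>P x) \<partial>A t h) \<le> g h"
  shows "(\<integral>h. f h \<partial>history_law M A P (Suc t)) \<le> (\<integral>h. g h \<partial>history_law M A P t)"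
proof -
  note s = sets_history_law[OF A P, of t]
  have sp: "space (history_law M A P t) = space (history_space M t)"
    by (rule sets_eq_imp_space_eq[OF s(1)])
  interpret prob_space "history_law M A P t" by (rule s(2))
  note step = integral_history_law_Suc[OF A P f B]
  have "(\<integral>h. (\<integral>x. (\<integral>y. f (h(t := (x, y))) \<partial>P x) \<partial>A t h) \<partial>history_law M A P t) \<le>
      (\<integral>h. g h \<partial>history_law M A P t)"
  proof (rule integral_mono)
    show "integrable (history_law M A P t) (\<lambda>h. \<integral>x. (\<integral>y. f (h(t := (x, y))) \<partial>P x) \<partial>A t h)"
      by (rule integrable_abs_le_const[where B = B])
        (use step(2,3) sp in \<open>auto simp: measurable_cong_sets[OF s(1) refl]\<close>)
    show "integrable (history_law M A P t) g"
      by (rule integrable_abs_le_const[where B = C])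
        (use g C sp in \<open>auto simp: measurable_cong_sets[OF s(1) refl]\<close>)
  qed (use le sp in auto)
  with step(1) show ?thesis by linarith
qed

lemma integrable_history_law:
  fixes f :: "(nat \<Rightarrow> 'a \<times> real) \<Rightarrow> real"
  assumes A: "bandit_algorithm M A" and P: "P \<in> M \<rightarrow>\<^sub>M prob_algebra borel"
    and f: "f \<in> borel_measurable (history_space M t)"
    and B: "\<And>h. h \<in> space (history_space M t) \<Longrightarrow> \<bar>f h\<bar> \<le> B"
  shows "integrable (history_law M A P t) f"
proof -
  note s = sets_history_law[OF A P, of t]
  interpret prob_space "history_law M A P t" by (rule s(2))
  show ?thesis
    by (rule integrable_abs_le_const[where B = B])
      (use f B sets_eq_imp_space_eq[OF s(1)] in \<open>auto simp: measurable_cong_sets[OF s(1) refl]\<close>)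
qed

lemma measurable_history_arm:
  assumes "s < t" and g: "g \<in> M \<rightarrow>\<^sub>M N"
  shows "(\<lambda>h. g (fst (h s))) \<in> history_space M t \<rightarrow>\<^sub>M N"
proof -
  have "(\<lambda>h. h s) \<in> history_space M t \<rightarrow>\<^sub>M M \<Otimes>\<^sub>M borel"
    using assms by (intro measurable_component_singleton) auto
  from measurable_compose[OF measurable_compose[OF this measurable_fst] g] show ?thesis .
qed

lemma measurable_history_reward:
  assumes "s < t"
  shows "(\<lambda>h. snd (h s)) \<in> borel_measurable (history_space M t)"
proof -
  have "(\<lambda>h. h s) \<in> history_space M t \<rightarrow>\<^sub>M M \<Otimes>\<^sub>M borel"
    using assms by (intro measurable_component_singleton) auto
  from measurable_compose[OF this measurable_snd] show ?thesis .
qed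

lemma
  assumes A: "bandit_algorithm M A" and h: "h \<in> space (history_space M t)"
  shows space_arm_law: "space (A t h) = space M"
    and sets_arm_law: "sets (A t h) = sets M"
    and prob_space_arm_law: "prob_space (A t h)"
proof -
  have At: "A t \<in> history_space M t \<rightarrow>\<^sub>M prob_algebra M"
    using A by (simp add: bandit_algorithm_def)
  show "prob_space (A t h)"
    and *: "sets (A t h) = sets M"
    using measurable_space[OF At h] by (auto simp: space_prob_algebra)
  show "space (A t h) = space M"
    by (rule sets_eq_imp_space_eq[OF *])
qed

lemma measurable_history_update_reward:
  assumes "h \<in> space (history_space M t)" "x \<in> space M"
    "f \<in> borel_measurable (history_space M (Suc t))"
  shows "(\<lambda>y. f (h(t := (x, y)))) \<in> borel_measurable borel"
proof -
  have "(\<lambda>y. ((h, x), y)) \<in> borel \<rightarrow>\<^sub>M (history_space M t \<Otimes>\<^sub>M M) \<Otimes>\<^sub>M borel"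
    using assms by (simp add: space_pair_measure)
  from measurable_compose[OF measurable_compose[OF this measurable_history_update] assms(3)]
  show ?thesis by simp
qed

lemma measurable_arm_sum:
  assumes "g \<in> borel_measurable M"
  shows "(\<lambda>h. \<Sum>s<t. g (fst (h s)) :: real) \<in> borel_measurable (history_space M t)"
  using assms by (intro borel_measurable_sum measurable_history_arm) auto

lemma abs_arm_sum_le:
  assumes "h \<in> space (history_space M t)" "\<And>x. x \<in> space M \<Longrightarrow> \<bar>g x\<bar> \<le> C"
  shows "\<bar>\<Sum>s<t. g (fst (h s)) :: real\<bar> \<le> t * C"
proof -
  have "\<bar>\<Sum>s<t. g (fst (h s))\<bar> \<le> (\<Sum>s<t. \<bar>g (fst (h s))\<bar>)"
    by (rule sum_abs)
  also have "\<dots> \<le> (\<Sum>s<t. C)"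
    using assms history_arm_in_space[OF assms(1)] by (intro sum_mono) auto
  finally show ?thesis by simp
qed

section \<open>Changing the reward means\<close>

text \<open>\<open>point_measure\<close> carries the discrete \<sigma>-algebra on \<open>F\<close>;
  the identity pushes it into the \<sigma>-algebra of \<open>N\<close>, as required of a kernel into
  \<open>prob_algebra N\<close>.\<close>

definition finite_dist :: "'b measure \<Rightarrow> 'b set \<Rightarrow> ('b \<Rightarrow> real) \<Rightarrow> 'b measure" where
  "finite_dist N F p = distr (point_measure F (\<lambda>i. ennreal (p i))) N (\<lambda>i. i)"

lemma integral_finite_dist:
  fixes f :: "'b \<Rightarrow> real"
  assumes "finite F" "F \<subseteq> space N" "f \<in> borel_measurable N" "\<And>i. i \<in> F \<Longrightarrow> 0 \<le> p i"
  shows "(\<integral>x. f x \<partial>finite_dist N F p) = (\<Sum>i\<in>F. p i * f i)"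
  unfolding finite_dist_def
  by (subst integral_distr) (use assms in \<open>auto simp: lebesgue_integral_point_measure_finite\<close>)

lemma AE_finite_dist:
  assumes "finite F" "F \<subseteq> space N" "{x \<in> space N. Q x} \<in> sets N" "\<And>i. i \<in> F \<Longrightarrow> Q i"
  shows "AE x in finite_dist N F p. Q x"
  unfolding finite_dist_def
  by (subst AE_distr_iff) (use assms in \<open>auto simp: AE_point_measure\<close>)

lemma finite_dist_kernel:
  assumes F: "finite F" "F \<subseteq> space N"
    and m: "\<And>i. i \<in> F \<Longrightarrow> (\<lambda>z. p z i) \<in> borel_measurable L"
    and p: "\<And>z i. z \<in> space L \<Longrightarrow> i \<in> F \<Longrightarrow> 0 \<le> p z i"
      "\<And>z. z \<in> space L \<Longrightarrow> (\<Sum>i\<in>F. p z i) = 1"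
  shows "(\<lambda>z. finite_dist N F (p z)) \<in> L \<rightarrow>\<^sub>M prob_algebra N"
proof -
  have e: "emeasure (finite_dist N F (p z)) S = (\<Sum>i\<in>F \<inter> S. ennreal (p z i))"
    if "S \<in> sets N" for z S
    unfolding finite_dist_def using F that sets.sets_into_space[OF that]
    by (subst emeasure_distr)
      (auto simp: emeasure_point_measure_finite space_point_measure Int_commute)
  have pr: "prob_space (finite_dist N F (p z))" if "z \<in> space L" for z
  proof
    have "emeasure (finite_dist N F (p z)) (space N) = (\<Sum>i\<in>F. ennreal (p z i))"
      using e[OF sets.top] F by (simp add: Int_absorb2)
    also have "\<dots> = ennreal (\<Sum>i\<in>F. p z i)"
      using p(1)[OF that] by (intro sum_ennreal) auto
    finally show "emeasure (finite_dist N F (p z)) (space (finite_dist N F (p z))) = 1"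
      using p(2)[OF that] by (simp add: finite_dist_def)
  qed
  have "(\<lambda>z. finite_dist N F (p z)) \<in> L \<rightarrow>\<^sub>M subprob_algebra N"
  proof (rule measurable_subprob_algebra)
    fix S assume S: "S \<in> sets N"
    have "(\<lambda>z. \<Sum>i\<in>F \<inter> S. ennreal (p z i)) \<in> borel_measurable L"
      using m by (intro borel_measurable_sum measurable_compose[OF _ measurable_ennreal]) auto
    then show "(\<lambda>z. emeasure (finite_dist N F (p z)) S) \<in> borel_measurable L"
      by (simp add: e[OF S])
  qed (use pr in \<open>auto intro: prob_space_imp_subprob_space simp: finite_dist_def\<close>)
  with pr show ?thesis
    by (intro measurable_prob_algebraI)
qed

definition bernoulli_dist :: "real \<Rightarrow> real measure" where
  "bernoulli_dist m = finite_dist borel {0, 1} (\<lambda>y. if y = 1 then m else 1 - m)"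

lemma bernoulli_dist_kernel:
  assumes "\<mu> \<in> borel_measurable M" "\<And>x. x \<in> space M \<Longrightarrow> 0 \<le> \<mu> x \<and> \<mu> x \<le> 1"
  shows "(\<lambda>x. bernoulli_dist (\<mu> x)) \<in> M \<rightarrow>\<^sub>M prob_algebra borel"
  unfolding bernoulli_dist_def
  by (rule finite_dist_kernel) (use assms in auto)

lemma integral_bernoulli_dist:
  assumes "f \<in> borel_measurable borel" "0 \<le> m" "m \<le> 1"
  shows "(\<integral>y. f y \<partial>bernoulli_dist m) = m * f 1 + (1 - m) * (f 0 :: real)"
  unfolding bernoulli_dist_def
  by (subst integral_finite_dist) (use assms in auto)

text \<open>Likelihood ratio of one round. Every reward other than 1 is treated as 0: the Bernoulli
  laws charge nothing else, and the ratio stays bounded on all histories.\<close>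

definition bernoulli_ratio :: "('a \<Rightarrow> real) \<Rightarrow> ('a \<Rightarrow> real) \<Rightarrow> 'a \<times> real \<Rightarrow> real" where
  "bernoulli_ratio \<mu> \<nu> z =
     (if snd z = 1 then \<nu> (fst z) / \<mu> (fst z) else (1 - \<nu> (fst z)) / (1 - \<mu> (fst z)))"

definition likelihood_ratio ::
  "('a \<Rightarrow> real) \<Rightarrow> ('a \<Rightarrow> real) \<Rightarrow> nat \<Rightarrow> (nat \<Rightarrow> 'a \<times> real) \<Rightarrow> real" where
  "likelihood_ratio \<mu> \<nu> t h = (\<Prod>s<t. bernoulli_ratio \<mu> \<nu> (h s))"

lemma likelihood_ratio_update:
  "likelihood_ratio \<mu> \<nu> (Suc t) (h(t := z)) = likelihood_ratio \<mu> \<nu> t h * bernoulli_ratio \<mu> \<nu> z"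
  by (simp add: likelihood_ratio_def)

text \<open>A substitute for Pinsker's inequality: for a likelihood ratio \<open>z\<close> of mean
  1, the mean of \<open>z - 1 - ln z\<close> is a relative entropy. The weight \<open>a\<close>
  remains free to balance the two terms.\<close>

lemma one_minus_le_log_gap:
  fixes z a :: real
  assumes "0 < z" "0 < a"
  shows "1 - z \<le> a + (z - 1 - ln z) / a"
proof -
  \<comment> \<open>With the square root, \<open>ln z = 2 * ln w \<le> 2 * (w - 1)\<close> bounds
    the gap from below by the perfect square \<open>(1 - w)\<^sup>2\<close>, ready for the
    inequality of arithmetic and geometric means.\<close>
  define w where "w = sqrt z"
  have w: "0 < w" "z = w\<^sup>2"
    using assms by (auto simp: w_def)
  have "ln z = 2 * ln w"
    using w by (simp add: ln_realpow)
  also have "\<dots> \<le> 2 * (w - 1)"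
    using ln_le_minus_one[OF w(1)] by simp
  finally have g: "(1 - w)\<^sup>2 \<le> z - 1 - ln z"
    using w(2) by (simp add: power2_eq_square algebra_simps)
  have "a * (1 - z) \<le> a\<^sup>2 + (1 - w)\<^sup>2"
  proof (cases "w \<le> 1")
    case True
    have "(1 - w) * (1 + w) \<le> (1 - w) * 2"
      using True w by (intro mult_left_mono) auto
    then have "1 - z \<le> 2 * (1 - w)"
      using w(2) by (simp add: power2_eq_square algebra_simps)
    then have "a * (1 - z) \<le> a * (2 * (1 - w))"
      using assms by (intro mult_left_mono) auto
    also have "\<dots> \<le> a\<^sup>2 + (1 - w)\<^sup>2"
      using sum_squares_bound[of a "1 - w"] by (simp add: algebra_simps)
    finally show ?thesis .
  next
    case False
    then have "1 \<le> z"
      using w by simp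
    then have "a * (1 - z) \<le> 0"
      using assms by (simp add: mult_nonneg_nonpos)
    then show ?thesis
      by (smt (verit) zero_le_power2)
  qed
  with g have "a * (1 - z) \<le> a\<^sup>2 + (z - 1 - ln z)" by simp
  then show ?thesis
    using assms by (simp add: field_simps power2_eq_square)
qed

text \<open>Relative entropy is at most the chi-square divergence, here
  \<open>(p - q)\<^sup>2 / (q * (1 - q))\<close>, and \<open>q * (1 - q) \<ge> 3/16\<close> on the
  interval. This is why the payoffs of the lower bound are kept between 1/4 and 3/4.\<close>

lemma bernoulli_divergence_le:
  fixes p q :: real
  assumes "1/4 \<le> p" "p \<le> 3/4" "1/4 \<le> q" "q \<le> 3/4"
  shows "- (p * ln (q / p)) - (1 - p) * ln ((1 - q) / (1 - p)) \<le> 6 * (p - q)\<^sup>2"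
proof -
  have "ln (p / q) \<le> p / q - 1"
    using assms by (intro ln_le_minus_one) auto
  then have 1: "- ln (q / p) \<le> p / q - 1"
    using assms by (simp add: ln_div)
  have "ln ((1 - p) / (1 - q)) \<le> (1 - p) / (1 - q) - 1"
    using assms by (intro ln_le_minus_one) auto
  then have 2: "- ln ((1 - q) / (1 - p)) \<le> (1 - p) / (1 - q) - 1"
    using assms by (simp add: ln_div)
  have "p * - ln (q / p) + (1 - p) * - ln ((1 - q) / (1 - p)) \<le>
      p * (p / q - 1) + (1 - p) * ((1 - p) / (1 - q) - 1)"
    using 1 2 assms by (intro add_mono mult_left_mono) auto
  also have "\<dots> = (p - q)\<^sup>2 / (q * (1 - q))"
    using assms by (simp add: field_simps power2_eq_square)
  also have "\<dots> \<le> (p - q)\<^sup>2 / (1 / 6)"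
  proof (rule divide_left_mono)
    have "0 \<le> (q - 1/4) * (3/4 - q)"
      using assms by (intro mult_nonneg_nonneg) auto
    also have "\<dots> = q * (1 - q) - 3/16"
      by (simp add: field_simps)
    finally show "1 / 6 \<le> q * (1 - q)"
      by linarith
    then show "0 < q * (1 - q) * (1 / 6)" by simp
  qed simp
  finally show ?thesis by simp
qed

section \<open>Likelihood ratio of two Bernoulli instances under the same algorithm\<close>

context
  fixes M :: "'a measure" and A :: "'a algorithm" and \<mu> \<nu> :: "'a \<Rightarrow> real"
  assumes A: "bandit_algorithm M A"
    and meas: "\<mu> \<in> borel_measurable M" "\<nu> \<in> borel_measurable M"
    and range: "\<And>x. x \<in> space M \<Longrightarrow> 1/4 \<le> \<mu> x \<and> \<mu> x \<le> 3/4"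
      "\<And>x. x \<in> space M \<Longrightarrow> 1/4 \<le> \<nu> x \<and> \<nu> x \<le> 3/4"
begin

lemma bernoulli_ratio_bounds:
  "fst z \<in> space M \<Longrightarrow> 1/3 \<le> bernoulli_ratio \<mu> \<nu> z \<and> bernoulli_ratio \<mu> \<nu> z \<le> 3"
  using range[of "fst z"] by (auto simp: bernoulli_ratio_def field_simps)

lemma likelihood_ratio_bounds:
  assumes "h \<in> space (history_space M t)"
  shows "(1/3) ^ t \<le> likelihood_ratio \<mu> \<nu> t h" and "likelihood_ratio \<mu> \<nu> t h \<le> 3 ^ t"
proof -
  have b: "1/3 \<le> bernoulli_ratio \<mu> \<nu> (h s) \<and> bernoulli_ratio \<mu> \<nu> (h s) \<le> 3" if "s < t" for s
    by (rule bernoulli_ratio_bounds, rule history_arm_in_space[OF assms that])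
  have "(\<Prod>s<t. 1/3) \<le> (\<Prod>s<t. bernoulli_ratio \<mu> \<nu> (h s))"
    using b by (intro prod_mono) auto
  then show "(1/3) ^ t \<le> likelihood_ratio \<mu> \<nu> t h" by (simp add: likelihood_ratio_def)
  have "(\<Prod>s<t. bernoulli_ratio \<mu> \<nu> (h s)) \<le> (\<Prod>s<t. 3)"
    using b by (intro prod_mono) force
  then show "likelihood_ratio \<mu> \<nu> t h \<le> 3 ^ t" by (simp add: likelihood_ratio_def)
qed

lemma likelihood_ratio_pos:
  "h \<in> space (history_space M t) \<Longrightarrow> 0 < likelihood_ratio \<mu> \<nu> t h"
  using likelihood_ratio_bounds(1)[of h t] by (smt (verit) zero_less_power zero_less_divide_1_iff)

lemma measurable_likelihood_ratio:
  "likelihood_ratio \<mu> \<nu> t \<in> borel_measurable (history_space M t)"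
proof -
  note measurable_history_arm[OF _ meas(1), measurable] measurable_history_arm[OF _ meas(2), measurable]
    measurable_history_reward[measurable]
  show ?thesis
    unfolding likelihood_ratio_def bernoulli_ratio_def
    by (intro borel_measurable_prod measurable_If) auto
qed

lemma bernoulli_kernels:
  "(\<lambda>x. bernoulli_dist (\<mu> x)) \<in> M \<rightarrow>\<^sub>M prob_algebra borel"
  "(\<lambda>x. bernoulli_dist (\<nu> x)) \<in> M \<rightarrow>\<^sub>M prob_algebra borel"
  using range by (auto intro!: bernoulli_dist_kernel meas) (force+)

text \<open>The arm kernels of the algorithm are the same under both laws, so they cancel from the
  density and only one reward factor per round remains.\<close>

lemma change_of_measure:
  assumes "f \<in> borel_measurable (history_space M t)"
    and "\<And>h. h \<in> space (history_space M t) \<Longrightarrow> \<bar>f h\<bar> \<le> B"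
  shows "(\<integral>h. f h \<partial>history_law M A (\<lambda>x. bernoulli_dist (\<nu> x)) t) =
      (\<integral>h. f h * likelihood_ratio \<mu> \<nu> t h \<partial>history_law M A (\<lambda>x. bernoulli_dist (\<mu> x)) t)"
  using assms
proof (induction t arbitrary: f B)
  case 0
  then show ?case by (simp add: likelihood_ratio_def)
next
  case (Suc t)
  let ?P = "\<lambda>x. bernoulli_dist (\<mu> x)" and ?P' = "\<lambda>x. bernoulli_dist (\<nu> x)"
  let ?H = "history_space M t" and ?L = "likelihood_ratio \<mu> \<nu>"
  note step' = integral_history_law_Suc[OF A bernoulli_kernels(2) Suc.prems]
  have m: "(\<lambda>h. f h * ?L (Suc t) h) \<in> borel_measurable (history_space M (Suc t))"
    using Suc.prems(1) measurable_likelihood_ratio by measurable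
  have b: "\<bar>f h * ?L (Suc t) h\<bar> \<le> \<bar>B\<bar> * 3 ^ Suc t" if "h \<in> space (history_space M (Suc t))" for h
    unfolding abs_mult
    using Suc.prems(2)[OF that] likelihood_ratio_pos[OF that] likelihood_ratio_bounds[OF that]
    by (intro mult_mono) auto
  note step = integral_history_law_Suc[OF A bernoulli_kernels(1) m b]
  \<comment> \<open>The induction hypothesis is applied to the integral over the last round, which
    is again measurable and bounded by \<open>B\<close>.\<close>
  have "(\<integral>h. f h \<partial>history_law M A ?P' (Suc t)) =
      (\<integral>h. (\<integral>x. (\<integral>y. f (h(t := (x, y))) \<partial>?P' x) \<partial>A t h) * ?L t h \<partial>history_law M A ?P t)"
    by (rule trans[OF step'(1) Suc.IH[OF step'(2,3)]])
  also have "\<dots> = (\<integral>h. (\<integral>x. (\<integral>y. f (h(t := (x, y))) * ?L (Suc t) (h(t := (x, y))) \<partial>?P x) \<partial>A t h)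
      \<partial>history_law M A ?P t)"
  proof (rule Bochner_Integration.integral_cong[OF refl])
    fix h assume "h \<in> space (history_law M A ?P t)"
    then have h: "h \<in> space ?H"
      using sets_eq_imp_space_eq[OF sets_history_law(1)[OF A bernoulli_kernels(1)]] by auto
    have "(\<integral>x. (\<integral>y. f (h(t := (x, y))) \<partial>?P' x) \<partial>A t h) * ?L t h =
      (\<integral>x. (\<integral>y. f (h(t := (x, y))) \<partial>?P' x) * ?L t h \<partial>A t h)"
      by simp
    also have "\<dots> = (\<integral>x. (\<integral>y. f (h(t := (x, y))) * ?L (Suc t) (h(t := (x, y))) \<partial>?P x) \<partial>A t h)"
    proof (rule Bochner_Integration.integral_cong[OF refl])
      fix x assume "x \<in> space (A t h)"
      then have x: "x \<in> space M" using space_arm_law[OF A h] by simp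
      show "(\<integral>y. f (h(t := (x, y))) \<partial>?P' x) * ?L t h =
        (\<integral>y. f (h(t := (x, y))) * ?L (Suc t) (h(t := (x, y))) \<partial>?P x)"
      proof -
        have r: "0 < \<mu> x" "\<mu> x < 1" "0 \<le> \<nu> x" "\<nu> x \<le> 1"
          using range(1)[OF x] range(2)[OF x] by auto
        have "(\<integral>y. f (h(t := (x, y))) \<partial>?P' x) =
            \<nu> x * f (h(t := (x, 1))) + (1 - \<nu> x) * f (h(t := (x, 0)))"
          by (rule integral_bernoulli_dist[OF measurable_history_update_reward[OF h x Suc.prems(1)]])
            (use r in auto)
        moreover have "(\<integral>y. f (h(t := (x, y))) * ?L (Suc t) (h(t := (x, y))) \<partial>?P x) =
            \<mu> x * (f (h(t := (x, 1))) * ?L (Suc t) (h(t := (x, 1)))) +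
            (1 - \<mu> x) * (f (h(t := (x, 0))) * ?L (Suc t) (h(t := (x, 0))))"
          by (rule integral_bernoulli_dist[OF measurable_history_update_reward[OF h x m]])
            (use r in auto)
        moreover have "\<mu> x * bernoulli_ratio \<mu> \<nu> (x, 1) = \<nu> x"
          "(1 - \<mu> x) * bernoulli_ratio \<mu> \<nu> (x, 0) = 1 - \<nu> x"
          using r by (auto simp: bernoulli_ratio_def)
        moreover have "m * (u * (l * r)) = (m * r) * u * l" for m u l r :: real
          by simp
        ultimately show ?thesis
          unfolding likelihood_ratio_update by (simp only: distrib_right)
      qed
    qed
    finally show "(\<integral>x. (\<integral>y. f (h(t := (x, y))) \<partial>?P' x) \<partial>A t h) * ?L t h =
      (\<integral>x. (\<integral>y. f (h(t := (x, y))) * ?L (Suc t) (h(t := (x, y))) \<partial>?P x) \<partial>A t h)" .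
  qed
  also have "\<dots> = (\<integral>h. f h * ?L (Suc t) h \<partial>history_law M A ?P (Suc t))"
    by (rule step(1)[symmetric])
  finally show ?case .
qed

lemma measurable_ln_likelihood_ratio:
  "(\<lambda>h. ln (likelihood_ratio \<mu> \<nu> t h)) \<in> borel_measurable (history_space M t)"
  by (rule borel_measurable_ln[OF measurable_likelihood_ratio]) 

lemma abs_ln_likelihood_ratio_le:
  assumes h: "h \<in> space (history_space M t)"
  shows "\<bar>ln (likelihood_ratio \<mu> \<nu> t h)\<bar> \<le> t * ln 3"
proof -
  have "ln (likelihood_ratio \<mu> \<nu> t h) \<le> ln (3 ^ t)"
    using likelihood_ratio_bounds[OF h] likelihood_ratio_pos[OF h] by (subst ln_le_cancel_iff) auto
  moreover have "ln ((1/3) ^ t) \<le> ln (likelihood_ratio \<mu> \<nu> t h)"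
    using likelihood_ratio_bounds[OF h] likelihood_ratio_pos[OF h] by (subst ln_le_cancel_iff) auto
  ultimately show ?thesis
    by (simp add: ln_realpow ln_div power_divide)
qed

text \<open>The chain rule for relative entropy in inequality form: a round at arm \<open>x\<close>
  adds at most \<open>6 * (\<mu> x - \<nu> x)\<^sup>2\<close>, so the compensated process decreases
  in expectation. Visits to arms where the payoffs agree reveal nothing.\<close>

lemma expected_log_likelihood_le:
  "(\<integral>h. - ln (likelihood_ratio \<mu> \<nu> t h) - 6 * (\<Sum>s<t. (\<mu> (fst (h s)) - \<nu> (fst (h s)))\<^sup>2)
     \<partial>history_law M A (\<lambda>x. bernoulli_dist (\<mu> x)) t) \<le> 0"
proof (induction t)
  case 0
  then show ?case by (simp add: likelihood_ratio_def)
next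
  case (Suc t)
  let ?P = "\<lambda>x. bernoulli_dist (\<mu> x)" and ?H = "history_space M t"
  let ?L = "likelihood_ratio \<mu> \<nu>" and ?S = "\<lambda>t h. \<Sum>s<t. (\<mu> (fst (h s)) - \<nu> (fst (h s)))\<^sup>2"
  let ?g = "\<lambda>t h. - ln (?L t h) - 6 * ?S t h"
  have sq: "\<bar>(\<mu> x - \<nu> x)\<^sup>2\<bar> \<le> 1" if "x \<in> space M" for x
    using range(1)[OF that] range(2)[OF that] by (auto simp: abs_square_le_1)
  have m: "?g t \<in> borel_measurable (history_space M t)" for t
    using meas by (intro borel_measurable_diff borel_measurable_uminus borel_measurable_times
        borel_measurable_const measurable_ln_likelihood_ratio measurable_arm_sum) measurable
  have b: "\<bar>?g t h\<bar> \<le> t * ln 3 + 6 * (t * 1)" if "h \<in> space (history_space M t)" for t h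
    using abs_ln_likelihood_ratio_le[OF that] abs_arm_sum_le[OF that, of "\<lambda>x. (\<mu> x - \<nu> x)\<^sup>2" 1] sq by force
  have "(\<integral>h. ?g (Suc t) h \<partial>history_law M A ?P (Suc t)) \<le> (\<integral>h. ?g t h \<partial>history_law M A ?P t)"
  proof (rule integral_history_law_Suc_le[OF A bernoulli_kernels(1) m b m b], assumption, assumption)
    fix h assume h: "h \<in> space ?H"
    note step = integral_history_law_Suc[OF A bernoulli_kernels(1) m b, of t]
    have le: "(\<integral>y. ?g (Suc t) (h(t := (x, y))) \<partial>?P x) \<le> ?g t h" if x: "x \<in> space M" for x
    proof -
      have L: "0 < ?L t h" by (rule likelihood_ratio_pos[OF h])
      have r: "1/4 \<le> \<mu> x" "\<mu> x \<le> 3/4" "1/4 \<le> \<nu> x" "\<nu> x \<le> 3/4"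
        using range(1)[OF x] range(2)[OF x] by auto
      have S: "?S (Suc t) (h(t := (x, y))) = ?S t h + (\<mu> x - \<nu> x)\<^sup>2" for y
        by simp
      have l1: "ln (?L (Suc t) (h(t := (x, 1)))) = ln (?L t h) + ln (\<nu> x / \<mu> x)"
        using L r ln_mult[of "?L t h"] by (simp add: likelihood_ratio_update bernoulli_ratio_def del: times_divide_eq_right)
      have l0: "ln (?L (Suc t) (h(t := (x, 0)))) = ln (?L t h) + ln ((1 - \<nu> x) / (1 - \<mu> x))"
        using L r ln_mult[of "?L t h"] by (simp add: likelihood_ratio_update bernoulli_ratio_def del: times_divide_eq_right)
      have "(\<integral>y. ?g (Suc t) (h(t := (x, y))) \<partial>?P x) =
          \<mu> x * ?g (Suc t) (h(t := (x, 1))) + (1 - \<mu> x) * ?g (Suc t) (h(t := (x, 0)))"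
        by (rule integral_bernoulli_dist[OF measurable_history_update_reward[OF h x m]]) (use r in auto)
      also have "\<dots> = ?g t h - 6 * (\<mu> x - \<nu> x)\<^sup>2 +
          (- (\<mu> x * ln (\<nu> x / \<mu> x)) - (1 - \<mu> x) * ln ((1 - \<nu> x) / (1 - \<mu> x)))"
        unfolding S l1 l0 by (simp add: algebra_simps)
      also have "\<dots> \<le> ?g t h"
        using bernoulli_divergence_le[OF r] by simp
      finally show ?thesis .
    qed
    interpret At: prob_space "A t h" by (rule prob_space_arm_law[OF A h])
    show "(\<integral>x. (\<integral>y. ?g (Suc t) (h(t := (x, y))) \<partial>?P x) \<partial>A t h) \<le> ?g t h"
    proof (rule At.integral_le_const)
      have bi: "\<bar>\<integral>y. ?g (Suc t) (h(t := (x, y))) \<partial>?P x\<bar> \<le> real (Suc t) * ln 3 + 6 * (real (Suc t) * 1)"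
        if x: "x \<in> space M" for x
      proof (rule prob_space.abs_integral_le_const)
        show "prob_space (bernoulli_dist (\<mu> x))"
          using measurable_space[OF bernoulli_kernels(1) x] by (simp add: space_prob_algebra)
      qed (intro b history_update_in_space h x)
      show "integrable (A t h) (\<lambda>x. \<integral>y. ?g (Suc t) (h(t := (x, y))) \<partial>?P x)"
        by (rule At.integrable_abs_le_const)
          (use step(4)[OF _ h] bi in \<open>auto simp: measurable_cong_sets[OF sets_arm_law[OF A h] refl] space_arm_law[OF A h]\<close>)
    qed (use le space_arm_law[OF A h] in auto)
  qed
  with Suc show ?case by linarith
qed

text \<open>With \<open>L\<close> the likelihood ratio, \<open>f * (1 - L)\<close> is pointwise at
  most \<open>a + (L - 1 - ln L) / a\<close>; in expectation \<open>L - 1\<close> vanishes and the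
  relative entropy is left.\<close>

lemma expectation_change_le:
  assumes f: "f \<in> borel_measurable (history_space M t)"
    and r: "\<And>h. h \<in> space (history_space M t) \<Longrightarrow> 0 \<le> f h \<and> f h \<le> 1" and a: "0 < a"
  shows "(\<integral>h. f h \<partial>history_law M A (\<lambda>x. bernoulli_dist (\<mu> x)) t) - a -
      6 * (\<integral>h. (\<Sum>s<t. (\<mu> (fst (h s)) - \<nu> (fst (h s)))\<^sup>2)
        \<partial>history_law M A (\<lambda>x. bernoulli_dist (\<mu> x)) t) / a
    \<le> (\<integral>h. f h \<partial>history_law M A (\<lambda>x. bernoulli_dist (\<nu> x)) t)"
proof -
  let ?Q = "history_law M A (\<lambda>x. bernoulli_dist (\<mu> x)) t"
  let ?L = "likelihood_ratio \<mu> \<nu> t" and ?S = "\<lambda>h. \<Sum>s<t. (\<mu> (fst (h s)) - \<nu> (fst (h s)))\<^sup>2"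
  note int = integrable_history_law[OF A bernoulli_kernels(1)]
  note sp = sets_eq_imp_space_eq[OF sets_history_law(1)[OF A bernoulli_kernels(1), of t]]
  interpret Q: prob_space ?Q by (rule sets_history_law(2)[OF A bernoulli_kernels(1)])
  have sq: "\<bar>(\<mu> x - \<nu> x)\<^sup>2\<bar> \<le> 1" if "x \<in> space M" for x
    using range(1)[OF that] range(2)[OF that] by (auto simp: abs_square_le_1)
  have iS: "integrable ?Q ?S"
    using meas by (intro int[OF measurable_arm_sum abs_arm_sum_le[OF _ sq]]) measurable
  have iL: "integrable ?Q ?L"
    by (rule int[OF measurable_likelihood_ratio, of _ "3^t"])
      (use likelihood_ratio_bounds likelihood_ratio_pos in force)
  have iln: "integrable ?Q (\<lambda>h. ln (?L h))"
    by (rule int[OF measurable_ln_likelihood_ratio abs_ln_likelihood_ratio_le])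
  have f1: "integrable ?Q f"
    by (rule int[OF f, of 1]) (use r in force)
  have ifL: "integrable ?Q (\<lambda>h. f h * ?L h)"
  proof (rule int)
    show "(\<lambda>h. f h * ?L h) \<in> borel_measurable (history_space M t)"
      using f measurable_likelihood_ratio by measurable
    show "\<bar>f h * ?L h\<bar> \<le> 1 * 3 ^ t" if "h \<in> space (history_space M t)" for h
      unfolding abs_mult using r[OF that] likelihood_ratio_bounds[OF that] likelihood_ratio_pos[OF that]
      by (intro mult_mono) auto
  qed
  have EL: "(\<integral>h. ?L h \<partial>?Q) = 1"
    using change_of_measure[of "\<lambda>_. 1" t 1]
      prob_space.prob_space[OF sets_history_law(2)[OF A bernoulli_kernels(2)]] by simp
  have "(\<integral>h. - ln (?L h) - 6 * ?S h \<partial>?Q) = - (\<integral>h. ln (?L h) \<partial>?Q) - 6 * (\<integral>h. ?S h \<partial>?Q)"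
    using iln iS by simp
  then have ln_le: "- (\<integral>h. ln (?L h) \<partial>?Q) \<le> 6 * (\<integral>h. ?S h \<partial>?Q)"
    using expected_log_likelihood_le[of t] by simp
  have "(\<integral>h. f h \<partial>?Q) - (\<integral>h. f h * ?L h \<partial>?Q) = (\<integral>h. f h - f h * ?L h \<partial>?Q)"
    using f1 ifL by simp
  also have "\<dots> \<le> (\<integral>h. a + (?L h - 1 - ln (?L h)) / a \<partial>?Q)"
  proof (rule integral_mono)
    fix h assume "h \<in> space ?Q"
    then have h: "h \<in> space (history_space M t)" using sp by simp
    note g = one_minus_le_log_gap[OF likelihood_ratio_pos[OF h] a]
    \<comment> \<open>Nonnegativity of the bound allows the factor \<open>f h \<le> 1\<close> to be
      dropped from it.\<close>
    have "0 \<le> ?L h - 1 - ln (?L h)"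
      using ln_le_minus_one[OF likelihood_ratio_pos[OF h]] by simp
    then have nn: "0 \<le> a + (?L h - 1 - ln (?L h)) / a" using a by simp
    have "f h * (1 - ?L h) \<le> f h * (a + (?L h - 1 - ln (?L h)) / a)"
      using g r[OF h] by (intro mult_left_mono) auto
    also have "\<dots> \<le> 1 * (a + (?L h - 1 - ln (?L h)) / a)"
      using nn r[OF h] by (intro mult_right_mono) auto
    finally show "f h - f h * ?L h \<le> a + (?L h - 1 - ln (?L h)) / a"
      by (simp add: algebra_simps)
  qed (use f1 ifL iL iln in auto)
  also have "\<dots> = a + ((\<integral>h. ?L h \<partial>?Q) - 1 - (\<integral>h. ln (?L h) \<partial>?Q)) / a"
    using iL iln by (simp add: Q.prob_space)
  also have "\<dots> \<le> a + 6 * (\<integral>h. ?S h \<partial>?Q) / a"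
    using divide_right_mono[OF ln_le, of a] EL a by simp
  finally have "(\<integral>h. f h \<partial>?Q) - (\<integral>h. f h * ?L h \<partial>?Q) \<le> a + 6 * (\<integral>h. ?S h \<partial>?Q) / a" .
  moreover have "(\<integral>h. f h \<partial>history_law M A (\<lambda>x. bernoulli_dist (\<nu> x)) t) = (\<integral>h. f h * ?L h \<partial>?Q)"
    by (rule change_of_measure[OF f, of 1]) (use r in force)
  ultimately show ?thesis by linarith
qed

end

section \<open>Covering numbers, packings and nets\<close>

text \<open>For a separated set of maximal size, the closed balls of radius \<open>r / 3\<close>
  about its points cover \<open>U\<close>. Their diameter is at most \<open>2 * r / 3\<close>,
  strictly below \<open>r\<close> as a covering set requires.\<close>

lemma covering_number_le_packing:
  fixes X :: "'a::metric_space set"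
  assumes "compact X" "U \<subseteq> X" "0 < r"
  obtains Z where "finite Z" "Z \<subseteq> U" "\<And>x y. x \<in> Z \<Longrightarrow> y \<in> Z \<Longrightarrow> x \<noteq> y \<Longrightarrow> r / 3 \<le> dist x y"
    "covering_number r U \<le> enat (card Z)"
proof -
  define sep where "sep Z \<longleftrightarrow> Z \<subseteq> U \<and> (\<forall>x\<in>Z. \<forall>y\<in>Z. x \<noteq> y \<longrightarrow> r / 3 \<le> dist x y)" for Z
  obtain k where k: "finite k" "X \<subseteq> (\<Union>x\<in>k. ball x (r / 6))"
    using assms(1,3) unfolding compact_eq_totally_bounded by (meson divide_pos_pos zero_less_numeral)
  \<comment> \<open>No ball of radius \<open>r / 6\<close> contains two points at distance
    \<open>r / 3\<close> or more. Hence separated sets are bounded in size and one of maximal size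
    exists.\<close>
  have bound: "finite Z \<and> card Z \<le> card k" if "sep Z" for Z
  proof -
    have "\<exists>c\<in>k. dist c z < r / 6" if "z \<in> Z" for z
    proof -
      have "z \<in> X" using that \<open>sep Z\<close> assms(2) by (auto simp: sep_def)
      then obtain c where "c \<in> k" "z \<in> ball c (r / 6)" using k(2) by blast
      then show ?thesis by auto
    qed
    then obtain c where c: "\<And>z. z \<in> Z \<Longrightarrow> c z \<in> k \<and> dist (c z) z < r / 6"
      by metis
    have "inj_on c Z"
    proof (rule inj_onI, rule ccontr)
      fix x y assume *: "x \<in> Z" "y \<in> Z" "c x = c y" "x \<noteq> y"
      have "dist x y \<le> dist (c x) x + dist (c x) y"
        by (metis dist_commute dist_triangle)
      also have "\<dots> < r / 3"
        using c[OF *(1)] c[OF *(2)] *(3) by auto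
      finally show False
        using * \<open>sep Z\<close> by (force simp: sep_def)
    qed
    moreover have "c ` Z \<subseteq> k" using c by auto
    ultimately show ?thesis
      using k(1) by (meson card_inj_on_le inj_on_finite)
  qed
  have "sep {}" by (simp add: sep_def)
  obtain Z where Z: "sep Z" "\<And>Z'. sep Z' \<Longrightarrow> card Z' \<le> card Z"
    using ex_has_greatest_nat[of sep "{}" card "Suc (card k)"] \<open>sep {}\<close> bound by (metis le_imp_less_Suc)
  have fin: "finite Z" using bound Z by auto
  have near: "\<exists>z\<in>Z. dist z x \<le> r / 3" if "x \<in> U" for x
  proof (rule ccontr)
    assume *: "\<not> (\<exists>z\<in>Z. dist z x \<le> r / 3)"
    then have "x \<notin> Z" using \<open>0 < r\<close> by fastforce
    have "sep (insert x Z)"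
      using Z(1) * \<open>x \<in> U\<close> unfolding sep_def
      by (auto simp: not_le dist_commute intro: less_imp_le)
    from Z(2)[OF this] show False
      using \<open>x \<notin> Z\<close> fin by simp
  qed
  let ?F = "(\<lambda>z. U \<inter> cball z (r / 3)) ` Z"
  have "diameter (U \<inter> cball z (r / 3)) < r" for z
  proof -
    let ?S = "U \<inter> cball z (r / 3)"
    have "dist x y \<le> 2 * (r / 3)" if "x \<in> ?S" "y \<in> ?S" for x y
      using that dist_triangle2[of x y z] by (auto simp: dist_commute)
    then have "(SUP (x, y)\<in>?S \<times> ?S. dist x y) \<le> 2 * (r / 3)" if "?S \<noteq> {}"
      using that by (intro cSUP_least) auto
    then have "diameter ?S \<le> 2 * (r / 3)"
      using \<open>0 < r\<close> by (simp add: diameter_def)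
    then show ?thesis using \<open>0 < r\<close> by simp
  qed
  moreover have "U \<subseteq> \<Union> ?F"
    using near by auto
  moreover have "bounded (U \<inter> cball z (r / 3))" for z
    by (simp add: bounded_Int)
  ultimately have "covering_number r U \<le> enat (card ?F)"
    unfolding covering_number_def using fin by (intro Inf_lower CollectI exI[of _ ?F] conjI) auto
  also have "\<dots> \<le> enat (card Z)"
    using card_image_le[OF fin] by simp
  finally show thesis
    using that[OF fin] Z(1) by (auto simp: sep_def)
qed

lemma net_of_covering_number:
  fixes T :: "'a::metric_space set"
  assumes "ereal_of_enat (covering_number r T) \<le> ereal c"
  obtains Z where "finite Z" "Z \<subseteq> T" "real (card Z) \<le> c" "\<And>x. x \<in> T \<Longrightarrow> \<exists>z\<in>Z. dist x z \<le> r"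
proof -
  let ?A = "{enat (card F) |F. finite F \<and> T \<subseteq> \<Union>F \<and> (\<forall>S\<in>F. S \<subseteq> T \<and> bounded S \<and> diameter S < r)}"
  \<comment> \<open>Without finite covers the infimum would be \<infinity>, contrary to the real
    bound. Hence it is attained by some cover, and one point of each nonempty member gives the
    net.\<close>
  have "?A \<noteq> {}"
  proof
    assume "?A = {}"
    then have "covering_number r T = \<infinity>"
      unfolding covering_number_def by (simp only: Inf_enat_def) simp
    then show False using assms by simp
  qed
  then obtain a where "a \<in> ?A"
    by blast
  then have "(LEAST a. a \<in> ?A) \<in> ?A"
    by (rule LeastI)
  moreover have "covering_number r T = (LEAST a. a \<in> ?A)"
    unfolding covering_number_def Inf_enat_def using \<open>?A \<noteq> {}\<close> by (simp only: if_False)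
  ultimately have "covering_number r T \<in> ?A"
    by (simp only:)
  then obtain F where F: "finite F" "T \<subseteq> \<Union>F" "\<And>S. S \<in> F \<Longrightarrow> S \<subseteq> T \<and> bounded S \<and> diameter S < r"
    "covering_number r T = enat (card F)"
    by auto
  define Z where "Z = (\<lambda>S. SOME x. x \<in> S) ` {S \<in> F. S \<noteq> {}}"
  have some: "(SOME x. x \<in> S) \<in> S" if "S \<noteq> {}" for S :: "'a set"
    using that by (simp add: some_in_eq)
  have "finite Z" using F(1) by (simp add: Z_def)
  moreover have "Z \<subseteq> T"
    unfolding Z_def using some F(3) by blast
  moreover have "card Z \<le> card F"
  proof -
    have "card Z \<le> card {S \<in> F. S \<noteq> {}}"
      unfolding Z_def using F(1) by (intro card_image_le) simp
    also have "\<dots> \<le> card F"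
      using F(1) by (intro card_mono) auto
    finally show ?thesis .
  qed
  moreover have "real (card F) \<le> c"
    using assms F(4) by simp
  moreover have "\<exists>z\<in>Z. dist x z \<le> r" if "x \<in> T" for x
  proof -
    obtain S where S: "S \<in> F" "x \<in> S"
      using F(2) \<open>x \<in> T\<close> by auto
    then have "(SOME x. x \<in> S) \<in> S" by (intro some) auto
    then have "dist x (SOME x. x \<in> S) \<le> diameter S"
      using diameter_bounded_bound S F(3) by blast
    then show ?thesis
      using S F(3) unfolding Z_def by force
  qed
  ultimately show thesis
    by (intro that[of Z]) auto
qed

section \<open>From covering dimension to finite exploration nets\<close>

lemma COV_lessD:
  assumes "COV T < ereal d"
  shows "\<exists>c. \<forall>r. 0 < r \<and> r \<le> 1 \<longrightarrow> ereal_of_enat (covering_number r T) \<le> ereal (c * r powr (- d))"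
proof -
  obtain d' c where d': "d' < d"
    and c: "\<And>r. 0 < r \<Longrightarrow> r \<le> 1 \<Longrightarrow> ereal_of_enat (covering_number r T) \<le> ereal (c * r powr (- d'))"
    using assms unfolding COV_def Inf_less_iff by (auto; blast)
  \<comment> \<open>Raising the exponent is harmless because \<open>r \<le> 1\<close>; the absolute
    value supplies the sign needed to multiply the two monotone estimates.\<close>
  have "ereal_of_enat (covering_number r T) \<le> ereal (\<bar>c\<bar> * r powr (- d))" if r: "0 < r" "r \<le> 1" for r
  proof -
    have "c * r powr (- d') \<le> \<bar>c\<bar> * r powr (- d)"
      using d' r by (intro mult_mono powr_mono') auto
    with c[OF r] show ?thesis by (meson ereal_less_eq(3) order_trans)
  qed
  then show ?thesis by blast
qed

text \<open>The points without a \<open>\<sigma>\<close>-thin neighbourhood form a set none of whose nonempty relatively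
  open subsets is thin, so there are no such points.\<close>

lemma countable_cover_of_MaxMinCOV_less:
  fixes X :: "'a::metric_space set"
  assumes "compact X" and less: "MaxMinCOV X < d"
  obtains \<T> where "countable \<T>" "\<Union>\<T> = X" "\<And>T. T \<in> \<T> \<Longrightarrow> COV T < d"
proof -
  have "\<exists>k. finite k \<and> X \<subseteq> (\<Union>x\<in>k. ball x (1 / Suc n))" for n
    using assms(1) unfolding compact_eq_totally_bounded by (meson divide_pos_pos of_nat_0_less_iff zero_less_Suc zero_less_one)
  then obtain k where k: "\<And>n::nat. finite (k n)" "\<And>n. X \<subseteq> (\<Union>x\<in>k n. ball x (1 / Suc n))"
    by metis
  \<comment> \<open>Balls of radius \<open>1 / Suc n\<close> about finite nets form a countable base
    on \<open>X\<close>, so that the union of all thin basic sets is still thin.\<close>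
  define \<B> where "\<B> = (\<Union>n. (\<lambda>x. ball x (1 / Suc n)) ` k n)"
  have "countable \<B>"
    unfolding \<B>_def using k(1) by (auto intro: countable_finite)
  have base: "\<exists>B\<in>\<B>. x \<in> B \<and> B \<subseteq> S" if S: "open S" "x \<in> S" and "x \<in> X" for S x
  proof -
    obtain e where e: "0 < e" "ball x e \<subseteq> S"
      using S by (meson openE)
    obtain n where n: "1 / Suc n < e / 2"
      using reals_Archimedean[of "e / 2"] e by (auto simp: field_simps)
    obtain z where z: "z \<in> k n" "dist z x < 1 / Suc n"
      using k(2)[of n] \<open>x \<in> X\<close> by auto
    have "ball z (1 / Suc n) \<subseteq> ball x e"
    proof
      fix y assume "y \<in> ball z (1 / Suc n)"
      then have "dist x y < 1 / Suc n + 1 / Suc n"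
        using dist_triangle[of x y z] z(2) by (auto simp: dist_commute)
      then show "y \<in> ball x e" using n by simp
    qed
    then show ?thesis
      using z e unfolding \<B>_def by (intro bexI[of _ "ball z (1 / Suc n)"]) auto
  qed
  define thin where "thin S \<longleftrightarrow> (\<exists>\<T>. countable \<T> \<and> S \<subseteq> \<Union>\<T> \<and> (\<forall>T\<in>\<T>. T \<subseteq> X \<and> COV T < d))" for S :: "'a set"
  have thin_UN: "thin (\<Union>\<S>)" if "countable \<S>" "\<And>S. S \<in> \<S> \<Longrightarrow> thin S" for \<S>
  proof -
    have "\<forall>S\<in>\<S>. \<exists>\<T>. countable \<T> \<and> S \<subseteq> \<Union>\<T> \<and> (\<forall>T\<in>\<T>. T \<subseteq> X \<and> COV T < d)"
      using that(2) by (auto simp: thin_def)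
    then obtain g where g: "\<And>S. S \<in> \<S> \<Longrightarrow> countable (g S) \<and> S \<subseteq> \<Union>(g S) \<and> (\<forall>T\<in>g S. T \<subseteq> X \<and> COV T < d)"
      by metis
    show ?thesis
      unfolding thin_def
    proof (intro exI conjI)
      show "countable (\<Union>(g ` \<S>))"
        using that(1) g by auto
      show "\<Union>\<S> \<subseteq> \<Union>(\<Union>(g ` \<S>))"
      proof
        fix x assume "x \<in> \<Union>\<S>"
        then obtain S where "S \<in> \<S>" "x \<in> S" by blast
        then have "x \<in> \<Union>(g S)" using g[of S] by blast
        then show "x \<in> \<Union>(\<Union>(g ` \<S>))" using \<open>S \<in> \<S>\<close> by blast
      qed
      show "\<forall>T\<in>\<Union>(g ` \<S>). T \<subseteq> X \<and> COV T < d"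
        using g by blast
    qed
  qed
  define V where "V = \<Union>{B \<inter> X |B. B \<in> \<B> \<and> thin (B \<inter> X)}"
  have "{B \<inter> X |B. B \<in> \<B> \<and> thin (B \<inter> X)} \<subseteq> (\<lambda>B. B \<inter> X) ` \<B>" by auto
  then have "countable {B \<inter> X |B. B \<in> \<B> \<and> thin (B \<inter> X)}"
    by (rule countable_subset) (intro countable_image \<open>countable \<B>\<close>)
  then have "thin V"
    unfolding V_def by (intro thin_UN) auto
  have "V \<subseteq> X" by (auto simp: V_def)
  have "X - V = {}"
  proof (rule ccontr)
    assume ne: "X - V \<noteq> {}"
    then have "MinCOV (X - V) \<le> MaxMinCOV X"
      unfolding MaxMinCOV_def by (intro Sup_upper) auto
    also note less
    finally obtain U where U: "U \<noteq> {}" "openin (top_of_set (X - V)) U" "COV U < d"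
      unfolding MinCOV_def Inf_less_iff by auto
    then obtain S where S: "open S" "U = (X - V) \<inter> S"
      by (auto simp: openin_open)
    obtain x where x: "x \<in> U" using U by auto
    then obtain B where B: "B \<in> \<B>" "x \<in> B" "B \<subseteq> S"
      using base[OF S(1)] S(2) by auto
    obtain \<T> where \<T>: "countable \<T>" "V \<subseteq> \<Union>\<T>" "\<forall>T\<in>\<T>. T \<subseteq> X \<and> COV T < d"
      using \<open>thin V\<close> by (auto simp: thin_def)
    \<comment> \<open>Outside \<open>V\<close> the basic set \<open>B\<close> lies in
      \<open>U\<close>. Adding the single piece \<open>U\<close> to a cover of \<open>V\<close>
      makes \<open>B \<inter> X\<close> thin, which forces \<open>x\<close> into
      \<open>V\<close>.\<close>
    have "B \<inter> X \<subseteq> U \<union> V" using B S by auto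
    then have "thin (B \<inter> X)"
      unfolding thin_def using \<T> U S by (intro exI[of _ "insert U \<T>"]) auto
    then have "B \<inter> X \<subseteq> V" using B by (auto simp: V_def)
    then show False using B x S by auto
  qed
  then have "thin X" using \<open>thin V\<close> \<open>V \<subseteq> X\<close> by (metis Diff_eq_empty_iff subset_antisym)
  then obtain \<T> where \<T>: "countable \<T>" "X \<subseteq> \<Union>\<T>" "\<forall>T\<in>\<T>. T \<subseteq> X \<and> COV T < d"
    by (auto simp: thin_def)
  then show thesis
    by (intro that[of \<T>]) auto
qed


lemma exploration_nets:
  fixes X :: "'a::metric_space set" and d \<beta> a :: real
  assumes "compact X" "X \<noteq> {}" "MaxMinCOV X < ereal d" "0 < \<beta>" "\<beta> * d < a" "0 \<le> a"
  obtains F where "\<And>k::nat. finite (F k)" "\<And>k. F k \<noteq> {}" "\<And>k. F k \<subseteq> X"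
    "\<And>k. real (card (F k)) \<le> 2 * 2 powr (k * a)"
    "\<And>x. x \<in> X \<Longrightarrow> \<forall>\<^sub>F k in sequentially. \<exists>z\<in>F k. dist x z \<le> 2 powr (- (k * \<beta>))"
proof -
  obtain \<T> where \<T>: "countable \<T>" "\<Union>\<T> = X" "\<And>T. T \<in> \<T> \<Longrightarrow> COV T < ereal d"
    using countable_cover_of_MaxMinCOV_less[OF assms(1,3)] by blast
  have "\<T> \<noteq> {}" using \<T>(2) assms(2) by auto
  define T where "T = from_nat_into \<T>"
  have T: "range T = \<T>"
    unfolding T_def using \<T>(1) \<open>\<T> \<noteq> {}\<close> by (simp add: range_from_nat_into)
  have "\<exists>c. \<forall>r. 0 < r \<and> r \<le> 1 \<longrightarrow> ereal_of_enat (covering_number r (T i)) \<le> ereal (c * r powr (- d))" for i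
    using T \<T>(3) by (intro COV_lessD) auto
  then obtain c where c: "\<And>i r. 0 < r \<Longrightarrow> r \<le> 1 \<Longrightarrow>
      ereal_of_enat (covering_number r (T i)) \<le> ereal (c i * r powr (- d))"
    by metis
  let ?r = "\<lambda>k::nat. 2 powr (- (k * \<beta>)) :: real"
  have r1: "?r k \<le> 1" for k
    using assms(4) by (simp add: powr_minus_divide ge_one_powr_ge_zero)
  have rd: "?r k powr (- d) = 2 powr (k * (\<beta> * d))" for k
    by (simp add: powr_powr mult_ac)
  have "\<exists>Z. finite Z \<and> Z \<subseteq> T i \<and> real (card Z) \<le> c i * 2 powr (k * (\<beta> * d)) \<and>
      (\<forall>x\<in>T i. \<exists>z\<in>Z. dist x z \<le> ?r k)" for i k
    using net_of_covering_number[OF c[of "?r k" i, unfolded rd]] r1 by (metis powr_gt_zero zero_neq_numeral)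
  then obtain Z where Z: "\<And>i k. finite (Z i k)" "\<And>i k. Z i k \<subseteq> T i"
    "\<And>i k. real (card (Z i k)) \<le> c i * 2 powr (real k * (\<beta> * d))"
    "\<And>i k x. x \<in> T i \<Longrightarrow> \<exists>z\<in>Z i k. dist x z \<le> ?r k"
    by metis
  obtain x0 where x0: "x0 \<in> X" using assms(2) by auto
  \<comment> \<open>A share of \<open>2 powr (k * a) / (k + 2)\<close> for each of at most
    \<open>k\<close> pieces keeps their total below \<open>2 powr (k * a)\<close>. The extra point
    \<open>x0\<close>, which keeps \<open>F k\<close> nonempty, is paid for by the factor 2 in the
    bound.\<close>
  define I where "I k = {i. i < k \<and> (real k + 2) * card (Z i k) \<le> 2 powr (k * a)}" for k
  define F where "F k = insert x0 (\<Union>i\<in>I k. Z i k)" for k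
  have finI: "finite (I k)" and cardI: "card (I k) \<le> k" for k
  proof -
    have "I k \<subseteq> {..<k}" by (auto simp: I_def)
    then show "finite (I k)" "card (I k) \<le> k"
      using card_mono[of "{..<k}" "I k"] by (auto intro: finite_subset)
  qed
  show thesis
  proof (rule that)
    show "finite (F k)" "F k \<noteq> {}" for k
      using Z(1) finI by (auto simp: F_def)
    show "F k \<subseteq> X" for k
      using Z(2) T \<T>(2) x0 unfolding F_def by blast
    show "real (card (F k)) \<le> 2 * 2 powr (k * a)" for k
    proof -
      have "card (F k) \<le> Suc (card (\<Union>i\<in>I k. Z i k))"
        unfolding F_def using card_insert_le_m1 by (simp add: card_insert_if Z(1) finI)
      also have "\<dots> \<le> Suc (\<Sum>i\<in>I k. card (Z i k))"
        using card_UN_le[OF finI] by simp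
      finally have "real (card (F k)) \<le> 1 + (\<Sum>i\<in>I k. real (card (Z i k)))"
        by (metis of_nat_Suc of_nat_le_iff of_nat_sum)
      also have "(\<Sum>i\<in>I k. real (card (Z i k))) \<le> (\<Sum>i\<in>I k. 2 powr (k * a) / (real k + 2))"
        by (intro sum_mono) (auto simp: I_def field_simps)
      also have "\<dots> = real (card (I k)) * (2 powr (k * a) / (real k + 2))"
        by simp
      also have "\<dots> \<le> (real k + 2) * (2 powr (k * a) / (real k + 2))"
        using cardI[of k] by (intro mult_right_mono) auto
      also have "\<dots> = 2 powr (k * a)"
        by (simp add: field_simps)
      finally show ?thesis
        using ge_one_powr_ge_zero[of 2 "k * a"] assms(6) by simp
    qed
    fix x assume "x \<in> X"
    then obtain i where i: "x \<in> T i" using T \<T>(2) by auto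
    define \<delta> where "\<delta> = a - \<beta> * d"
    have "\<delta> > 0" using assms(5) by (simp add: \<delta>_def)
    then have "((\<lambda>k::nat. (real k + 2) * c i * 2 powr (- (k * \<delta>))) \<longlongrightarrow> 0) sequentially"
      by real_asymp
    then have "\<forall>\<^sub>F k in sequentially. (real k + 2) * c i * 2 powr (- (k * \<delta>)) < 1"
      by (rule order_tendstoD) simp
    moreover have "\<forall>\<^sub>F k in sequentially. i < k"
      by (rule eventually_gt_at_top)
    ultimately show "\<forall>\<^sub>F k in sequentially. \<exists>z\<in>F k. dist x z \<le> ?r k"
    proof eventually_elim
      case (elim k)
      have "(real k + 2) * card (Z i k) \<le> (real k + 2) * (c i * 2 powr (real k * (\<beta> * d)))"
        using Z(3) by (intro mult_left_mono) auto
      also have "\<dots> = ((real k + 2) * c i * 2 powr (- (k * \<delta>))) * 2 powr (k * a)"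
        by (simp add: \<delta>_def powr_add[symmetric] algebra_simps)
      also have "\<dots> \<le> 1 * 2 powr (k * a)"
        using elim by (intro mult_right_mono) auto
      finally have "i \<in> I k" using elim by (simp add: I_def)
      then show ?case using Z(4)[OF i, of k] by (auto simp: F_def)
    qed
  qed
qed

section \<open>Exponential weights on finitely many arms\<close>

definition softmax :: "'b set \<Rightarrow> real \<Rightarrow> ('b \<Rightarrow> real) \<Rightarrow> 'b \<Rightarrow> real" where
  "softmax F \<eta> L i = exp (- \<eta> * L i) / (\<Sum>j\<in>F. exp (- \<eta> * L j))"

text \<open>Rewards are clipped to \<open>[0, 1]\<close> so that the loss estimates are bounded on all histories and not
  only on almost all of them.\<close>

primrec exp3_loss :: "'a set \<Rightarrow> real \<Rightarrow> nat \<Rightarrow> nat \<Rightarrow> (nat \<Rightarrow> 'a \<times> real) \<Rightarrow> 'a \<Rightarrow> real" where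
  "exp3_loss F \<eta> a 0 h = (\<lambda>i. 0)"
| "exp3_loss F \<eta> a (Suc n) h = (\<lambda>i. exp3_loss F \<eta> a n h i +
     (if fst (h (a + n)) = i
      then (1 - max 0 (min 1 (snd (h (a + n))))) / softmax F \<eta> (exp3_loss F \<eta> a n h) i else 0))"

text \<open>Multiply by \<open>exp u \<ge> 1 + u + u\<^sup>2 / 2\<close>: the product of the two
  quadratics is \<open>1 + u ^ 4 / 4\<close>.\<close>

lemma exp_minus_le_quadratic:
  fixes u :: real
  assumes "0 \<le> u"
  shows "exp (- u) \<le> 1 - u + u\<^sup>2 / 2"
proof -
  have "1 \<le> (1 - u + u\<^sup>2 / 2) * (1 + u + u\<^sup>2 / 2)"
    using zero_le_power2[of "u\<^sup>2"] by (simp add: algebra_simps power2_eq_square)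
  also have "\<dots> \<le> (1 - u + u\<^sup>2 / 2) * exp u"
  proof (rule mult_left_mono)
    show "1 + u + u\<^sup>2 / 2 \<le> exp u"
      using exp_lower_Taylor_quadratic[OF assms] .
    have "0 \<le> (1 - u)\<^sup>2" by simp
    then show "0 \<le> 1 - u + u\<^sup>2 / 2"
      by (simp add: power2_eq_square algebra_simps)
  qed
  finally show ?thesis
    by (simp add: exp_minus field_simps)
qed

context
  fixes F :: "'b set" and \<eta> :: real
  assumes F: "finite F" "F \<noteq> {}" and \<eta>: "0 < \<eta>"
begin

lemma exp_sum_pos: "0 < (\<Sum>j\<in>F. exp (- \<eta> * L j))"
  using F by (intro sum_pos) auto

lemma softmax_pos: "0 < softmax F \<eta> L i"
  unfolding softmax_def using exp_sum_pos[of L] by (intro divide_pos_pos) auto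

lemma sum_softmax: "(\<Sum>i\<in>F. softmax F \<eta> L i) = 1"
  unfolding softmax_def sum_divide_distrib[symmetric] using exp_sum_pos[of L] by simp

lemma exp_sum_bounds:
  assumes "\<And>i. i \<in> F \<Longrightarrow> 0 \<le> L i" "\<And>i. i \<in> F \<Longrightarrow> L i \<le> B"
  shows "exp (- \<eta> * B) \<le> (\<Sum>j\<in>F. exp (- \<eta> * L j))" "(\<Sum>j\<in>F. exp (- \<eta> * L j)) \<le> card F"
proof -
  have "(\<Sum>j\<in>F. exp (- \<eta> * L j)) \<le> (\<Sum>j\<in>F. 1)"
    using assms \<eta> by (intro sum_mono) auto
  then show "(\<Sum>j\<in>F. exp (- \<eta> * L j)) \<le> card F" by simp
  obtain i where i: "i \<in> F" using F by auto
  have "exp (- \<eta> * B) \<le> exp (- \<eta> * L i)"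
    using assms(2)[OF i] \<eta> by simp
  also have "\<dots> \<le> (\<Sum>j\<in>F. exp (- \<eta> * L j))"
    using F i by (intro member_le_sum) auto
  finally show "exp (- \<eta> * B) \<le> (\<Sum>j\<in>F. exp (- \<eta> * L j))" .
qed

lemma softmax_ge:
  assumes "\<And>i. i \<in> F \<Longrightarrow> 0 \<le> L i" "\<And>i. i \<in> F \<Longrightarrow> L i \<le> B" "i \<in> F"
  shows "exp (- \<eta> * B) / card F \<le> softmax F \<eta> L i"
  unfolding softmax_def
  using assms \<eta> exp_sum_bounds(2)[OF assms(1,2)] exp_sum_pos[of L]
  by (intro frac_le) auto

text \<open>Only the weight of the drawn arm changes, so the sum is multiplied by
  \<open>1 + p * (exp (- u) - 1)\<close> with \<open>u = \<eta> * l / p\<close>, where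
  \<open>p\<close> is the probability of that arm. The second-order term carries
  \<open>1 / p\<close>, which becomes the number of arms after averaging over the draw.\<close>

lemma ln_exp_sum_update:
  assumes i: "i \<in> F" and l: "0 \<le> l" "l \<le> 1"
  shows "ln (\<Sum>j\<in>F. exp (- \<eta> * (L j + (if i = j then l / softmax F \<eta> L j else 0))))
    \<le> ln (\<Sum>j\<in>F. exp (- \<eta> * L j)) - \<eta> * l + \<eta>\<^sup>2 / (2 * softmax F \<eta> L i)"
proof -
  let ?W = "\<Sum>j\<in>F. exp (- \<eta> * L j)" and ?p = "softmax F \<eta> L i"
  let ?W' = "\<Sum>j\<in>F. exp (- \<eta> * (L j + (if i = j then l / softmax F \<eta> L j else 0)))"
  define u where "u = \<eta> * l / ?p"
  have W: "0 < ?W" and p: "0 < ?p" by (rule exp_sum_pos softmax_pos)+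
  have W': "0 < ?W'" by (rule exp_sum_pos)
  have u: "0 \<le> u" using \<eta> l p by (simp add: u_def)
  have pW: "exp (- \<eta> * L i) = ?p * ?W"
    using W by (simp add: softmax_def)
  have "?W' = exp (- \<eta> * (L i + l / ?p)) + (\<Sum>j\<in>F - {i}. exp (- \<eta> * L j))"
    using F i by (subst sum.remove[OF F(1) i]) (auto intro!: sum.cong)
  also have "\<dots> = ?p * ?W * exp (- u) + (?W - ?p * ?W)"
    unfolding pW[symmetric] using F i
    by (simp add: sum_diff1 u_def exp_add[symmetric] algebra_simps)
  also have "\<dots> = ?W * (1 + ?p * (exp (- u) - 1))"
    by (simp add: algebra_simps)
  also have "\<dots> \<le> ?W * (1 + ?p * (- u + u\<^sup>2 / 2))"
    using W p exp_minus_le_quadratic[OF u] by (intro mult_left_mono add_left_mono) auto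
  also have "1 + ?p * (- u + u\<^sup>2 / 2) = 1 - \<eta> * l + \<eta>\<^sup>2 * l\<^sup>2 / (2 * ?p)"
    using p by (simp add: u_def field_simps power2_eq_square)
  finally have le: "?W' / ?W \<le> 1 - \<eta> * l + \<eta>\<^sup>2 * l\<^sup>2 / (2 * ?p)"
    using W by (simp add: field_simps)
  have "l\<^sup>2 \<le> 1" using l by (simp add: power_le_one)
  then have "\<eta>\<^sup>2 * l\<^sup>2 / (2 * ?p) \<le> \<eta>\<^sup>2 * 1 / (2 * ?p)"
    using p by (intro divide_right_mono mult_left_mono) auto
  with le have "?W' / ?W - 1 \<le> - \<eta> * l + \<eta>\<^sup>2 / (2 * ?p)" by simp
  moreover have "ln (?W' / ?W) \<le> ?W' / ?W - 1"
    using W W' by (intro ln_le_minus_one) auto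
  moreover have "ln (?W' / ?W) = ln ?W' - ln ?W"
    using W W' by (simp add: ln_div)
  ultimately show ?thesis by linarith
qed

text \<open>While the losses are at most \<open>B\<close>, no arm of \<open>F\<close> has
  probability below \<open>exp (- \<eta> * B) / card F\<close>, which bounds the next importance
  weight. The bound serves integrability of the potential; its size never enters the regret.\<close>

lemma exp3_loss_bounds:
  "\<exists>B. \<forall>h. \<forall>i\<in>F. 0 \<le> exp3_loss F \<eta> a n h i \<and> exp3_loss F \<eta> a n h i \<le> B"
proof (induction n)
  case 0
  show ?case by auto
next
  case (Suc n)
  then obtain B where B: "\<And>h i. i \<in> F \<Longrightarrow> 0 \<le> exp3_loss F \<eta> a n h i \<and> exp3_loss F \<eta> a n h i \<le> B"
    by blast
  have "0 \<le> exp3_loss F \<eta> a (Suc n) h i \<and>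
      exp3_loss F \<eta> a (Suc n) h i \<le> B + 1 / (exp (- \<eta> * B) / card F)" if i: "i \<in> F" for h i
  proof -
    let ?p = "softmax F \<eta> (exp3_loss F \<eta> a n h) i"
    let ?l = "1 - max 0 (min 1 (snd (h (a + n))))"
    have N: "0 < real (card F)" using F by (simp add: card_gt_0_iff)
    have p: "exp (- \<eta> * B) / card F \<le> ?p"
      using B i by (intro softmax_ge) auto
    have l: "0 \<le> ?l" "?l \<le> 1" by auto
    have "?l / ?p \<le> 1 / (exp (- \<eta> * B) / card F)"
      using l p N by (intro frac_le) auto
    moreover have "0 \<le> ?l / ?p" using l softmax_pos by (intro divide_nonneg_pos) auto
    moreover have "0 \<le> 1 / (exp (- \<eta> * B) / card F)" by simp
    ultimately show ?thesis
      using B[OF i, of h] by (auto simp del: max.bounded_iff)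
  qed
  then show ?case by blast
qed

end

lemma exp3_loss_cong:
  "(\<And>s. s < a + n \<Longrightarrow> h s = h' s) \<Longrightarrow> exp3_loss F \<eta> a n h = exp3_loss F \<eta> a n h'"
  by (induction n) auto

lemma measurable_softmax:
  assumes "finite F" "\<And>i. i \<in> F \<Longrightarrow> (\<lambda>h. L h i) \<in> borel_measurable N" "i \<in> F"
  shows "(\<lambda>h. softmax F \<eta> (L h) i) \<in> borel_measurable N"
  unfolding softmax_def using assms
  by (intro borel_measurable_divide borel_measurable_sum borel_measurable_exp measurable_compose[OF _ borel_measurable_exp] borel_measurable_times borel_measurable_const) auto

lemma measurable_exp3_loss:
  assumes F: "finite F" "\<And>i. i \<in> F \<Longrightarrow> {i} \<in> sets M" and i: "i \<in> F" and t: "a + n \<le> t"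
  shows "(\<lambda>h. exp3_loss F \<eta> a n h i) \<in> borel_measurable (history_space M t)"
  using i t
proof (induction n arbitrary: i)
  case 0
  show ?case by simp
next
  case (Suc n)
  have sm: "(\<lambda>h. softmax F \<eta> (exp3_loss F \<eta> a n h) i) \<in> borel_measurable (history_space M t)"
    using Suc F by (intro measurable_softmax) auto
  have "{x \<in> space M. x = i} = {i}"
    using sets.sets_into_space[OF F(2)[OF Suc.prems(1)]] by auto
  then have "Measurable.pred M (\<lambda>x. x = i)"
    unfolding pred_def using F(2)[OF Suc.prems(1)] by simp
  from measurable_history_arm[OF _ this, of "a + n" t]
  have p: "Measurable.pred (history_space M t) (\<lambda>h. fst (h (a + n)) = i)"
    using Suc.prems by simp
  have y: "(\<lambda>h. snd (h (a + n))) \<in> borel_measurable (history_space M t)"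
    using Suc.prems by (intro measurable_history_reward) auto
  note [measurable] = p y sm
  have [measurable]: "(\<lambda>h. exp3_loss F \<eta> a n h i) \<in> borel_measurable (history_space M t)"
    using Suc by auto
  show ?case
    unfolding exp3_loss.simps by measurable
qed

text \<open>Importance weighting makes the loss estimates unbiased, so the usual potential argument
  works in expectation. What happened before round \<open>a\<close> enters only through the regret
  accumulated at \<open>a\<close>, which lets the phases be chained. The comparator \<open>j\<close>
  is an arm of the net; discretization is paid for separately.\<close>

lemma exp3_regret:
  fixes M :: "'a measure" and \<eta> :: real and \<mu> :: "'a \<Rightarrow> real"
  assumes A: "bandit_algorithm M A" and P: "P \<in> M \<rightarrow>\<^sub>M prob_algebra borel"
    and AE: "\<And>x. x \<in> space M \<Longrightarrow> AE y in P x. 0 \<le> y \<and> y \<le> 1"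
    and mean: "\<And>x. x \<in> space M \<Longrightarrow> (\<integral>y. y \<partial>P x) = \<mu> x"
    and \<mu>: "\<mu> \<in> borel_measurable M" "\<And>x. x \<in> space M \<Longrightarrow> 0 \<le> \<mu> x \<and> \<mu> x \<le> 1"
    and F: "finite F" "F \<noteq> {}" "F \<subseteq> space M" "\<And>i. i \<in> F \<Longrightarrow> {i} \<in> sets M" and \<eta>: "0 < \<eta>"
    and law: "\<And>n h. n < m \<Longrightarrow> h \<in> space (history_space M (a + n)) \<Longrightarrow>
      A (a + n) h = finite_dist M F (softmax F \<eta> (exp3_loss F \<eta> a n h))"
    and j: "j \<in> F"
    and n: "n \<le> m"
  shows "(\<integral>h. (\<Sum>s<a + n. \<mu> j - \<mu> (fst (h s))) \<partial>history_law M A P (a + n)) \<le>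
    (\<integral>h. (\<Sum>s<a. \<mu> j - \<mu> (fst (h s))) \<partial>history_law M A P a) + ln (card F) / \<eta> + n * \<eta> * card F / 2"
proof -
  let ?N = "real (card F)" and ?L = "exp3_loss F \<eta> a" and ?p = "\<lambda>n h. softmax F \<eta> (exp3_loss F \<eta> a n h)"
  let ?S = "\<lambda>t h. \<Sum>s<t. \<mu> j - \<mu> (fst (h s))"
  define W where "W n h = (\<Sum>i\<in>F. exp (- \<eta> * ?L n h i))" for n h
  \<comment> \<open>The potential \<open>G\<close> decreases in expectation, and \<open>ln (W n h) / \<eta> + ?L n h j \<ge> 0\<close>.\<close>
  define G where "G n h = ln (W n h) / \<eta> + ?L n h j + ?S (a + n) h - n * \<eta> * ?N / 2" for n h
  have N: "1 \<le> ?N" using F by (simp add: Suc_le_eq card_gt_0_iff)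
  have jM: "j \<in> space M" using j F by auto
  have mL: "(\<lambda>h. ?L n h i) \<in> borel_measurable (history_space M (a + n))" if "i \<in> F" for n i
    by (rule measurable_exp3_loss[OF F(1) F(4) that]) auto
  have mW: "W n \<in> borel_measurable (history_space M (a + n))" for n
    unfolding W_def using mL by (intro borel_measurable_sum measurable_compose[OF _ borel_measurable_exp]) auto
  have mS: "?S t \<in> borel_measurable (history_space M t)" for t
    using \<mu>(1) by (intro borel_measurable_sum borel_measurable_diff borel_measurable_const measurable_history_arm) auto
  have mG: "G n \<in> borel_measurable (history_space M (a + n))" for n
    unfolding G_def
    by (intro borel_measurable_diff borel_measurable_add borel_measurable_divide borel_measurable_ln
        borel_measurable_const mW mL[OF j] mS)
  have bS: "\<bar>?S t h\<bar> \<le> real t * 1" if "h \<in> space (history_space M t)" for t h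
  proof (rule abs_arm_sum_le[OF that, where g = "\<lambda>x. \<mu> j - \<mu> x"])
    fix x assume "x \<in> space M"
    then show "\<bar>\<mu> j - \<mu> x\<bar> \<le> 1" using \<mu>(2)[OF jM] \<mu>(2)[of x] by (simp add: abs_le_iff)
  qed
  have "\<exists>B. \<forall>h\<in>space (history_space M (a + n)). \<bar>G n h\<bar> \<le> B" for n
  proof -
    obtain B where B: "\<And>h i. i \<in> F \<Longrightarrow> 0 \<le> ?L n h i \<and> ?L n h i \<le> B"
      using exp3_loss_bounds[OF F(1,2) \<eta>] by blast
    have "\<bar>G n h\<bar> \<le> (\<bar>\<eta> * B\<bar> + ln ?N) / \<eta> + \<bar>B\<bar> + (a + n) + n * \<eta> * ?N / 2"
      if h: "h \<in> space (history_space M (a + n))" for h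
    proof -
      have W: "exp (- \<eta> * B) \<le> W n h" "W n h \<le> ?N"
        unfolding W_def using exp_sum_bounds[OF F(1,2) \<eta>, of "?L n h" B] B by auto
      then have "- \<eta> * B \<le> ln (W n h)"
        by (metis exp_gt_zero ln_exp ln_mono less_le_trans)
      moreover have "ln (W n h) \<le> ln ?N"
        using W N by (intro ln_mono) (auto intro: less_le_trans[OF exp_gt_zero])
      moreover have "0 \<le> ln ?N" using N by simp
      ultimately have "\<bar>ln (W n h)\<bar> \<le> \<bar>\<eta> * B\<bar> + ln ?N" by linarith
      then have "\<bar>ln (W n h) / \<eta>\<bar> \<le> (\<bar>\<eta> * B\<bar> + ln ?N) / \<eta>"
        using \<eta> by (simp add: divide_right_mono)
      moreover have "\<bar>?L n h j\<bar> \<le> \<bar>B\<bar>" using B[OF j, of h] by simp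
      moreover have "\<bar>?S (a + n) h\<bar> \<le> real (a + n)" using bS[OF h] by simp
      moreover have "0 \<le> n * \<eta> * ?N / 2" using \<eta> by simp
      ultimately show ?thesis unfolding G_def by linarith
    qed
    then show ?thesis by blast
  qed
  then obtain B where B: "\<And>n h. h \<in> space (history_space M (a + n)) \<Longrightarrow> \<bar>G n h\<bar> \<le> B n"
    by metis
  have step: "(\<integral>h. G (Suc n) h \<partial>history_law M A P (a + Suc n)) \<le> (\<integral>h. G n h \<partial>history_law M A P (a + n))"
    if n: "n < m" for n
  proof -
    have mG': "G (Suc n) \<in> borel_measurable (history_space M (Suc (a + n)))"
      using mG[of "Suc n"] by simp
    have B': "\<bar>G (Suc n) h\<bar> \<le> B (Suc n)" if "h \<in> space (history_space M (Suc (a + n)))" for h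
      using B[of h "Suc n"] that by simp
    have "(\<integral>h. G (Suc n) h \<partial>history_law M A P (Suc (a + n))) \<le> (\<integral>h. G n h \<partial>history_law M A P (a + n))"
    proof (rule integral_history_law_Suc_le[OF A P mG' B' mG B], assumption, assumption)
      fix h assume h: "h \<in> space (history_space M (a + n))"
      let ?q = "?p n h"
      have q: "0 < ?q i" for i by (rule softmax_pos[OF F(1,2) \<eta>])
      have q1: "(\<Sum>i\<in>F. ?q i) = 1" by (rule sum_softmax[OF F(1,2) \<eta>])
      \<comment> \<open>\<open>c\<close> collects what depends neither on the drawn arm nor on its
        reward.\<close>
      define c where "c = ln (W n h) / \<eta> + ?L n h j + ?S (a + n) h + \<mu> j - (real n + 1) * \<eta> * ?N / 2"
      have inner: "(\<integral>y. G (Suc n) (h(a + n := (i, y))) \<partial>P i) \<le>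
          c + \<eta> / (2 * ?q i) - \<mu> i + ((if i = j then 1 / ?q i else 0) - 1) * (1 - \<mu> i)"
        if i: "i \<in> F" for i
      proof -
        have iM: "i \<in> space M" using i F by auto
        have sP: "sets (P i) = sets borel" and pP: "prob_space (P i)"
          using measurable_space[OF P iM] by (auto simp: space_prob_algebra)
        interpret Pi: prob_space "P i" by (rule pP)
        define l where "l y = 1 - max 0 (min 1 y)" for y :: real
        have l: "0 \<le> l y" "l y \<le> 1" for y by (auto simp: l_def)
        have ml: "l \<in> borel_measurable (P i)"
          unfolding measurable_cong_sets[OF sP refl] l_def by measurable
        have il: "integrable (P i) l"
          by (rule Pi.integrable_abs_le_const[OF ml, of 1]) (use l in auto)
        have "(\<integral>y. l y \<partial>P i) = (\<integral>y. 1 - y \<partial>P i)"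
        proof (rule integral_cong_AE)
          show "AE y in P i. l y = 1 - y"
            using AE[OF iM] by eventually_elim (auto simp: l_def)
          show "(\<lambda>y. 1 - y) \<in> borel_measurable (P i)"
            unfolding measurable_cong_sets[OF sP refl] by measurable
        qed (rule ml)
        also have "\<dots> = 1 - \<mu> i"
        proof -
          have "integrable (P i) (\<lambda>y. y)"
            by (rule Pi.integrable_const_bound[of _ 1])
              (use AE[OF iM] in \<open>auto simp: measurable_cong_sets[OF sP refl] elim: eventually_mono\<close>)
          then show ?thesis using mean[OF iM] by (simp add: Pi.prob_space)
        qed
        finally have El: "(\<integral>y. l y \<partial>P i) = 1 - \<mu> i" .
        have same: "exp3_loss F \<eta> a n (h(a + n := z)) = exp3_loss F \<eta> a n h" for z
          by (rule exp3_loss_cong) simp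
        have point: "G (Suc n) (h(a + n := (i, y))) \<le>
            (c + \<eta> / (2 * ?q i) - \<mu> i) + ((if i = j then 1 / ?q i else 0) - 1) * l y" for y
        proof -
          let ?h = "h(a + n := (i, y))"
          have L': "exp3_loss F \<eta> a (Suc n) ?h =
              (\<lambda>j. ?L n h j + (if i = j then l y / ?q j else 0))"
            unfolding exp3_loss.simps same fun_upd_same fst_conv snd_conv l_def ..
          have "ln (W (Suc n) ?h) \<le> ln (W n h) - \<eta> * l y + \<eta>\<^sup>2 / (2 * ?q i)"
            unfolding W_def L' by (rule ln_exp_sum_update[OF F(1,2) \<eta> i l])
          then have "ln (W (Suc n) ?h) / \<eta> \<le> (ln (W n h) - \<eta> * l y + \<eta>\<^sup>2 / (2 * ?q i)) / \<eta>"
            using \<eta> by (intro divide_right_mono) auto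
          also have "\<dots> = ln (W n h) / \<eta> - l y + \<eta> / (2 * ?q i)"
            using \<eta> q[of i] by (simp add: field_simps power2_eq_square)
          finally have 1: "ln (W (Suc n) ?h) / \<eta> \<le> ln (W n h) / \<eta> - l y + \<eta> / (2 * ?q i)" .
          have 2: "?L (Suc n) ?h j = ?L n h j + (if i = j then 1 / ?q i else 0) * l y"
            unfolding L' by simp
          have 3: "?S (a + Suc n) ?h = ?S (a + n) h + \<mu> j - \<mu> i"
            by simp
          have 4: "real (Suc n) * \<eta> * ?N / 2 = (real n + 1) * \<eta> * ?N / 2" by simp
          show ?thesis
            unfolding G_def c_def 2 3 4 using 1 by (simp add: left_diff_distrib)
        qed
        have "(\<integral>y. G (Suc n) (h(a + n := (i, y))) \<partial>P i) \<le>
          (\<integral>y. (c + \<eta> / (2 * ?q i) - \<mu> i) + ((if i = j then 1 / ?q i else 0) - 1) * l y \<partial>P i)"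
        proof (rule integral_mono)
          show "integrable (P i) (\<lambda>y. G (Suc n) (h(a + n := (i, y))))"
            by (rule Pi.integrable_abs_le_const[of _ "B (Suc n)"])
              (use measurable_history_update_reward[OF h iM mG'] B' history_update_in_space[OF h iM]
                in \<open>auto simp: measurable_cong_sets[OF sP refl]\<close>)
          show "integrable (P i) (\<lambda>y. (c + \<eta> / (2 * ?q i) - \<mu> i) + ((if i = j then 1 / ?q i else 0) - 1) * l y)"
            using il by auto
        qed (rule point)
        also have "\<dots> = (c + \<eta> / (2 * ?q i) - \<mu> i) + ((if i = j then 1 / ?q i else 0) - 1) * (1 - \<mu> i)"
          using il El by (simp add: Pi.prob_space)
        finally show ?thesis .
      qed
      have "(\<integral>x. (\<integral>y. G (Suc n) (h(a + n := (x, y))) \<partial>P x) \<partial>A (a + n) h) =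
        (\<Sum>i\<in>F. ?q i * (\<integral>y. G (Suc n) (h(a + n := (i, y))) \<partial>P i))"
        unfolding law[OF n h]
        by (rule integral_finite_dist[OF F(1) F(3) integral_history_law_Suc(4)[OF A P mG' B' h]])
          (use q in \<open>auto intro: less_imp_le\<close>)
      also have "\<dots> \<le> (\<Sum>i\<in>F. ?q i * (c + \<eta> / (2 * ?q i) - \<mu> i +
          ((if i = j then 1 / ?q i else 0) - 1) * (1 - \<mu> i)))"
        using inner q by (intro sum_mono mult_left_mono) (auto intro: less_imp_le)
      \<comment> \<open>Multiplying by the probability of an arm cancels its importance weight: each
        arm contributes \<open>\<eta> / 2\<close>, in total exactly the compensator of one round,
        and the comparator contributes \<open>1 - \<mu> j\<close>.\<close>
      also have "\<dots> = (\<Sum>i\<in>F. (c - 1) * ?q i + \<eta> / 2 + (if i = j then 1 - \<mu> i else 0))"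
      proof (rule sum.cong[OF refl])
        fix i
        show "?q i * (c + \<eta> / (2 * ?q i) - \<mu> i + ((if i = j then 1 / ?q i else 0) - 1) * (1 - \<mu> i)) =
          (c - 1) * ?q i + \<eta> / 2 + (if i = j then 1 - \<mu> i else 0)"
          using q[of i] by (auto simp: field_simps)
      qed
      also have "\<dots> = (c - 1) + ?N * \<eta> / 2 + (1 - \<mu> j)"
        using q1 F(1) j by (simp add: sum.distrib sum_distrib_left[symmetric])
      also have "\<dots> = G n h"
        unfolding c_def G_def by (simp add: algebra_simps add_divide_distrib)
      finally show "(\<integral>x. (\<integral>y. G (Suc n) (h(a + n := (x, y))) \<partial>P x) \<partial>A (a + n) h) \<le> G n h" .
    qed
    then show ?thesis by simp
  qed
  have all: "(\<integral>h. G n h \<partial>history_law M A P (a + n)) \<le> (\<integral>h. G 0 h \<partial>history_law M A P a)" if "n \<le> m" for n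
    using that
  proof (induction n)
    case (Suc n)
    then show ?case using step[of n] by simp
  qed simp
  interpret Q: prob_space "history_law M A P a" by (rule sets_history_law(2)[OF A P])
  interpret Q': prob_space "history_law M A P (a + n)" by (rule sets_history_law(2)[OF A P])
  have iS: "integrable (history_law M A P t) (?S t)" for t
    by (rule integrable_history_law[OF A P mS bS])
  have "(\<integral>h. ?S (a + n) h \<partial>history_law M A P (a + n)) - n * \<eta> * ?N / 2 =
      (\<integral>h. ?S (a + n) h - n * \<eta> * ?N / 2 \<partial>history_law M A P (a + n))"
    using iS[of "a + n"] by (subst Bochner_Integration.integral_diff) (auto simp: Q'.prob_space)
  also have "\<dots> \<le> (\<integral>h. G n h \<partial>history_law M A P (a + n))"
  proof (rule integral_mono)
    show "integrable (history_law M A P (a + n)) (G n)"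
      by (rule integrable_history_law[OF A P mG B])
    show "integrable (history_law M A P (a + n)) (\<lambda>h. ?S (a + n) h - n * \<eta> * ?N / 2)"
      using iS[of "a + n"] by (intro Bochner_Integration.integrable_diff) auto
    fix h
    have "exp (- \<eta> * ?L n h j) \<le> W n h"
      unfolding W_def using F(1) j by (intro member_le_sum) auto
    then have "- \<eta> * ?L n h j \<le> ln (W n h)"
      by (metis exp_gt_zero ln_exp ln_mono less_le_trans)
    then have "0 \<le> ln (W n h) / \<eta> + ?L n h j"
      using \<eta> by (simp add: field_simps)
    then show "?S (a + n) h - n * \<eta> * ?N / 2 \<le> G n h"
      unfolding G_def by simp
  qed
  also have "\<dots> \<le> (\<integral>h. G 0 h \<partial>history_law M A P a)"
    by (rule all[OF n])
  also have "\<dots> = (\<integral>h. ln ?N / \<eta> + ?S a h \<partial>history_law M A P a)"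
    by (simp add: G_def W_def)
  also have "\<dots> = ln ?N / \<eta> + (\<integral>h. ?S a h \<partial>history_law M A P a)"
    using iS[of a] by (subst Bochner_Integration.integral_add) (auto simp: Q.prob_space)
  finally show ?thesis by simp
qed

section \<open>The upper bound\<close>

text \<open>Phase \<open>k\<close> consists of the rounds \<open>2\<^sup>k - 1, \<dots>, 2\<^bsup>k+1\<^esup> - 2\<close>.\<close>

definition phase :: "nat \<Rightarrow> nat" where
  "phase t = (LEAST k. Suc t < 2 ^ Suc k)"

lemma phase_eqI:
  assumes "2 ^ k \<le> Suc t" "Suc t < 2 ^ Suc k"
  shows "phase t = k"
  unfolding phase_def
proof (rule Least_equality)
  fix j :: nat assume "Suc t < 2 ^ Suc j"
  with assms(1) have "(2::nat) ^ k < 2 ^ Suc j" by linarith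
  then show "k \<le> j" by (simp add: power_strict_increasing_iff[of 2, simplified] del: power_Suc)
qed fact

lemma phase_bounds: "2 ^ phase t \<le> Suc t" "Suc t < 2 ^ Suc (phase t)"
proof -
  have "Suc t < 2 ^ Suc t" by (rule less_exp)
  then show "Suc t < 2 ^ Suc (phase t)"
    unfolding phase_def by (rule LeastI)
  show "2 ^ phase t \<le> Suc t"
  proof (cases "phase t")
    case (Suc j)
    then have "\<not> Suc t < 2 ^ Suc j"
      unfolding phase_def by (intro not_less_Least) simp
    with Suc show ?thesis by simp
  qed simp
qed

text \<open>Losses are counted from the start \<open>2 ^ k - 1\<close> of the current phase
  \<open>k\<close>, so every phase restarts exponential weights with its own net and learning
  rate.\<close>

definition exp3_phases :: "'a measure \<Rightarrow> (nat \<Rightarrow> 'a set) \<Rightarrow> (nat \<Rightarrow> real) \<Rightarrow> 'a algorithm" where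
  "exp3_phases M F \<eta> t h =
     finite_dist M (F (phase t)) (softmax (F (phase t)) (\<eta> (phase t))
       (exp3_loss (F (phase t)) (\<eta> (phase t)) (2 ^ phase t - 1) (t - (2 ^ phase t - 1)) h))"

lemma bandit_algorithm_exp3_phases:
  assumes F: "\<And>k. finite (F k)" "\<And>k. F k \<noteq> {}" "\<And>k. F k \<subseteq> space M"
    "\<And>k i. i \<in> F k \<Longrightarrow> {i} \<in> sets M" and \<eta>: "\<And>k. 0 < \<eta> k"
  shows "bandit_algorithm M (exp3_phases M F \<eta>)"
  unfolding bandit_algorithm_def
proof
  fix t
  have t: "2 ^ phase t - 1 + (t - (2 ^ phase t - 1)) \<le> t"
    using phase_bounds(1)[of t] by simp
  show "exp3_phases M F \<eta> t \<in> history_space M t \<rightarrow>\<^sub>M prob_algebra M"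
    unfolding exp3_phases_def
    using F softmax_pos[OF F(1,2) \<eta>] sum_softmax[OF F(1,2) \<eta>]
    by (intro finite_dist_kernel measurable_softmax measurable_exp3_loss t) (auto intro: less_imp_le)
qed

text \<open>The phase costs form a geometric series of ratio \<open>2 powr \<gamma> > 1\<close>,
  which is dominated by its last term. The rounds before phase \<open>k0\<close> are absorbed by a
  constant through \<open>g t \<le> t\<close>.\<close>

lemma doubling_bound:
  fixes g :: "nat \<Rightarrow> real"
  assumes \<gamma>: "0 < \<gamma>" and C: "0 \<le> C" and le: "\<And>t. g t \<le> t"
    and step: "\<And>k n. k0 \<le> k \<Longrightarrow> n \<le> 2 ^ k \<Longrightarrow> g (2 ^ k - 1 + n) \<le> g (2 ^ k - 1) + C * 2 powr (k * \<gamma>)"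
  shows "\<exists>K. \<forall>t\<ge>1. g t \<le> K * real t powr \<gamma>"
proof -
  \<comment> \<open>\<open>D\<close> solves \<open>D + C = D * 2 powr \<gamma>\<close>, which makes
    the bound at the ends of phases reproduce itself.\<close>
  define D where "D = C / (2 powr \<gamma> - 1)"
  define K where "K = (2::real) ^ k0"
  have g1: "2 powr \<gamma> > 1" using \<gamma> by simp
  have "D * (2 powr \<gamma> - 1) = C" unfolding D_def using g1 by (intro nonzero_eq_divide_eq[THEN iffD1] refl) linarith
  then have D: "D + C = D * 2 powr \<gamma>" "0 \<le> D"
    using g1 C by (simp_all add: algebra_simps) (simp add: D_def)
  have K: "0 \<le> K" by (simp add: K_def)
  have ends: "g (2 ^ k - 1) \<le> K + D * 2 powr (k * \<gamma>)" if "k0 \<le> k" for k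
    using that
  proof (induction k rule: nat_induct_at_least)
    case base
    have "g (2 ^ k0 - 1) \<le> real (2 ^ k0 - 1)" by (rule le)
    also have "\<dots> \<le> K" by (simp add: K_def of_nat_diff)
    finally show ?case using D by (simp add: add_increasing2)
  next
    case (Suc k)
    have e: "(2::nat) ^ Suc k - 1 = 2 ^ k - 1 + 2 ^ k"
      using one_le_power[of "2::nat" k] by (simp add: mult_2)
    have "g (2 ^ Suc k - 1) \<le> g (2 ^ k - 1) + C * 2 powr (k * \<gamma>)"
      unfolding e by (rule step[OF Suc.hyps]) simp
    also have "\<dots> \<le> K + (D + C) * 2 powr (k * \<gamma>)"
      using Suc.IH by (simp add: algebra_simps)
    also have "\<dots> = K + D * 2 powr (real (Suc k) * \<gamma>)"
      unfolding D(1) by (simp add: powr_add[symmetric] algebra_simps)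
    finally show ?case .
  qed
  have "g t \<le> (K + (D + C) * 2 powr \<gamma>) * real t powr \<gamma>" if t: "1 \<le> t" for t
  proof -
    have t1: "1 \<le> real t powr \<gamma>"
      using t \<gamma> by (intro ge_one_powr_ge_zero) auto
    have Kt: "K \<le> K * real t powr \<gamma>"
      using mult_left_mono[OF t1 K] by simp
    have nn: "0 \<le> (D + C) * 2 powr \<gamma> * real t powr \<gamma>"
      using D C by simp
    show ?thesis
    proof (cases "k0 \<le> phase t")
      case True
      let ?k = "phase t"
      note b = phase_bounds[of t]
      have "t = 2 ^ ?k - 1 + (t - (2 ^ ?k - 1))" "t - (2 ^ ?k - 1) \<le> 2 ^ ?k"
        using b by auto
      then have "g t \<le> g (2 ^ ?k - 1) + C * 2 powr (?k * \<gamma>)"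
        using step[OF True, of "t - (2 ^ ?k - 1)"] by simp
      also have "\<dots> \<le> K + (D + C) * 2 powr (?k * \<gamma>)"
        using ends[OF True] by (simp add: algebra_simps)
      also have "2 powr (?k * \<gamma>) \<le> 2 powr \<gamma> * real t powr \<gamma>"
      proof -
        have "2 powr (?k * \<gamma>) = (2 ^ ?k) powr \<gamma>"
          by (simp add: powr_powr[symmetric] powr_realpow)
        also have "\<dots> \<le> (2 * real t) powr \<gamma>"
        proof (rule powr_mono2)
          have "2 ^ ?k \<le> 2 * t" using b(1) t by linarith
          then show "2 ^ ?k \<le> 2 * real t" by (metis of_nat_le_iff of_nat_mult of_nat_numeral of_nat_power)
        qed (use \<gamma> in auto)
        also have "\<dots> = 2 powr \<gamma> * real t powr \<gamma>" by (simp add: powr_mult)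
        finally show ?thesis .
      qed
      finally have "g t \<le> K + (D + C) * (2 powr \<gamma> * real t powr \<gamma>)"
        using D C by (simp add: mult_left_mono)
      also have "\<dots> \<le> K * real t powr \<gamma> + (D + C) * (2 powr \<gamma> * real t powr \<gamma>)"
        using Kt by simp
      finally show ?thesis by (simp add: algebra_simps)
    next
      case False
      have "Suc t < 2 ^ Suc (phase t)" by (rule phase_bounds)
      also have "\<dots> \<le> (2::nat) ^ k0" using False by (intro power_increasing) auto
      finally have "real t \<le> K"
        unfolding K_def by (metis Suc_lessD less_imp_le of_nat_le_iff of_nat_numeral of_nat_power)
      then show ?thesis
        using le[of t] Kt nn by (simp add: algebra_simps)
    qed
  qed
  then show ?thesis by blast
qed

section \<open>Measurability of payoffs, and regret as a single integral\<close>

lemma singleton_in_sets: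
  assumes "sets (restrict_space borel (space M)) \<subseteq> sets M" "x \<in> space M"
  shows "{x :: 'a::metric_space} \<in> sets M"
proof -
  have "{x} \<in> sets (restrict_space borel (space M))"
    using assms(2) by (auto simp: sets_restrict_space intro!: image_eqI[of _ _ "{x}"])
  with assms show ?thesis by auto
qed

lemma borel_measurable_of_continuous_on:
  fixes f :: "'a::metric_space \<Rightarrow> real"
  assumes "sets (restrict_space borel (space M)) \<subseteq> sets M" "continuous_on (space M) f"
  shows "f \<in> borel_measurable M"
proof -
  have "f \<in> borel_measurable (restrict_space borel (space M))"
    using assms(2) by (rule borel_measurable_continuous_on_restrict)
  then have "f -` S \<inter> space M \<in> sets (restrict_space borel (space M))" if "S \<in> sets borel" for S
    using that by (auto dest: measurable_sets simp: space_restrict_space)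
  then show ?thesis
    using assms(1) by (intro measurableI) auto
qed

lemma lipschitz_instanceD:
  assumes "lipschitz_instance M \<mu> P" and sets: "sets (restrict_space borel (space M)) \<subseteq> sets M"
  shows "P \<in> M \<rightarrow>\<^sub>M prob_algebra borel" "continuous_on (space M) \<mu>" "\<mu> \<in> borel_measurable M"
    "\<And>x. x \<in> space M \<Longrightarrow> 0 \<le> \<mu> x \<and> \<mu> x \<le> 1"
    "\<And>x y. x \<in> space M \<Longrightarrow> y \<in> space M \<Longrightarrow> \<bar>\<mu> x - \<mu> y\<bar> \<le> dist x y"
    "\<And>x. x \<in> space M \<Longrightarrow> AE y in P x. 0 \<le> y \<and> y \<le> 1"
    "\<And>x. x \<in> space M \<Longrightarrow> (\<integral>y. y \<partial>P x) = \<mu> x"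
proof -
  have L: "1-lipschitz_on (space M) \<mu>"
    using assms(1) by (simp add: lipschitz_instance_def)
  show c: "continuous_on (space M) \<mu>"
    by (rule lipschitz_on_continuous_on[OF L])
  show "\<mu> \<in> borel_measurable M"
    by (rule borel_measurable_of_continuous_on[OF sets c])
  show "\<And>x y. x \<in> space M \<Longrightarrow> y \<in> space M \<Longrightarrow> \<bar>\<mu> x - \<mu> y\<bar> \<le> dist x y"
    using lipschitz_onD[OF L] by (simp add: dist_real_def)
qed (use assms(1) in \<open>auto simp: lipschitz_instance_def\<close>)

text \<open>The level \<open>c\<close> is left free: it is the payoff of a net point in the upper
  bound and the supremum in the lower bound.\<close>

lemma regret_eq_integral:
  assumes A: "bandit_algorithm M A" and P: "P \<in> M \<rightarrow>\<^sub>M prob_algebra borel"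
    and \<mu>: "\<mu> \<in> borel_measurable M" "\<And>x. x \<in> space M \<Longrightarrow> 0 \<le> \<mu> x \<and> \<mu> x \<le> 1"
  shows "real t * c - (\<integral>h. (\<Sum>s<t. \<mu> (fst (h s))) \<partial>history_law M A P t) =
      (\<integral>h. (\<Sum>s<t. c - \<mu> (fst (h s))) \<partial>history_law M A P t)"
    and "0 \<le> (\<integral>h. (\<Sum>s<t. \<mu> (fst (h s))) \<partial>history_law M A P t)"
proof -
  interpret Q: prob_space "history_law M A P t" by (rule sets_history_law(2)[OF A P])
  have "\<bar>\<mu> x\<bar> \<le> 1" if "x \<in> space M" for x using \<mu>(2)[OF that] by simp
  then have "integrable (history_law M A P t) (\<lambda>h. \<Sum>s<t. \<mu> (fst (h s)))"
    by (intro integrable_history_law[OF A P measurable_arm_sum[OF \<mu>(1)] abs_arm_sum_le])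
  then show "real t * c - (\<integral>h. (\<Sum>s<t. \<mu> (fst (h s))) \<partial>history_law M A P t) =
      (\<integral>h. (\<Sum>s<t. c - \<mu> (fst (h s))) \<partial>history_law M A P t)"
    by (simp add: sum_subtractf Q.prob_space)
  note sp = sets_eq_imp_space_eq[OF sets_history_law(1)[OF A P, of t]]
  show "0 \<le> (\<integral>h. (\<Sum>s<t. \<mu> (fst (h s))) \<partial>history_law M A P t)"
  proof (intro Bochner_Integration.integral_nonneg sum_nonneg)
    fix h s assume "h \<in> space (history_law M A P t)" "s \<in> {..<t}"
    then show "0 \<le> \<mu> (fst (h s))"
      using \<mu>(2)[OF history_arm_in_space[of h t M s]] sp by auto
  qed
qed

lemma regret_le:
  assumes A: "bandit_algorithm M A" and inst: "lipschitz_instance M \<mu> P"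
    and sets: "sets (restrict_space borel (space M)) \<subseteq> sets M" and ne: "space M \<noteq> {}"
  shows "regret M A \<mu> P t \<le> t"
proof -
  note D = lipschitz_instanceD[OF inst sets]
  have "(SUP x\<in>space M. \<mu> x) \<le> 1"
    using D(4) ne by (intro cSUP_least) auto
  then have "real t * (SUP x\<in>space M. \<mu> x) \<le> real t"
    by (simp add: mult_left_le)
  then show ?thesis
    unfolding regret_def using regret_eq_integral(2)[OF A D(1,3,4), of t] by linarith
qed

lemma achieves_rate_upper:
  fixes M :: "'a::metric_space measure" and d \<beta> :: real
  assumes "compact (space M)" "space M \<noteq> {}"
    and sets: "sets (restrict_space borel (space M)) \<subseteq> sets M"
    and d: "MaxMinCOV (space M) < ereal d" "0 \<le> d" and \<beta>: "0 < \<beta>" "\<beta> * (d + 2) < 1"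
  shows "\<exists>A. bandit_algorithm M A \<and> achieves_rate M A (1 - \<beta>)"
proof -
  \<comment> \<open>The midpoint of \<open>\<beta> * d\<close> and \<open>1 - 2 * \<beta>\<close>,
    between which \<open>\<beta> * (d + 2) < 1\<close> leaves a gap.\<close>
  define a where "a = (\<beta> * d + (1 - 2 * \<beta>)) / 2"
  have a: "\<beta> * d < a" "a < 1 - 2 * \<beta>"
    using \<beta> by (auto simp: a_def field_simps)
  have "0 \<le> \<beta> * d" using \<beta> d by simp
  with a have a0: "0 \<le> a" by linarith
  have \<gamma>: "0 < 1 - \<beta>" using a a0 by linarith
  obtain F where F: "\<And>k::nat. finite (F k)" "\<And>k. F k \<noteq> {}" "\<And>k. F k \<subseteq> space M"
    "\<And>k. real (card (F k)) \<le> 2 * 2 powr (k * a)"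
    "\<And>x. x \<in> space M \<Longrightarrow> \<forall>\<^sub>F k in sequentially. \<exists>z\<in>F k. dist x z \<le> 2 powr (- (k * \<beta>))"
    using exploration_nets[OF assms(1,2) d(1) \<beta>(1) a(1) a0] by blast
  have F4: "{i} \<in> sets M" if "i \<in> F k" for i k
    using F(3) that by (intro singleton_in_sets[OF sets]) auto
  \<comment> \<open>Chosen so that \<open>2 ^ k * \<eta> k * 2 powr (k * a) = 2 powr (k * (1 -
    \<beta>))\<close>, the order of the discretization error.\<close>
  define \<eta> where "\<eta> k = 2 powr (- (real k * (a + \<beta>)))" for k
  have \<eta>: "0 < \<eta> k" for k by (simp add: \<eta>_def)
  let ?A = "exp3_phases M F \<eta>"
  have A: "bandit_algorithm M ?A"
    by (rule bandit_algorithm_exp3_phases[OF F(1,2,3) F4 \<eta>])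
  define \<delta> where "\<delta> = 1 - 2 * \<beta> - a"
  have "0 < \<delta>" using a by (simp add: \<delta>_def)
  then have "((\<lambda>k::nat. (ln 2 + k * a * ln 2) * 2 powr (- (k * \<delta>))) \<longlongrightarrow> 0) sequentially"
    by real_asymp
  then have "Bseq (\<lambda>k::nat. (ln 2 + k * a * ln 2) * 2 powr (- (k * \<delta>)))"
    by (intro convergent_imp_Bseq convergentI)
  then obtain C1 where C1: "0 < C1" "\<And>k::nat. \<bar>(ln 2 + k * a * ln 2) * 2 powr (- (k * \<delta>))\<bar> \<le> C1"
    unfolding Bseq_def by auto
  have "\<exists>K. \<forall>t\<ge>1. regret M ?A \<mu> P t \<le> K * real t powr (1 - \<beta>)" if inst: "lipschitz_instance M \<mu> P" for \<mu> P
  proof -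
    note D = lipschitz_instanceD[OF inst sets]
    obtain x where x: "x \<in> space M" "\<And>y. y \<in> space M \<Longrightarrow> \<mu> y \<le> \<mu> x"
      using continuous_attains_sup[OF assms(1,2) D(2)] by auto
    have sup: "(SUP y\<in>space M. \<mu> y) = \<mu> x"
      using x by (intro cSup_eq_maximum) auto
    \<comment> \<open>\<open>k0\<close> depends on the maximizer \<open>x\<close> and thereby on the
      instance; nothing else in the final constant does.\<close>
    obtain k0 where k0: "\<And>k. k0 \<le> k \<Longrightarrow> \<exists>z\<in>F k. dist x z \<le> 2 powr (- (real k * \<beta>))"
      using F(5)[OF x(1)] unfolding eventually_sequentially by blast
    show ?thesis
    proof (rule doubling_bound[OF \<gamma>, of "2 + C1" _ k0])
      show "regret M ?A \<mu> P t \<le> real t" for t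
        by (rule regret_le[OF A inst sets assms(2)])
      fix k n :: nat assume k: "k0 \<le> k" and n: "n \<le> 2 ^ k"
      let ?s = "2 ^ k - 1 :: nat"
      obtain z where z: "z \<in> F k" "dist x z \<le> 2 powr (- (real k * \<beta>))"
        using k0[OF k] by blast
      have zM: "z \<in> space M" using z F by auto
      have law: "?A (?s + m) h = finite_dist M (F k) (softmax (F k) (\<eta> k) (exp3_loss (F k) (\<eta> k) ?s m h))"
        if "m < 2 ^ k" for m h
      proof -
        have "(1::nat) \<le> 2 ^ k" by simp
        then have "phase (?s + m) = k"
          using that by (intro phase_eqI) auto
        then show ?thesis by (simp add: exp3_phases_def)
      qed
      let ?N = "real (card (F k))"
      have N: "1 \<le> ?N" using F(1,2) by (simp add: Suc_le_eq card_gt_0_iff)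
      note R = regret_eq_integral(1)[OF A D(1,3,4)]
      have "(\<integral>h. (\<Sum>s<?s + n. \<mu> z - \<mu> (fst (h s))) \<partial>history_law M ?A P (?s + n)) \<le>
        (\<integral>h. (\<Sum>s<?s. \<mu> z - \<mu> (fst (h s))) \<partial>history_law M ?A P ?s) + ln ?N / \<eta> k + n * \<eta> k * ?N / 2"
        by (rule exp3_regret[OF A D(1) D(6,7) D(3,4) F(1,2,3) F4 \<eta> law z(1) n])
      then have le: "real (?s + n) * \<mu> z - (\<integral>h. (\<Sum>s<?s + n. \<mu> (fst (h s))) \<partial>history_law M ?A P (?s + n)) \<le>
        real ?s * \<mu> z - (\<integral>h. (\<Sum>s<?s. \<mu> (fst (h s))) \<partial>history_law M ?A P ?s) +
          ln ?N / \<eta> k + n * \<eta> k * ?N / 2"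
        using R[of "?s + n" "\<mu> z"] R[of ?s "\<mu> z"] by linarith
      have e: "real (?s + n) * v = real ?s * v + real n * v" "real n * (v - w) = real n * v - real n * w"
        for v w :: real
        by (simp_all only: of_nat_add distrib_right right_diff_distrib)
      \<comment> \<open>Passing from the net point \<open>z\<close> to the maximizer
        \<open>x\<close> is charged for the \<open>n\<close> new rounds only, since the regret at
        the start of the phase is already measured against \<open>x\<close>.\<close>
      have 1: "regret M ?A \<mu> P (?s + n) \<le> regret M ?A \<mu> P ?s + n * (\<mu> x - \<mu> z) +
          ln ?N / \<eta> k + n * \<eta> k * ?N / 2"
        using le unfolding regret_def sup e by linarith
      have n': "real n \<le> 2 powr k"
        using n by (simp add: powr_realpow)
      have "n * (\<mu> x - \<mu> z) \<le> 2 powr k * 2 powr (- (real k * \<beta>))"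
        using n' D(5)[OF x(1) zM] z(2) x(2)[OF zM] by (intro mult_mono) auto
      also have "\<dots> = 2 powr (k * (1 - \<beta>))"
        by (simp add: powr_add[symmetric] algebra_simps)
      finally have 2: "n * (\<mu> x - \<mu> z) \<le> 2 powr (k * (1 - \<beta>))" .
      have "n * \<eta> k * ?N / 2 \<le> 2 powr k * \<eta> k * (2 * 2 powr (k * a)) / 2"
        using n' F(4)[of k] \<eta>[of k] by (intro divide_right_mono mult_mono) auto
      also have "\<dots> = 2 powr (k * (1 - \<beta>))"
        by (simp add: \<eta>_def powr_add[symmetric] algebra_simps)
      finally have 3: "n * \<eta> k * ?N / 2 \<le> 2 powr (k * (1 - \<beta>))" .
      have "ln ?N \<le> ln (2 * 2 powr (k * a))"
        using F(4)[of k] N by (intro ln_mono) auto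
      also have "\<dots> = ln 2 + k * a * ln 2"
        by (simp add: ln_mult ln_powr)
      finally have "ln ?N / \<eta> k \<le> (ln 2 + k * a * ln 2) / \<eta> k"
        using \<eta>[of k] by (intro divide_right_mono) auto
      also have "\<dots> = (ln 2 + k * a * ln 2) * 2 powr (- (k * \<delta>)) * 2 powr (k * (1 - \<beta>))"
        by (simp add: \<eta>_def \<delta>_def powr_minus_divide[symmetric] divide_inverse powr_minus[symmetric]
            powr_add[symmetric] algebra_simps)
      also have "\<dots> \<le> C1 * 2 powr (k * (1 - \<beta>))"
        using C1(2)[of k] by (intro mult_right_mono) auto
      finally have 4: "ln ?N / \<eta> k \<le> C1 * 2 powr (k * (1 - \<beta>))" .
      show "regret M ?A \<mu> P (2 ^ k - 1 + n) \<le> regret M ?A \<mu> P (2 ^ k - 1) + (2 + C1) * 2 powr (k * (1 - \<beta>))"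
        using 1 2 3 4 by (simp add: algebra_simps)
    qed (use C1 in auto)
  qed
  then show ?thesis
    using A unfolding achieves_rate_def by blast
qed

section \<open>The lower bound\<close>

text \<open>Averaging: the expected numbers of visits to disjoint sets add up to at most
  \<open>t\<close>.\<close>

lemma exists_rarely_pulled:
  fixes M :: "'a measure" and B :: "'b \<Rightarrow> 'a set"
  assumes A: "bandit_algorithm M A" and P: "P \<in> M \<rightarrow>\<^sub>M prob_algebra borel"
    and Z: "finite Z" "Z \<noteq> {}" and B: "\<And>z. z \<in> Z \<Longrightarrow> B z \<in> sets M" "disjoint_family_on B Z"
  obtains z where "z \<in> Z"
    "(\<integral>h. (\<Sum>s<t. indicator (B z) (fst (h s))) \<partial>history_law M A P t) \<le> real t / card Z"
proof -
  let ?Q = "history_law M A P t" and ?I = "\<lambda>z h. \<Sum>s<t. indicator (B z) (fst (h s)) :: real"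
  interpret Q: prob_space ?Q by (rule sets_history_law(2)[OF A P])
  have int: "integrable ?Q (?I z)" if "z \<in> Z" for z
    using B(1)[OF that]
    by (intro integrable_history_law[OF A P measurable_arm_sum abs_arm_sum_le[where C = 1]]) auto
  have "(\<Sum>z\<in>Z. \<integral>h. ?I z h \<partial>?Q) = (\<integral>h. (\<Sum>z\<in>Z. ?I z h) \<partial>?Q)"
    by (rule Bochner_Integration.integral_sum[symmetric]) (rule int)
  also have "\<dots> \<le> (\<integral>h. real t \<partial>?Q)"
  proof (rule integral_mono)
    show "integrable ?Q (\<lambda>h. \<Sum>z\<in>Z. ?I z h)"
      by (rule Bochner_Integration.integrable_sum) (rule int)
    fix h
    have "(\<Sum>z\<in>Z. ?I z h) = (\<Sum>s<t. \<Sum>z\<in>Z. indicator (B z) (fst (h s)))"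
      by (rule sum.swap)
    also have "\<dots> = (\<Sum>s<t. indicator (\<Union>z\<in>Z. B z) (fst (h s)))"
      by (simp add: indicator_UN_disjoint[OF Z(1) B(2)])
    also have "\<dots> \<le> (\<Sum>s<t. 1)"
      by (intro sum_mono) (simp add: indicator_def)
    finally show "(\<Sum>z\<in>Z. ?I z h) \<le> real t" by simp
  qed simp
  also have "\<dots> = real t" by (simp add: Q.prob_space)
  finally have sum: "(\<Sum>z\<in>Z. \<integral>h. ?I z h \<partial>?Q) \<le> real t" .
  have "\<exists>z\<in>Z. (\<integral>h. ?I z h \<partial>?Q) \<le> real t / card Z"
  proof (rule ccontr)
    assume "\<not> ?thesis"
    then have "(\<Sum>z\<in>Z. real t / card Z) < (\<Sum>z\<in>Z. \<integral>h. ?I z h \<partial>?Q)"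
      using Z by (intro sum_strict_mono) (auto simp: not_le)
    with sum Z show False by simp
  qed
  then show thesis using that by blast
qed

text \<open>The test function is the fraction of rounds spent outside \<open>B\<close>. Its mean is
  at least 1/2 under \<open>\<mu>\<close>, hence at least 1/4 under \<open>\<nu>\<close>, where each
  such round loses at least \<open>H\<close>.\<close>

lemma regret_ge_of_perturbation:
  fixes M :: "'a measure" and \<mu> \<nu> :: "'a \<Rightarrow> real"
  assumes A: "bandit_algorithm M A"
    and meas: "\<mu> \<in> borel_measurable M" "\<nu> \<in> borel_measurable M"
    and range: "\<And>x. x \<in> space M \<Longrightarrow> 1/4 \<le> \<mu> x \<and> \<mu> x \<le> 3/4"
      "\<And>x. x \<in> space M \<Longrightarrow> 1/4 \<le> \<nu> x \<and> \<nu> x \<le> 3/4"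
    and B: "B \<in> sets M" and H: "0 \<le> H"
    and eq: "\<And>x. x \<in> space M \<Longrightarrow> x \<notin> B \<Longrightarrow> \<nu> x = \<mu> x"
    and near: "\<And>x. x \<in> space M \<Longrightarrow> \<bar>\<mu> x - \<nu> x\<bar> \<le> 2 * H"
    and gap: "\<And>x. x \<in> space M \<Longrightarrow> \<nu> x \<le> c" "\<And>x. x \<in> space M \<Longrightarrow> x \<notin> B \<Longrightarrow> \<nu> x + H \<le> c"
    and t: "1 \<le> t"
    and rare: "(\<integral>h. (\<Sum>s<t. indicator B (fst (h s))) \<partial>history_law M A (\<lambda>x. bernoulli_dist (\<mu> x)) t) \<le> real t / 2"
      "24 * H\<^sup>2 * (\<integral>h. (\<Sum>s<t. indicator B (fst (h s))) \<partial>history_law M A (\<lambda>x. bernoulli_dist (\<mu> x)) t) \<le> 1 / 64"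
  shows "real t * H / 4 \<le> (\<integral>h. (\<Sum>s<t. c - \<nu> (fst (h s))) \<partial>history_law M A (\<lambda>x. bernoulli_dist (\<nu> x)) t)"
proof -
  let ?Q = "history_law M A (\<lambda>x. bernoulli_dist (\<mu> x)) t"
  let ?Q' = "history_law M A (\<lambda>x. bernoulli_dist (\<nu> x)) t"
  let ?I = "\<lambda>h. \<Sum>s<t. indicator B (fst (h s)) :: real"
  note ker = bernoulli_kernels[OF A meas range]
  interpret Q: prob_space ?Q by (rule sets_history_law(2)[OF A ker(1)])
  interpret Q': prob_space ?Q' by (rule sets_history_law(2)[OF A ker(2)])
  have mI: "?I \<in> borel_measurable (history_space M t)"
    using B by (intro measurable_arm_sum) auto
  have bI: "\<bar>?I h\<bar> \<le> real t * 1" if "h \<in> space (history_space M t)" for h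
    using that by (intro abs_arm_sum_le) auto
  note iI = integrable_history_law[OF A ker(1) mI bI] integrable_history_law[OF A ker(2) mI bI]
  have I0: "0 \<le> ?I h" for h by (intro sum_nonneg) simp
  define f where "f h = 1 - ?I h / t" for h :: "nat \<Rightarrow> 'a \<times> real"
  have mf: "f \<in> borel_measurable (history_space M t)"
    unfolding f_def using mI by measurable
  have f01: "0 \<le> f h \<and> f h \<le> 1" if "h \<in> space (history_space M t)" for h
    using bI[OF that] I0[of h] t by (auto simp: f_def field_simps)
  have Ef: "(\<integral>h. f h \<partial>?Q) = 1 - (\<integral>h. ?I h \<partial>?Q) / t"
    unfolding f_def using iI(1) by (simp add: Q.prob_space)
  have half: "1 / 2 \<le> (\<integral>h. f h \<partial>?Q)"
    unfolding Ef using rare(1) t by (simp add: field_simps)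
  have "(\<integral>h. (\<Sum>s<t. (\<mu> (fst (h s)) - \<nu> (fst (h s)))\<^sup>2) \<partial>?Q) \<le> (\<integral>h. 4 * H\<^sup>2 * ?I h \<partial>?Q)"
  proof (rule integral_mono)
    have "\<bar>(\<mu> x - \<nu> x)\<^sup>2\<bar> \<le> 1" if "x \<in> space M" for x
      using range(1)[OF that] range(2)[OF that] by (auto simp: abs_square_le_1)
    then show "integrable ?Q (\<lambda>h. \<Sum>s<t. (\<mu> (fst (h s)) - \<nu> (fst (h s)))\<^sup>2)"
      using meas by (intro integrable_history_law[OF A ker(1) measurable_arm_sum abs_arm_sum_le]) auto
    show "integrable ?Q (\<lambda>h. 4 * H\<^sup>2 * ?I h)" using iI by simp
    fix h assume "h \<in> space ?Q"
    then have h: "h \<in> space (history_space M t)"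
      using sets_eq_imp_space_eq[OF sets_history_law(1)[OF A ker(1), of t]] by simp
    show "(\<Sum>s<t. (\<mu> (fst (h s)) - \<nu> (fst (h s)))\<^sup>2) \<le> 4 * H\<^sup>2 * ?I h"
      unfolding sum_distrib_left
    proof (rule sum_mono)
      fix s assume "s \<in> {..<t}"
      then have x: "fst (h s) \<in> space M" using history_arm_in_space[OF h] by simp
      have "(\<mu> (fst (h s)) - \<nu> (fst (h s)))\<^sup>2 \<le> (2 * H)\<^sup>2"
        using near[OF x] H by (intro abs_le_square_iff[THEN iffD1]) simp
      then show "(\<mu> (fst (h s)) - \<nu> (fst (h s)))\<^sup>2 \<le> 4 * H\<^sup>2 * indicator B (fst (h s))"
        using eq[OF x] by (cases "fst (h s) \<in> B") (auto simp: power_mult_distrib)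
    qed
  qed
  then have "6 * (\<integral>h. (\<Sum>s<t. (\<mu> (fst (h s)) - \<nu> (fst (h s)))\<^sup>2) \<partial>?Q) / (1/8) \<le> 1 / 8"
    using rare(2) by simp
  \<comment> \<open>The choice \<open>a = 1/8\<close> leaves \<open>1/2 - 1/8 - 1/8\<close>, as the
    entropy term is at most 8/64. The factor 24 in the hypothesis is \<open>6 * 2\<^sup>2\<close>,
    since the payoffs differ by up to \<open>2 * H\<close>.\<close>
  with expectation_change_le[OF A meas range mf f01, of "1/8"] half
  have f4: "1 / 4 \<le> (\<integral>h. f h \<partial>?Q')" by simp
  have Ef': "(\<integral>h. f h \<partial>?Q') = 1 - (\<integral>h. ?I h \<partial>?Q') / t"
    unfolding f_def using iI(2) by (simp add: Q'.prob_space)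
  have "real t * H / 4 = (real t * H) * (1 / 4)" by simp
  also have "\<dots> \<le> (real t * H) * (\<integral>h. f h \<partial>?Q')"
    using f4 H by (intro mult_left_mono) auto
  also have "\<dots> = (\<integral>h. H * (real t - ?I h) \<partial>?Q')"
    unfolding Ef' using iI(2) t by (simp add: Q'.prob_space field_simps)
  also have "\<dots> \<le> (\<integral>h. (\<Sum>s<t. c - \<nu> (fst (h s))) \<partial>?Q')"
  proof (rule integral_mono)
    show "integrable ?Q' (\<lambda>h. H * (real t - ?I h))" using iI by simp
    have "\<bar>c - \<nu> x\<bar> \<le> \<bar>c\<bar> + 1" if "x \<in> space M" for x
      using range(2)[OF that] by auto
    then show "integrable ?Q' (\<lambda>h. \<Sum>s<t. c - \<nu> (fst (h s)))"
      using meas by (intro integrable_history_law[OF A ker(2) measurable_arm_sum[where g = "\<lambda>x. c - \<nu> x"]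
          abs_arm_sum_le[where g = "\<lambda>x. c - \<nu> x"]]) auto
    fix h assume "h \<in> space ?Q'"
    then have h: "h \<in> space (history_space M t)"
      using sets_eq_imp_space_eq[OF sets_history_law(1)[OF A ker(2), of t]] by simp
    have "H * (real t - ?I h) = (\<Sum>s<t. H * (1 - indicator B (fst (h s))))"
      by (simp add: sum_distrib_left[symmetric] sum_subtractf)
    also have "\<dots> \<le> (\<Sum>s<t. c - \<nu> (fst (h s)))"
    proof (rule sum_mono)
      fix s assume "s \<in> {..<t}"
      then have x: "fst (h s) \<in> space M" using history_arm_in_space[OF h] by simp
      show "H * (1 - indicator B (fst (h s))) \<le> c - \<nu> (fst (h s))"
        using gap[OF x] by (cases "fst (h s) \<in> B") auto
    qed
    finally show "H * (real t - ?I h) \<le> (\<Sum>s<t. c - \<nu> (fst (h s)))" .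
  qed
  finally show ?thesis .
qed

text \<open>The constant \<open>c\<close> is prescribed before the scale \<open>r\<close> is found;
  this freedom is what later beats any constant in front of the rate.\<close>

lemma not_covering_of_COV_greater:
  assumes "ereal d < COV U" "0 \<le> d"
  shows "\<exists>r. 0 < r \<and> r \<le> 1 \<and> ereal (c * r powr (- d)) < ereal_of_enat (covering_number r U)"
proof (rule ccontr)
  assume "\<not> ?thesis"
  then have "\<forall>r. 0 < r \<and> r \<le> 1 \<longrightarrow> ereal_of_enat (covering_number r U) \<le> ereal (c * r powr (- d))"
    by (auto simp: not_less)
  then have "COV U \<le> ereal d"
    unfolding COV_def using assms(2) by (intro Inf_lower) blast
  with assms(1) show False by simp
qed

text \<open>A truncated cone: it has slope 1, equals \<open>\<rho>\<close> up to distance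
  \<open>\<rho>\<close> from \<open>y\<close> and vanishes from distance \<open>2 * \<rho>\<close>
  on. The flat top is where the next bump is placed.\<close>

definition bump :: "'a::metric_space \<Rightarrow> real \<Rightarrow> 'a \<Rightarrow> real" where
  "bump y \<rho> x = max 0 (min \<rho> (2 * \<rho> - dist x y))"

text \<open>At a suitable scale \<open>r\<close> there are more than \<open>c * r powr (- d)\<close>
  separated centres, and the ball about one of them is rarely visited during about
  \<open>card Z / H\<^sup>2\<close> rounds. With \<open>H\<close> proportional to \<open>r\<close>
  this time is at least of order \<open>r powr (- (d + 2))\<close>, and
  \<open>(1 - \<gamma>) * (d + 2) > 1\<close> makes \<open>t * H\<close> exceed
  \<open>K * t powr \<gamma>\<close>.\<close>

lemma perturbation_step:
  fixes M :: "'a::metric_space measure" and d \<gamma> \<kappa> K :: real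
  assumes "compact (space M)" and sets: "sets (restrict_space borel (space M)) \<subseteq> sets M"
    and A: "bandit_algorithm M A" and P: "P \<in> M \<rightarrow>\<^sub>M prob_algebra borel"
    and Y: "Y \<subseteq> space M" "\<And>U. U \<noteq> {} \<Longrightarrow> openin (top_of_set Y) U \<Longrightarrow> ereal d < COV U"
    and d: "0 \<le> d" and \<gamma>: "1 < (1 - \<gamma>) * (d + 2)"
    and y: "y \<in> Y" and \<rho>: "0 < \<rho>" and \<kappa>: "0 < \<kappa>" "\<kappa> \<le> 1"
  obtains y' \<rho>' t where "y' \<in> Y" "0 < \<rho>'" "dist y y' + 2 * \<rho>' \<le> \<rho>" "1 \<le> t"
    "(\<integral>h. (\<Sum>s<t. indicator (ball y' (2 * \<rho>')) (fst (h s))) \<partial>history_law M A P t) \<le> real t / 2"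
    "24 * (\<kappa> * \<rho>')\<^sup>2 *
      (\<integral>h. (\<Sum>s<t. indicator (ball y' (2 * \<rho>')) (fst (h s))) \<partial>history_law M A P t) \<le> 1 / 64"
    "K * real t powr \<gamma> \<le> real t * (\<kappa> * \<rho>')"
proof -
  define U where "U = Y \<inter> ball y (\<rho> / 2)"
  have "U \<noteq> {}" "openin (top_of_set Y) U"
    using y \<rho> by (auto simp: U_def openin_open)
  then have COV: "ereal d < COV U" by (rule Y(2))
  have \<gamma>1: "0 < 1 - \<gamma>"
    using \<gamma> d by (smt (verit) mult_nonpos_nonneg)
  \<comment> \<open>Both constants are read off from the final estimate, which uses
    \<open>K \<le> u * \<kappa> / 12\<close> and \<open>(c / 32) powr (1 - \<gamma>) = u\<close>. As
    \<open>u \<ge> 1\<close>, also \<open>c \<ge> 32\<close>, so there are more than 32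
    centres.\<close>
  define u where "u = max 1 (12 * K / \<kappa>)"
  define c where "c = 32 * u powr (1 / (1 - \<gamma>))"
  have c32: "32 \<le> c"
    using ge_one_powr_ge_zero[of u "1 / (1 - \<gamma>)"] \<gamma>1 by (simp add: c_def u_def)
  have cu: "(c / 32) powr (1 - \<gamma>) = u"
    using \<gamma>1 by (simp add: c_def powr_powr u_def)
  obtain r where r: "0 < r" "r \<le> 1" "ereal (c * r powr (- d)) < ereal_of_enat (covering_number r U)"
    using not_covering_of_COV_greater[OF COV d] by blast
  obtain Z where Z: "finite Z" "Z \<subseteq> U"
    "\<And>x y. x \<in> Z \<Longrightarrow> y \<in> Z \<Longrightarrow> x \<noteq> y \<Longrightarrow> r / 3 \<le> dist x y"
    "covering_number r U \<le> enat (card Z)"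
    using covering_number_le_packing[OF assms(1) _ r(1), of U] Y(1) unfolding U_def by blast
  let ?m = "real (card Z)"
  have "ereal_of_enat (covering_number r U) \<le> ereal ?m"
    using Z(4) by (metis ereal_of_enat_le_iff ereal_of_enat_simps(1))
  with r(3) have m: "c * r powr (- d) < ?m"
    by (metis ereal_less(1) less_ereal.simps(1) less_le_trans)
  have "1 \<le> r powr (- d)"
    using r d by (simp add: powr_minus_divide powr_le1)
  then have "c \<le> c * r powr (- d)"
    using c32 mult_left_mono[of 1 "r powr (- d)" c] by simp
  with m c32 have m32: "32 < ?m" by linarith
  then have "1 < card Z" by linarith
  then obtain z1 z2 where "z1 \<in> Z" "z2 \<in> Z" "z1 \<noteq> z2"
    by (metis card_le_Suc0_iff_eq Z(1) One_nat_def not_less)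
  \<comment> \<open>Two centres at distance at least \<open>r / 3\<close> within
    \<open>\<rho> / 2\<close> of \<open>y\<close> force \<open>r < 3 * \<rho>\<close>. Hence the new
    support, of radius \<open>r / 6\<close>, stays within the plateau of radius
    \<open>\<rho>\<close>.\<close>
  then have "r / 3 \<le> dist z1 z2" "dist y z1 < \<rho> / 2" "dist y z2 < \<rho> / 2"
    using Z by (auto simp: U_def)
  then have r\<rho>: "r < 3 * \<rho>"
    using dist_triangle3[of z1 z2 y] by linarith
  \<comment> \<open>One twelfth of \<open>r\<close> makes the balls of radius
    \<open>2 * \<rho>' = r / 6\<close> about \<open>r / 3\<close>-separated centres
    disjoint.\<close>
  define \<rho>' where "\<rho>' = r / 12"
  define H where "H = \<kappa> * \<rho>'"
  have H: "0 < H" "H \<le> r / 12"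
    using \<kappa> r by (auto simp: H_def \<rho>'_def mult_left_le_one_le)
  \<comment> \<open>The longest time during which the change stays hidden:
    \<open>24 * H\<^sup>2 * t / m \<le> 1 / 64\<close> amounts to
    \<open>t \<le> m / (1536 * H\<^sup>2)\<close> for \<open>m\<close> centres. Rounding down costs
    at most a factor 2, whence 3072 below.\<close>
  define t where "t = nat \<lfloor>?m / (1536 * H\<^sup>2)\<rfloor>"
  have H2: "H\<^sup>2 \<le> r\<^sup>2 / 144"
    using power_mono[OF H(2), of 2] H by (simp add: power_divide)
  have "H\<^sup>2 \<le> 1 / 144"
    using H2 power_le_one[of r 2] r by simp
  then have v1: "1 \<le> ?m / (1536 * H\<^sup>2)"
    using m32 H(1) by (simp add: field_simps)
  have t_le: "real t \<le> ?m / (1536 * H\<^sup>2)"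
    unfolding t_def using v1 by simp
  have t1: "1 \<le> t"
    unfolding t_def using v1 by (simp add: le_nat_iff)
  have "?m / (1536 * H\<^sup>2) < real t + 1"
    unfolding t_def using v1 by linarith
  then have "?m / (1536 * H\<^sup>2) \<le> 2 * real t"
    using t1 by linarith
  then have t_ge: "?m / (3072 * H\<^sup>2) \<le> real t"
    by (simp add: field_simps)
  have B: "ball z (2 * \<rho>') \<inter> space M \<in> sets M" for z
    by (rule subsetD[OF sets], unfold sets_restrict_space)
      (rule image_eqI[of _ _ "ball z (2 * \<rho>')"], auto)
  have disj: "disjoint_family_on (\<lambda>z. ball z (2 * \<rho>') \<inter> space M) Z"
    unfolding disjoint_family_on_def
  proof safe
    fix z z' x assume zs: "z \<in> Z" "z' \<in> Z" "z \<noteq> z'" "x \<in> ball z (2 * \<rho>')" "x \<in> ball z' (2 * \<rho>')"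
    then have "dist z z' < 2 * \<rho>' + 2 * \<rho>'"
      using dist_triangle2[of z z' x] by auto
    then show "x \<in> {}" using Z(3)[OF zs(1-3)] by (simp add: \<rho>'_def)
  qed
  have "Z \<noteq> {}" using \<open>1 < card Z\<close> by auto
  obtain z where z: "z \<in> Z"
    "(\<integral>h. (\<Sum>s<t. indicator (ball z (2 * \<rho>') \<inter> space M) (fst (h s))) \<partial>history_law M A P t) \<le> real t / ?m"
    using exists_rarely_pulled[OF A P Z(1) \<open>Z \<noteq> {}\<close> B disj, of t] by blast
  let ?E = "\<integral>h. (\<Sum>s<t. indicator (ball z (2 * \<rho>')) (fst (h s)) :: real) \<partial>history_law M A P t"
  have "?E = (\<integral>h. (\<Sum>s<t. indicator (ball z (2 * \<rho>') \<inter> space M) (fst (h s))) \<partial>history_law M A P t)"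
  proof (intro Bochner_Integration.integral_cong refl sum.cong)
    fix h s assume "h \<in> space (history_law M A P t)" "s \<in> {..<t}"
    then have "fst (h s) \<in> space M"
      using sets_eq_imp_space_eq[OF sets_history_law(1)[OF A P, of t]] history_arm_in_space[of h t M s] by simp
    then show "indicator (ball z (2 * \<rho>')) (fst (h s)) =
        (indicator (ball z (2 * \<rho>') \<inter> space M) (fst (h s)) :: real)"
      by (simp add: indicator_def)
  qed
  with z(2) have E: "?E \<le> real t / ?m" by simp
  show thesis
  proof (rule that[of z \<rho>' t])
    show "z \<in> Y" using z Z by (auto simp: U_def)
    show "0 < \<rho>'" using r by (simp add: \<rho>'_def)
    have "dist y z < \<rho> / 2" using z Z by (auto simp: U_def)
    then show "dist y z + 2 * \<rho>' \<le> \<rho>" using r\<rho> by (simp add: \<rho>'_def)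
    show "1 \<le> t" by (rule t1)
    have "real t / ?m \<le> real t / 2"
      using m32 by (intro divide_left_mono) auto
    with E show "?E \<le> real t / 2" by linarith
    have "24 * H\<^sup>2 * ?E \<le> 24 * H\<^sup>2 * (real t / ?m)"
      using E by (intro mult_left_mono) auto
    also have "\<dots> \<le> 24 * H\<^sup>2 * (1 / (1536 * H\<^sup>2))"
    proof (rule mult_left_mono)
      show "real t / ?m \<le> 1 / (1536 * H\<^sup>2)"
        using t_le m32 H(1) by (simp add: field_simps)
    qed simp
    also have "\<dots> = 1 / 64" using H(1) by simp
    finally show "24 * (\<kappa> * \<rho>')\<^sup>2 * ?E \<le> 1 / 64" by (simp add: H_def)
    have "(c / 32) * r powr (- (d + 2)) = (c * r powr (- d)) / (32 * r\<^sup>2)"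
      using r by (simp add: powr_diff powr_minus powr_add field_simps)
    also have "\<dots> \<le> ?m / (32 * r\<^sup>2)"
      using m by (intro divide_right_mono) auto
    also have "\<dots> \<le> ?m / (3072 * H\<^sup>2)"
    proof (rule divide_left_mono)
      show "3072 * H\<^sup>2 \<le> 32 * r\<^sup>2" using H2 zero_le_power2[of H] by linarith
    qed (use H(1) r in auto)
    also note t_ge
    finally have "((c / 32) * r powr (- (d + 2))) powr (1 - \<gamma>) \<le> real t powr (1 - \<gamma>)"
      using \<gamma>1 c32 by (intro powr_mono2) auto
    also have "((c / 32) * r powr (- (d + 2))) powr (1 - \<gamma>) = u * r powr (- ((1 - \<gamma>) * (d + 2)))"
      unfolding cu[symmetric] powr_mult powr_powr by (simp add: algebra_simps)
    finally have t\<gamma>: "u * r powr (- ((1 - \<gamma>) * (d + 2))) \<le> real t powr (1 - \<gamma>)" .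
    have "u * (1 / r) \<le> u * r powr (- ((1 - \<gamma>) * (d + 2)))"
    proof (rule mult_left_mono)
      have "r powr (- 1) \<le> r powr (- ((1 - \<gamma>) * (d + 2)))"
        using r \<gamma> by (intro powr_mono') auto
      then show "1 / r \<le> r powr (- ((1 - \<gamma>) * (d + 2)))"
        using r by (simp add: powr_minus_divide)
    qed (simp add: u_def)
    also note t\<gamma>
    finally have "u * (1 / r) * H \<le> real t powr (1 - \<gamma>) * H"
      using H by (intro mult_right_mono) auto
    moreover have "u * (1 / r) * H = u * \<kappa> / 12"
      using r by (simp add: H_def \<rho>'_def)
    moreover have "K \<le> u * \<kappa> / 12"
      using \<kappa> by (simp add: u_def max_def field_simps)
    ultimately have "K \<le> real t powr (1 - \<gamma>) * H" by linarith
    then have "K * real t powr \<gamma> \<le> real t powr (1 - \<gamma>) * H * real t powr \<gamma>"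
      by (intro mult_right_mono) auto
    also have "\<dots> = real t powr (1 - \<gamma> + \<gamma>) * H"
      by (simp only: powr_add ac_simps)
    also have "\<dots> = real t * H"
      using t1 by simp
    finally show "K * real t powr \<gamma> \<le> real t * (\<kappa> * \<rho>')" by (simp add: H_def)
  qed
qed

section \<open>Properties of bumps and the instance assembled from them\<close>

lemma bump_bounds: "0 \<le> \<rho> \<Longrightarrow> 0 \<le> bump y \<rho> x \<and> bump y \<rho> x \<le> \<rho>"
  by (auto simp: bump_def)

lemma bump_eq_0: "x \<notin> ball y (2 * \<rho>) \<Longrightarrow> bump y \<rho> x = 0"
  by (auto simp: bump_def dist_commute)

lemma bump_eq_height: "0 \<le> \<rho> \<Longrightarrow> dist x y \<le> \<rho> \<Longrightarrow> bump y \<rho> x = \<rho>"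
  by (auto simp: bump_def)

lemma abs_bump_diff_le: "\<bar>bump y \<rho> x - bump y \<rho> x'\<bar> \<le> dist x x'"
proof -
  have "\<bar>dist x y - dist x' y\<bar> \<le> dist x x'"
    using dist_triangle[of x y x'] dist_triangle[of x' y x] by (auto simp: dist_commute)
  then show ?thesis by (auto simp: bump_def)
qed

lemma continuous_on_bump: "continuous_on S (bump y \<rho>)"
  unfolding bump_def by (intro continuous_intros)

lemma not_achieves_rate_lower:
  fixes M :: "'a::metric_space measure" and d \<gamma> :: real
  assumes "compact (space M)" and sets: "sets (restrict_space borel (space M)) \<subseteq> sets M"
    and d: "ereal d < MaxMinCOV (space M)" "0 \<le> d" and \<gamma>: "1 < (1 - \<gamma>) * (d + 2)"
    and A: "bandit_algorithm M A"
  shows "\<not> achieves_rate M A \<gamma>"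
proof
  assume rate: "achieves_rate M A \<gamma>"
  obtain Y where Y: "Y \<noteq> {}" "Y \<subseteq> space M" "ereal d < MinCOV Y"
    using d(1) unfolding MaxMinCOV_def less_Sup_iff by auto
  have YU: "ereal d < COV U" if "U \<noteq> {}" "openin (top_of_set Y) U" for U
  proof -
    have "MinCOV Y \<le> COV U"
      unfolding MinCOV_def using that by (intro Inf_lower) auto
    with Y(3) show ?thesis by simp
  qed
  obtain y0 where y0: "y0 \<in> Y" using Y by auto
  \<comment> \<open>All \<open>\<kappa> n\<close> sum to 1/4, and those from \<open>n\<close> on to
    \<open>(1/2) ^ (n + 2)\<close>, the margin kept in \<open>good\<close>. This keeps payoffs below
    3/4 and gives the limit the Lipschitz constant 1/4.\<close>
  define \<kappa> where "\<kappa> n = (1/2::real) ^ (n + 3)" for n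
  have \<kappa>: "0 < \<kappa> n" "\<kappa> n \<le> 1" for n
    by (auto simp: \<kappa>_def power_le_one)
  define pulls where "pulls \<mu> B t =
    (\<integral>h. (\<Sum>s<t. indicator B (fst (h s)) :: real) \<partial>history_law M A (\<lambda>x. bernoulli_dist (\<mu> x)) t)"
    for \<mu> and B :: "'a set" and t
  define good where "good n s \<longleftrightarrow> (case s of (\<mu> :: 'a \<Rightarrow> real, y, \<rho> :: real) \<Rightarrow>
      continuous_on (space M) \<mu> \<and> (\<forall>x. 1/2 \<le> \<mu> x \<and> \<mu> x \<le> 3/4 - (1/2) ^ (n + 2)) \<and>
      y \<in> Y \<and> 0 < \<rho> \<and> \<rho> \<le> 1)" for n s
  \<comment> \<open>At stage \<open>n\<close> the constant to be beaten is \<open>n\<close> itself,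
    so that the limit eventually defeats every fixed constant.\<close>
  define next_state where "next_state n s s' \<longleftrightarrow> (case s of (\<mu> :: 'a \<Rightarrow> real, y :: 'a, \<rho> :: real) \<Rightarrow>
      case s' of (\<mu>' :: 'a \<Rightarrow> real, y', \<rho>') \<Rightarrow>
      \<mu>' = (\<lambda>x. \<mu> x + \<kappa> n * bump y' \<rho>' x) \<and> dist y y' + 2 * \<rho>' \<le> \<rho> \<and>
      (\<exists>t\<ge>1. pulls \<mu> (ball y' (2 * \<rho>')) t \<le> real t / 2 \<and>
        24 * (\<kappa> n * \<rho>')\<^sup>2 * pulls \<mu> (ball y' (2 * \<rho>')) t \<le> 1 / 64 \<and>
        real n * real t powr \<gamma> \<le> real t * (\<kappa> n * \<rho>')))" for n s s'
  have "\<exists>f. \<forall>n. good n (f n) \<and> next_state n (f n) (f (Suc n))"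
  proof (rule dependent_nat_choice)
    show "\<exists>s. good 0 s"
      using y0 by (intro exI[of _ "(\<lambda>_. 1/2, y0, 1)"]) (auto simp: good_def power2_eq_square)
    fix s n assume "good n s"
    then obtain \<mu> y \<rho> where s: "s = (\<mu>, y, \<rho>)" and \<mu>: "continuous_on (space M) \<mu>"
        "\<And>x. 1/2 \<le> \<mu> x \<and> \<mu> x \<le> 3/4 - (1/2) ^ (n + 2)" and y: "y \<in> Y" "0 < \<rho>" "\<rho> \<le> 1"
      by (auto simp: good_def split: prod.splits)
    have \<mu>01: "0 \<le> \<mu> x \<and> \<mu> x \<le> 1" for x
      using \<mu>(2)[of x] zero_le_power[of "1/2::real" "n + 2"] by linarith
    have P: "(\<lambda>x. bernoulli_dist (\<mu> x)) \<in> M \<rightarrow>\<^sub>M prob_algebra borel"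
      using \<mu>01 by (intro bernoulli_dist_kernel borel_measurable_of_continuous_on[OF sets \<mu>(1)]) auto
    obtain y' \<rho>' t where n: "y' \<in> Y" "0 < \<rho>'" "dist y y' + 2 * \<rho>' \<le> \<rho>" "1 \<le> t"
      "pulls \<mu> (ball y' (2 * \<rho>')) t \<le> real t / 2"
      "24 * (\<kappa> n * \<rho>')\<^sup>2 * pulls \<mu> (ball y' (2 * \<rho>')) t \<le> 1 / 64"
      "real n * real t powr \<gamma> \<le> real t * (\<kappa> n * \<rho>')"
      unfolding pulls_def
      using perturbation_step[OF assms(1) sets A P Y(2) YU d(2) \<gamma> y(1,2) \<kappa>[of n]] by blast
    have \<rho>': "\<rho>' \<le> 1" using n(2,3) y(3) zero_le_dist[of y y'] by linarith
    let ?s = "(\<lambda>x. \<mu> x + \<kappa> n * bump y' \<rho>' x, y', \<rho>')"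
    have "1/2 \<le> \<mu> x + \<kappa> n * bump y' \<rho>' x \<and> \<mu> x + \<kappa> n * bump y' \<rho>' x \<le> 3/4 - (1/2) ^ (Suc n + 2)" for x
    proof -
      have "0 \<le> bump y' \<rho>' x" "bump y' \<rho>' x \<le> 1"
        using bump_bounds[of \<rho>' y' x] n(2) \<rho>' by auto
      then have "0 \<le> \<kappa> n * bump y' \<rho>' x" "\<kappa> n * bump y' \<rho>' x \<le> \<kappa> n"
        using \<kappa>[of n] by (auto simp: mult_left_le)
      moreover have "(1/2::real) ^ (n + 2) = \<kappa> n + (1/2) ^ (Suc n + 2)"
        by (simp add: \<kappa>_def power_add power3_eq_cube)
      ultimately show ?thesis using \<mu>(2)[of x] by linarith
    qed
    then have "good (Suc n) ?s"
      unfolding good_def using \<mu>(1) n(1,2) \<rho>' by (auto intro!: continuous_intros continuous_on_bump)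
    moreover have "next_state n s ?s"
      unfolding next_state_def s using n by auto
    ultimately show "\<exists>s'. good (Suc n) s' \<and> next_state n s s'" by blast
  qed
  then obtain f where f: "\<And>n. good n (f n)" "\<And>n. next_state n (f n) (f (Suc n))" by blast
  define m y \<rho> where "m n = fst (f n)" and "y n = fst (snd (f n))" and "\<rho> n = snd (snd (f n))" for n
  have f_eq: "f n = (m n, y n, \<rho> n)" for n by (simp add: m_def y_def \<rho>_def)
  have g: "continuous_on (space M) (m n)" "1/2 \<le> m n x" "m n x \<le> 3/4 - (1/2) ^ (n + 2)"
    "y n \<in> Y" "0 < \<rho> n" "\<rho> n \<le> 1" for n x
    using f(1)[of n] unfolding good_def f_eq by auto
  define b where "b n x = \<kappa> n * bump (y (Suc n)) (\<rho> (Suc n)) x" for n x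
  define H where "H n = \<kappa> n * \<rho> (Suc n)" for n
  have step: "m (Suc n) = (\<lambda>x. m n x + b n x)" "dist (y n) (y (Suc n)) + 2 * \<rho> (Suc n) \<le> \<rho> n" for n
    using f(2)[of n] unfolding next_state_def f_eq b_def by auto
  have "\<exists>t\<ge>1. pulls (m n) (ball (y (Suc n)) (2 * \<rho> (Suc n))) t \<le> real t / 2 \<and>
      24 * (H n)\<^sup>2 * pulls (m n) (ball (y (Suc n)) (2 * \<rho> (Suc n))) t \<le> 1 / 64 \<and>
      real n * real t powr \<gamma> \<le> real t * H n" for n
    using f(2)[of n] unfolding next_state_def f_eq H_def by auto
  then obtain t where t: "\<And>n. 1 \<le> t n"
      "\<And>n. pulls (m n) (ball (y (Suc n)) (2 * \<rho> (Suc n))) (t n) \<le> real (t n) / 2"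
      "\<And>n. 24 * (H n)\<^sup>2 * pulls (m n) (ball (y (Suc n)) (2 * \<rho> (Suc n))) (t n) \<le> 1 / 64"
      "\<And>n. real n * real (t n) powr \<gamma> \<le> real (t n) * H n"
    by metis
  have H0: "0 < H n" for n using \<kappa>[of n] g(5)[of "Suc n"] by (simp add: H_def)
  have b: "0 \<le> b n x" "b n x \<le> H n" for n x
    using bump_bounds[of "\<rho> (Suc n)" "y (Suc n)" x] g(5)[of "Suc n"] \<kappa>[of n] by (auto simp: b_def H_def)
  have H\<kappa>: "H n \<le> \<kappa> n" for n
    using g(6)[of "Suc n"] g(5)[of "Suc n"] \<kappa>[of n] by (simp add: H_def mult_left_le)
  have sum\<kappa>: "summable \<kappa>" "suminf \<kappa> = 1/4"
  proof -
    have "(\<lambda>n. (1/8) * (1/2::real) ^ n) sums ((1/8) * (1 / (1 - 1/2)))"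
      by (intro sums_mult geometric_sums) simp
    moreover have "\<kappa> = (\<lambda>n. (1/8) * (1/2::real) ^ n)"
      by (auto simp: \<kappa>_def power_add fun_eq_iff power3_eq_cube)
    ultimately have "\<kappa> sums (1/4)" by simp
    then show "summable \<kappa>" "suminf \<kappa> = 1/4" by (auto simp: sums_iff)
  qed
  have b\<kappa>: "b n x \<le> \<kappa> n" for n x
    by (rule order_trans[OF b(2) H\<kappa>])
  have sb: "summable (\<lambda>n. b n x)" for x
    using b(1) b\<kappa> by (intro summable_comparison_test'[OF sum\<kappa>(1), of 0]) auto
  \<comment> \<open>For \<open>n = 0\<close> the two bounds of \<open>good\<close> coincide and pin
    the first payoff to 1/2.\<close>
  have m0: "m 0 x = 1/2" for x
    using g(2,3)[where n = 0 and x = x] by (simp add: power2_eq_square)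
  define \<nu> where "\<nu> x = 1/2 + (\<Sum>n. b n x)" for x
  have m_eq: "m n x = 1/2 + (\<Sum>j<n. b j x)" for n x
    by (induction n) (auto simp: step(1) m0)
  have \<nu>_eq: "\<nu> x = m n x + (\<Sum>j. b (j + n) x)" for n x
    unfolding \<nu>_def m_eq[of n] using suminf_split_initial_segment[OF sb[of x], of n] by simp
  \<comment> \<open>The radii decrease and \<open>\<kappa>\<close> halves, so the bumps from
    \<open>n\<close> on are dominated by a geometric series with sum \<open>2 * H n\<close>, the
    deviation that the perturbation estimate tolerates.\<close>
  have tail: "0 \<le> (\<Sum>j. b (j + n) x)" "(\<Sum>j. b (j + n) x) \<le> 2 * H n" for n x
  proof -
    have s: "summable (\<lambda>j. b (j + n) x)" using sb[of x] by (rule summable_ignore_initial_segment)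
    show "0 \<le> (\<Sum>j. b (j + n) x)" by (rule suminf_nonneg[OF s b(1)])
    have \<rho>_mono: "\<rho> (Suc (j + n)) \<le> \<rho> (Suc n)" for j
    proof (induction j)
      case (Suc j)
      have "\<rho> (Suc (Suc j + n)) \<le> \<rho> (Suc (j + n))"
        using step(2)[of "Suc (j + n)"] g(5)[of "Suc (Suc (j + n))"]
          zero_le_dist[of "y (Suc (j + n))" "y (Suc (Suc (j + n)))"] unfolding add_Suc by linarith
      with Suc show ?case by simp
    qed simp
    have le: "b (j + n) x \<le> H n * (1/2) ^ j" for j
    proof -
      have "b (j + n) x \<le> \<kappa> (j + n) * \<rho> (Suc (j + n))" using b(2) by (simp add: H_def)
      also have "\<dots> \<le> \<kappa> (j + n) * \<rho> (Suc n)"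
        using \<rho>_mono \<kappa> by (intro mult_left_mono) (auto intro: less_imp_le)
      also have "\<dots> = H n * (1/2) ^ j" by (simp add: H_def \<kappa>_def power_add)
      finally show ?thesis .
    qed
    have geo: "(\<lambda>j. H n * (1/2::real) ^ j) sums (H n * (1 / (1 - 1/2)))"
      by (intro sums_mult geometric_sums) simp
    have "(\<Sum>j. b (j + n) x) \<le> (\<Sum>j. H n * (1/2) ^ j)"
      using geo by (intro suminf_le le s) (auto simp: sums_iff)
    also have "\<dots> = 2 * H n" using geo by (simp add: sums_iff)
    finally show "(\<Sum>j. b (j + n) x) \<le> 2 * H n" .
  qed
  have \<nu>_range: "1/4 \<le> \<nu> x \<and> \<nu> x \<le> 3/4" for x
  proof -
    have "(\<Sum>n. b n x) \<le> (\<Sum>n. \<kappa> n)"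
      by (intro suminf_le sb sum\<kappa>(1) b\<kappa>)
    moreover have "0 \<le> (\<Sum>n. b n x)" by (rule suminf_nonneg[OF sb b(1)])
    ultimately show ?thesis using sum\<kappa>(2) by (simp add: \<nu>_def)
  qed
  have \<nu>_lip: "1-lipschitz_on (space M) \<nu>"
  proof (rule lipschitz_onI)
    fix x x' :: 'a
    have bd: "\<bar>b n x - b n x'\<bar> \<le> \<kappa> n * dist x x'" for n
      using abs_bump_diff_le[of "y (Suc n)" "\<rho> (Suc n)" x x'] \<kappa>[of n]
      by (simp add: b_def right_diff_distrib[symmetric] abs_mult)
    have s: "summable (\<lambda>n. \<bar>b n x - b n x'\<bar>)"
      using bd by (intro summable_comparison_test'[OF summable_mult2[OF sum\<kappa>(1), of "dist x x'"], of 0]) auto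
    have "\<nu> x - \<nu> x' = (\<Sum>n. b n x - b n x')"
      unfolding \<nu>_def using suminf_diff[OF sb[of x] sb[of x']] by simp
    then have "\<bar>\<nu> x - \<nu> x'\<bar> \<le> (\<Sum>n. \<bar>b n x - b n x'\<bar>)"
      using summable_rabs[OF s] by simp
    also have "\<dots> \<le> (\<Sum>n. \<kappa> n * dist x x')"
      by (intro suminf_le bd s summable_mult2 sum\<kappa>(1))
    also have "\<dots> = 1/4 * dist x x'"
      using suminf_mult2[OF sum\<kappa>(1), of "dist x x'"] sum\<kappa>(2) by simp
    also have "\<dots> \<le> 1 * dist x x'" by (intro mult_right_mono) auto
    finally show "dist (\<nu> x) (\<nu> x') \<le> 1 * dist x x'" by (simp add: dist_real_def)
  qed simp
  have \<nu>_meas: "\<nu> \<in> borel_measurable M"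
    by (rule borel_measurable_of_continuous_on[OF sets lipschitz_on_continuous_on[OF \<nu>_lip]])
  have \<nu>01: "0 \<le> \<nu> x \<and> \<nu> x \<le> 1" for x
    using \<nu>_range[of x] by auto
  have \<nu>_P: "(\<lambda>x. bernoulli_dist (\<nu> x)) \<in> M \<rightarrow>\<^sub>M prob_algebra borel"
    by (rule bernoulli_dist_kernel[OF \<nu>_meas \<nu>01])
  have inst: "lipschitz_instance M \<nu> (\<lambda>x. bernoulli_dist (\<nu> x))"
    unfolding lipschitz_instance_def
  proof (intro conjI ballI \<nu>_lip \<nu>_P)
    fix x
    show "0 \<le> \<nu> x" "\<nu> x \<le> 1" using \<nu>_range[of x] by auto
    show "AE y in bernoulli_dist (\<nu> x). 0 \<le> y \<and> y \<le> 1"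
      unfolding bernoulli_dist_def by (rule AE_finite_dist) auto
    show "(\<integral>y. y \<partial>bernoulli_dist (\<nu> x)) = \<nu> x"
      using \<nu>_range[of x] by (subst integral_bernoulli_dist) auto
  qed
  obtain C where C: "\<And>t. 1 \<le> t \<Longrightarrow> regret M A \<nu> (\<lambda>x. bernoulli_dist (\<nu> x)) t \<le> C * real t powr \<gamma>"
    using rate inst unfolding achieves_rate_def by blast
  \<comment> \<open>The support of each bump lies in the plateau of the preceding one: where a later
    bump is nonzero, all earlier ones have full height.\<close>
  have nest1: "ball (y (Suc n)) (2 * \<rho> (Suc n)) \<subseteq> ball (y n) (\<rho> n)" for n
  proof
    fix x assume "x \<in> ball (y (Suc n)) (2 * \<rho> (Suc n))"
    then show "x \<in> ball (y n) (\<rho> n)"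
      using step(2)[of n] dist_triangle[of "y n" x "y (Suc n)"] by simp
  qed
  have nest: "ball (y j) (2 * \<rho> j) \<subseteq> ball (y n) (2 * \<rho> n)" if "n \<le> j" for n j
    using that
  proof (induction j rule: dec_induct)
    case (step j)
    have "ball (y j) (\<rho> j) \<subseteq> ball (y j) (2 * \<rho> j)"
      using g(5)[of j] by (intro subset_ball) auto
    with step nest1[of j] show ?case by blast
  qed simp
  have bound: "real n / 4 \<le> C" for n
  proof -
    let ?B = "ball (y (Suc n)) (2 * \<rho> (Suc n))" and ?Q = "history_law M A (\<lambda>x. bernoulli_dist (m n x)) (t n)"
    let ?c = "SUP x\<in>space M. \<nu> x"
    have bdd: "bdd_above (\<nu> ` space M)"
      using \<nu>_range by (auto intro!: bdd_aboveI2[where M = "3/4"])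
    have yM: "y (Suc n) \<in> space M" using g(4) Y(2) by auto
    have m_range: "1/4 \<le> m n x \<and> m n x \<le> 3/4" for x
      using g(2)[of n x] g(3)[of n x] zero_le_power[of "1/2::real" "n + 2"] by linarith
    have m_meas: "m n \<in> borel_measurable M"
      by (rule borel_measurable_of_continuous_on[OF sets g(1)])
    have outside: "b j x = 0" if "x \<notin> ?B" "n \<le> j" for j x
    proof -
      have "x \<notin> ball (y (Suc j)) (2 * \<rho> (Suc j))"
        using nest[of "Suc n" "Suc j"] that by auto
      then show ?thesis by (simp add: b_def bump_eq_0)
    qed
    have eq: "\<nu> x = m n x" if "x \<notin> ?B" for x
      unfolding \<nu>_eq[of x n] using outside[OF that] by simp
    have peak: "b j (y (Suc n)) = H j" if "j \<le> n" for j
    proof -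
      have "dist (y (Suc n)) (y (Suc j)) \<le> \<rho> (Suc j)"
      proof (cases "j = n")
        case True
        then show ?thesis using g(5)[of "Suc n"] by simp
      next
        case False
        then have "ball (y (Suc n)) (2 * \<rho> (Suc n)) \<subseteq> ball (y (Suc (Suc j))) (2 * \<rho> (Suc (Suc j)))"
          using that by (intro nest) auto
        then have "y (Suc n) \<in> ball (y (Suc j)) (\<rho> (Suc j))"
          using nest1[of "Suc j"] g(5)[of "Suc n"] by (meson centre_in_ball mult_pos_pos subsetD zero_less_numeral)
        then show ?thesis by (simp add: dist_commute)
      qed
      then show ?thesis
        using g(5)[of "Suc j"] by (simp add: b_def H_def bump_eq_height)
    qed
    \<comment> \<open>The supremum is at least the value at \<open>y (Suc n)\<close>, where the
      bumps 0 to \<open>n\<close> all have full height.\<close>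
    have top: "1/2 + (\<Sum>j<n. H j) + H n \<le> ?c"
    proof -
      have "1/2 + (\<Sum>j<n. H j) + H n = m (Suc n) (y (Suc n))"
        unfolding m_eq using peak by simp
      also have "\<dots> \<le> \<nu> (y (Suc n))"
        using \<nu>_eq[of "y (Suc n)" "Suc n"] tail(1)[where n = "Suc n" and x = "y (Suc n)"] by linarith
      also have "\<dots> \<le> ?c" by (rule cSUP_upper[OF yM bdd])
      finally show ?thesis .
    qed
    have "real (t n) * H n / 4 \<le>
      (\<integral>h. (\<Sum>s<t n. ?c - \<nu> (fst (h s))) \<partial>history_law M A (\<lambda>x. bernoulli_dist (\<nu> x)) (t n))"
    proof (rule regret_ge_of_perturbation[OF A m_meas \<nu>_meas m_range \<nu>_range, where B = "?B \<inter> space M"])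
      show "?B \<inter> space M \<in> sets M"
        by (rule subsetD[OF sets], unfold sets_restrict_space) (rule image_eqI[of _ _ ?B], auto)
      show "0 \<le> H n" using H0[of n] by simp
      show "\<nu> x = m n x" if "x \<in> space M" "x \<notin> ?B \<inter> space M" for x
        using eq that by auto
      show "\<bar>m n x - \<nu> x\<bar> \<le> 2 * H n" for x
        using \<nu>_eq[of x n] tail[where n = n and x = x] by simp
      show "\<nu> x \<le> ?c" if "x \<in> space M" for x by (rule cSUP_upper[OF that bdd])
      \<comment> \<open>Outside \<open>?B\<close> bump \<open>n\<close> and all later ones vanish,
        so the payoff stays at least \<open>H n\<close> below the level in
        \<open>top\<close>.\<close>
      show "\<nu> x + H n \<le> ?c" if "x \<in> space M" "x \<notin> ?B \<inter> space M" for x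
      proof -
        have "\<nu> x = 1/2 + (\<Sum>j<n. b j x)"
          using eq that m_eq by auto
        also have "\<dots> \<le> 1/2 + (\<Sum>j<n. H j)"
          by (intro add_left_mono sum_mono b(2))
        finally show ?thesis using top by simp
      qed
      show "1 \<le> t n" by (rule t(1))
      have "pulls (m n) (?B \<inter> space M) (t n) = pulls (m n) ?B (t n)"
        unfolding pulls_def
      proof (intro Bochner_Integration.integral_cong refl sum.cong)
        fix h s assume "h \<in> space ?Q" "s \<in> {..<t n}"
        then have "fst (h s) \<in> space M"
          using sets_eq_imp_space_eq[OF sets_history_law(1)[OF A bernoulli_kernels(1)[OF A m_meas \<nu>_meas m_range \<nu>_range], of "t n"]]
            history_arm_in_space[of h "t n" M s] by simp
        then show "indicator (?B \<inter> space M) (fst (h s)) = (indicator ?B (fst (h s)) :: real)"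
          by (simp add: indicator_def)
      qed
      then show "(\<integral>h. (\<Sum>s<t n. indicator (?B \<inter> space M) (fst (h s))) \<partial>?Q) \<le> real (t n) / 2"
        "24 * (H n)\<^sup>2 * (\<integral>h. (\<Sum>s<t n. indicator (?B \<inter> space M) (fst (h s))) \<partial>?Q) \<le> 1 / 64"
        using t(2,3)[of n] unfolding pulls_def by simp_all
    qed
    also have "\<dots> = regret M A \<nu> (\<lambda>x. bernoulli_dist (\<nu> x)) (t n)"
      unfolding regret_def
      by (rule regret_eq_integral(1)[OF A \<nu>_P \<nu>_meas \<nu>01, symmetric])
    also have "\<dots> \<le> C * real (t n) powr \<gamma>" by (rule C[OF t(1)])
    finally have "real (t n) * H n / 4 \<le> C * real (t n) powr \<gamma>" .
    with t(4)[of n] have "real n / 4 * real (t n) powr \<gamma> \<le> C * real (t n) powr \<gamma>" by simp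
    moreover have "0 < real (t n) powr \<gamma>" using t(1)[of n] by simp
    ultimately show ?thesis by simp
  qed
  obtain n where "4 * C < real n" using reals_Archimedean2 by blast
  with bound[of n] show False by simp
qed

section \<open>The remaining range of exponents and the combination of both bounds\<close>

lemma MaxMinCOV_nonneg:
  fixes X :: "'a::metric_space set"
  assumes "X \<noteq> {}"
  shows "0 \<le> MaxMinCOV X"
proof -
  have "0 \<le> COV U" for U :: "'a set"
    unfolding COV_def by (rule Inf_greatest) auto
  then have "0 \<le> MinCOV X"
    unfolding MinCOV_def by (intro Inf_greatest) auto
  also have "\<dots> \<le> MaxMinCOV X"
    unfolding MaxMinCOV_def using assms by (intro Sup_upper) auto
  finally show ?thesis .
qed

text \<open>Regret never exceeds \<open>t\<close>, so playing one fixed arm suffices. This settles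
  \<open>d = \<infinity>\<close>, where the critical exponent is 1.\<close>

lemma achieves_rate_ge_1:
  fixes M :: "'a::metric_space measure"
  assumes "space M \<noteq> {}" "sets (restrict_space borel (space M)) \<subseteq> sets M" "1 \<le> \<gamma>"
  shows "\<exists>A. bandit_algorithm M A \<and> achieves_rate M A \<gamma>"
proof -
  obtain x where x: "x \<in> space M" using assms(1) by auto
  define A :: "'a algorithm" where "A = (\<lambda>t h. return M x)"
  have A: "bandit_algorithm M A"
    unfolding bandit_algorithm_def A_def
    using x by (auto intro!: measurable_const simp: space_prob_algebra prob_space_return)
  have "regret M A \<mu> P t \<le> 1 * real t powr \<gamma>" if "lipschitz_instance M \<mu> P" "1 \<le> t" for \<mu> P t
  proof -
    have "regret M A \<mu> P t \<le> real t powr 1"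
      using regret_le[OF A that(1) assms(2,1), of t] that(2) by simp
    also have "\<dots> \<le> real t powr \<gamma>"
      using assms(3) that(2) by (intro powr_mono) auto
    finally show ?thesis by simp
  qed
  then have "achieves_rate M A \<gamma>"
    unfolding achieves_rate_def by blast
  with A show ?thesis by blast
qed

theorem theorem1p5:
  fixes X :: "'a::metric_space set" and M :: "'a measure" and d :: ereal and \<gamma> :: real
  assumes "compact X" and "X \<noteq> {}" and "diameter X \<le> 1"
    and "space M = X" and "sets (restrict_space borel X) \<subseteq> sets M"
    and "d = MaxMinCOV X"
  shows "(\<gamma> > critical_exponent d \<longrightarrow>
            (\<exists>A. bandit_algorithm M A \<and> achieves_rate M A \<gamma>)) \<and>
         (d > 0 \<and> \<gamma> < critical_exponent d \<longrightarrow>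
            \<not> (\<exists>A. bandit_algorithm M A \<and> achieves_rate M A \<gamma>))"
proof (intro conjI impI)
  have X: "compact (space M)" "space M \<noteq> {}" "sets (restrict_space borel (space M)) \<subseteq> sets M"
    using assms by auto
  have d0: "0 \<le> d" using MaxMinCOV_nonneg[OF assms(2)] assms(6) by simp
  have d_real: "\<exists>e\<ge>0. d = ereal e \<and> critical_exponent d = (e + 1) / (e + 2)" if "d \<noteq> \<infinity>"
    using that d0 by (cases d) (auto simp: critical_exponent_def)
  \<comment> \<open>For finite \<open>d = ereal e\<close>, the condition
    \<open>\<gamma> > (e + 1) / (e + 2)\<close> becomes \<open>\<beta> * (e + 2) < 1\<close>, and
    likewise with both inequalities reversed.\<close>
  define \<beta> where "\<beta> = 1 - \<gamma>"
  {
    assume upper: "critical_exponent d < \<gamma>"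
    show "\<exists>A. bandit_algorithm M A \<and> achieves_rate M A \<gamma>"
    proof (cases "1 \<le> \<gamma>")
      case True
      then show ?thesis by (rule achieves_rate_ge_1[OF X(2,3)])
    next
      case False
      then have "d \<noteq> \<infinity>" using upper by (auto simp: critical_exponent_def)
      then obtain e where e: "0 \<le> e" "d = ereal e" "(e + 1) / (e + 2) < \<gamma>"
        using d_real upper by auto
      have \<beta>: "0 < \<beta>" using False by (simp add: \<beta>_def)
      have "e + 1 < \<gamma> * (e + 2)" using e by (simp add: field_simps)
      then have "\<beta> * (e + 2) < 1" by (simp add: \<beta>_def algebra_simps)
      then have e\<beta>: "e < 1 / \<beta> - 2" using \<beta> by (simp add: field_simps)
      \<comment> \<open>The midpoint leaves strict room on both sides: above the dimension
        \<open>e\<close>, and below the dimension at which the exponent \<open>1 - \<beta>\<close>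
        is critical.\<close>
      define d' where "d' = (e + (1 / \<beta> - 2)) / 2"
      have d': "e < d'" "d' < 1 / \<beta> - 2" using e\<beta> by (auto simp: d'_def)
      have "\<beta> * (d' + 2) < 1" using d'(2) \<beta> by (simp add: field_simps)
      moreover have "MaxMinCOV (space M) < ereal d'" using d'(1) e(2) assms by simp
      ultimately have "\<exists>A. bandit_algorithm M A \<and> achieves_rate M A (1 - \<beta>)"
        using d'(1) e(1) \<beta> by (intro achieves_rate_upper[OF X]) auto
      then show ?thesis by (simp add: \<beta>_def)
    qed
  next
    assume lower: "0 < d \<and> \<gamma> < critical_exponent d"
    have "\<exists>d'\<ge>0. ereal d' < d \<and> 1 < \<beta> * (d' + 2)"
    proof (cases "d = \<infinity>")
      case True
      then have "0 < \<beta>" using lower by (simp add: critical_exponent_def \<beta>_def)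
      \<comment> \<open>For \<open>d' = 1 / \<beta>\<close> the product is
        \<open>1 + 2 * \<beta>\<close>.\<close>
      then show ?thesis
        using True by (intro exI[of _ "1 / \<beta>"]) (auto simp: field_simps)
    next
      case False
      then obtain e where e: "d = ereal e" "\<gamma> < (e + 1) / (e + 2)"
        using d_real lower by auto
      have e0: "0 < e" using lower e by simp
      have "\<gamma> * (e + 2) < e + 1" using e e0 by (simp add: field_simps)
      then have "1 < \<beta> * (e + 2)" by (simp add: \<beta>_def algebra_simps)
      moreover from this have \<beta>: "0 < \<beta>"
        using e0 by (smt (verit) mult_nonpos_nonneg)
      ultimately have e\<beta>: "1 / \<beta> - 2 < e" by (simp add: field_simps)
      \<comment> \<open>The midpoint can be negative, hence the maximum with 0; that 0 itself lies
        below \<open>e\<close> is where \<open>d > 0\<close> enters.\<close>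
      define d' where "d' = max 0 ((e + (1 / \<beta> - 2)) / 2)"
      have d': "0 \<le> d'" "d' < e" "1 / \<beta> - 2 < d'"
        using e\<beta> e0 by (auto simp: d'_def max_def)
      have "1 < \<beta> * (d' + 2)" using d'(3) \<beta> by (simp add: field_simps)
      then show ?thesis using d' e by auto
    qed
    then obtain d' where d': "0 \<le> d'" "ereal d' < MaxMinCOV (space M)" "1 < (1 - \<gamma>) * (d' + 2)"
      using assms(4,6) by (auto simp: \<beta>_def)
    show "\<not> (\<exists>A. bandit_algorithm M A \<and> achieves_rate M A \<gamma>)"
      using not_achieves_rate_lower[OF X(1,3) d'(2,1,3)] by blast
  }
qed

end
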